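(* Let $C_u$ be the AG code on a Miura–Kamiya curve described in the context, with $0<u<n$. Let $v=c+e\in\mathbb{F}^n$ be a received vector, where $c=\mathrm{ev}(\mu)\in C_u$ is the sent codeword, $\mu=\sum_{s\in S,\,s\le u}\omega_s\varphi_s$ with $\omega_s\in\mathbb{F}$, and $e\in\mathbb{F}^n$ is the error vector. For $s\in S$ let $\nu(s)=|\Delta(J)\cup\Delta(R\varphi_s)|-s$. The Interpolation Decoding Algorithm (described in the context), applied to $v$, outputs $w^{(s)}=\omega_s$ for all $s\in S$, $s\le u$, if $$d_u=\min_{s\in S,\ s\le u}\nu(s)>2\,\mathrm{wt}(e).$$ Moreover, $d_u\ge n-u$.
   Context: **Curve.** Let $\mathbb{F}$ be a field, $a,b$ positive integers with $\gcd(a,b)=1$, and $X$ a Miura–Kamiya curve, i.e. an irreducible plane curve $y^a+\sum_{ai+bj<ab}c_{i,j}x^iy^j+dx^b=0$ over $\mathbb{F}$ with $0\ne d\in\mathbb{F}$. Let $R=\mathbb{F}[x,y]$ be its coordinate ring (generated by the classes $x,y$). $X$ has a unique point $P_\infty$ at infinity, with a unique associated valuation $v_{P_\infty}$; put $\delta(f)=-v_{P_\infty}(f)$ for $f\in R$. The elements $x^iy^j$, $i\ge0$, $0\le j<a$, called the monomials of $R$, form an $\mathbb{F}$-basis of $R$, with $\delta(x^iy^j)=ai+bj$; these values are pairwise distinct. Let $S=\{\delta(f): 0\ne f\in R\}=\langle a,b\rangle$ (the numerical semigroup generated by $a,b$). Elements of $S$ are called nongaps, other nonnegative integers gaps. For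 $s\in S$, $\varphi_s$ is the unique monomial of $R$ with $\delta(\varphi_s)=s$. For $f\in R\setminus\{0\}$, $\mathrm{lm}(f)=\varphi_{\delta(f)}$, and $\mathrm{lc}(f)$ is its coefficient in $f$. **Code.** Let $P_1,\dots,P_n$ be distinct nonsingular ($\mathbb{F}$-rational, affine) points of $X$, $\mathrm{ev}:R\to\mathbb{F}^n$, $\mathrm{ev}(f)=(f(P_1),\dots,f(P_n))$, $u$ a positive integer with $u<n$, $L_u=\{f\in R:\delta(f)\le u\}=\mathrm{span}_{\mathbb F}\{\varphi_s: s\in S,s\le u\}$, and $C_u=\mathrm{ev}(L_u)$ ($\mathrm{ev}$ is injective on $L_u$). Let $\mathfrak{m}_i$ be the maximal ideal of $R$ of $P_i$ and $J=\bigcap_{i=1}^n\mathfrak{m}_i$. $\mathrm{wt}$ is Hamming weight. **Divisibility, quotients, lcm.** $\varphi_s$ divides $\varphi_t$ (written $\varphi_s\mid\varphi_t$; also "$s$ divides $t$") if there is a unique monomial $\lambda$ of $R$ with $\delta(\varphi_t-\lambda\varphi_s)<\delta(\varphi_t)$; this $\lambda$ is denoted by the quotient $\varphi_t/\varphi_s$. $\varphi_s$ divides $\varphi_t$ if and only if $t-s$ is a nongap, and in this case $\varphi_t/\varphi_s=\varphi_{t-s}$. If neither of $s,t\in S$ divides the other, there are unique nongaps $l_1,l_2$ such that both are divisible by $s$ and $t$ and every nongap divisible by $s$ and $t$ is divisible by $l_1$ or $l_2$; $\varphi_{l_1},\varphi_{l_2}$ are called the lcms of $\varphi_s,\varphi_t$.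 If $\varphi_s\mid\varphi_t$, the lcm is $\varphi_t$. **Monomial orders on $Rz\oplus R$.** Elements are $f=f^Uz+f^D$ with $f^U,f^D\in R$. Monomials are $\varphi_tz$ and $\varphi_t$, $t\in S$; divisibility is only between two monomials in $Rz$ or two monomials in $R$, as for the $\varphi_t$. For an integer $s$, the order $>_s$ compares monomials by weighted degree ($t+s$ for $\varphi_tz$, $t$ for $\varphi_t$), ties being broken in favour of the one in $Rz$. $\mathrm{lm}_s,\mathrm{lc}_s,\mathrm{lt}_s$ are leading monomial, coefficient and term w.r.t. $>_s$; division by a term $\kappa\varphi_t$ means $\kappa^{-1}$ times division by $\varphi_t$. A Gröbner basis of an $R$-submodule $M$ w.r.t. $>_s$ is a subset of $M$ such that the leading term of every (nonzero) element of $M$ is divisible by that of some element of the subset; it is written $\{G_i,F_j\}$ where $\mathrm{lm}_s(G_i)\in R$, $\mathrm{lm}_s(F_j)\in Rz$. For an ideal $I$ of $R$, $\Delta(I)$ is the set of monomials of $R$ that are not leading monomials of elements of $I$ (Gröbner bases of $I$ are defined analogously). For $f\in R\setminus\{0\}$, $\Sigma(f)$ is the set of monomials of $R$ divisible by $\mathrm{lm}(f)$; for a set $T\subset R\setminus\{0\}$, $\Delta(T)$ is the set of monomials of $R$ divisible by no $\mathrm{lm}(f)$, $f\in T$. For $f\in Rz\oplus R$ and $g\in R$, $f(z+g)=f^Uz+f^Ug+f^D$. **Interpolation Decoding Algorithm.** Input $v\in\mathbb{F}^n$. *Initialize.* Compute $h_v\in R$ with $\mathrm{ev}(h_v)=v$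 (by Lagrange interpolation). Let $\{\eta_i\}$ be a Gröbner basis of $J$, and let $B^{(N)}=\{\eta_i\}\cup\{z-h_v\}$ where $N=\delta(h_v)$. *Main.* Repeat the following for $s$ from $N$ to $0$, with $B^{(s)}=\{G_i,F_j\}$ (classified w.r.t. $>_s$): M1. If $s$ is a nongap $\le u$, do the following; otherwise let $\tilde B=B^{(s)}$. (M1.1) Compute the set $W=\{w_j\}$, where $w_j=-\kappa_j/\mathrm{lc}(F_j^U)$ and $\kappa_j$ is the coefficient of the monomial $\mathrm{lm}(F_j^U\varphi_s)$ in $F_j^D$. (M1.2) For each $c\in W$ compute $d_c=\bigl|\bigcup_{w_j=c}\Sigma(F_j^U\varphi_s)\cap\Delta(\{G_i^D\})\bigr|$. (M1.3) Let $w^{(s)}=c$ with largest $d_c$, and let $\tilde B=\{G_i(z+w^{(s)}\varphi_s),F_j(z+w^{(s)}\varphi_s)\}$. M2. Write $\tilde B=\{\tilde G_i,\tilde F_j\}$. Let $\Sigma^R$ be the set of monomials of $R$ divisible by some $\mathrm{lm}_s(\tilde G_i)$ and $\Delta^R$ its complement in the monomials of $R$. Define $\mathrm{spoly}(\tilde F_j)$ as: $\{\tilde F_j\}$ if $\mathrm{lm}_{s-1}(\tilde F_j)\in Rz$; $\bigl\{\frac{1}{\mathrm{lc}_{s-1}(\tilde F_j)}\tilde F_j-\frac{\mathrm{lm}_{s-1}(\tilde F_j)}{\mathrm{lt}_s(\tilde G_i)}\tilde G_i\bigr\}$ for one chosen $i$ with $\mathrm{lm}_s(\tilde G_i)\mid\mathrm{lm}_{s-1}(\tilde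 F_j)$, if $\mathrm{lm}_{s-1}(\tilde F_j)\in\Sigma^R$; and the set of all $\frac{\psi}{\mathrm{lt}_{s-1}(\tilde F_j)}\tilde F_j-\frac{\psi}{\mathrm{lt}_s(\tilde G_i)}\tilde G_i$, over all $i$ and all lcms $\psi$ of $\mathrm{lm}_{s-1}(\tilde F_j)$ and $\mathrm{lm}_s(\tilde G_i)$, if $\mathrm{lm}_{s-1}(\tilde F_j)\in\Delta^R$. Let $$B^{(s-1)}=\{\tilde G_i,\ \tilde F_j:\mathrm{lm}_{s-1}(\tilde F_j)\in\Delta^R\}'\ \cup\ \Bigl(\bigcup_j\mathrm{spoly}(\tilde F_j)\Bigr)',$$ where the first set consists of all $\tilde G_i$ together with those $\tilde F_j$ satisfying the condition, and the prime means that each of the two sets is reduced by removing polynomials whose leading term w.r.t. $>_{s-1}$ is divisible by that of another polynomial in the same set. *Finalize.* Output $(w^{(s)}: \text{nongap } s\le u)$.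
   Formalization: For d ≠ −1 products of monomials can have leading coefficient −d, so the algorithm as described fails; here the quotient φ_t/φ_s is a monomial up to a scalar, and w_j = −κ_j/lc(F_j^U φ_s) instead of −κ_j/lc(F_j^U). For d = −1 nothing changes. *)

theory Defs
  imports
    "HOL-Analysis.Finite_Cartesian_Product"
    "HOL-Computational_Algebra.Polynomial"
    "HOL-Library.Product_Plus"
begin

section \<open>Miura-Kamiya curves\<close>

text \<open>
  An element of \<^typ>\<open>'a poly poly\<close> is a polynomial in \<open>y\<close> whose coefficients are polynomials
  in \<open>x\<close>.
\<close>

definition mk_poly :: "nat \<Rightarrow> nat \<Rightarrow> (nat \<Rightarrow> nat \<Rightarrow> 'a) \<Rightarrow> 'a \<Rightarrow> 'a::field poly poly" where
  "mk_poly a b c d =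
     monom 1 a
     + (\<Sum>(i, j)\<in>{(i, j). a * i + b * j < a * b}. monom (monom (c i j) i) j)
     + [:monom d b:]"

definition eval2 :: "'a::field poly poly \<Rightarrow> 'a \<times> 'a \<Rightarrow> 'a" where
  "eval2 p Q = poly (poly p [:snd Q:]) (fst Q)"

definition nonsingular_point :: "'a::field poly poly \<Rightarrow> 'a \<times> 'a \<Rightarrow> bool" where
  "nonsingular_point p Q \<longleftrightarrow>
     eval2 p Q = 0 \<and> (eval2 (map_poly pderiv p) Q \<noteq> 0 \<or> eval2 (pderiv p) Q \<noteq> 0)"

text \<open>
  \<open>\<delta> = - v\<close> on \<open>R - {0}\<close> for a discrete valuation \<open>v\<close> of the function field \<open>Frac R\<close> that is
  trivial on the constants, normalised (\<open>v\<close> is onto the integers) and not centred at an affine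
  point (some element of \<open>R\<close> has a pole). A valuation of \<open>Frac R\<close> is determined by its values on
  \<open>R - {0}\<close>. The value \<open>\<delta> 0\<close> stands for minus infinity and is left unspecified; every use
  below treats zero separately. On a Miura-Kamiya curve there is exactly one such \<open>\<delta>\<close>.
\<close>

definition pole_order_at_infinity ::
    "('a::field poly poly \<Rightarrow> 'r::comm_ring_1) \<Rightarrow> ('r \<Rightarrow> int) \<Rightarrow> bool" where
  "pole_order_at_infinity cls \<delta> \<longleftrightarrow>
     (\<forall>f g. f \<noteq> 0 \<longrightarrow> g \<noteq> 0 \<longrightarrow> \<delta> (f * g) = \<delta> f + \<delta> g) \<and>
     (\<forall>f g. f \<noteq> 0 \<longrightarrow> g \<noteq> 0 \<longrightarrow> f + g \<noteq> 0 \<longrightarrow> \<delta> (f + g) \<le> max (\<delta> f) (\<delta> g)) \<and>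
     (\<forall>k. k \<noteq> 0 \<longrightarrow> \<delta> (cls [:[:k:]:]) = 0) \<and>
     (\<exists>f g. f \<noteq> 0 \<and> g \<noteq> 0 \<and> \<delta> f - \<delta> g = 1) \<and>
     (\<exists>f. f \<noteq> 0 \<and> \<delta> f > 0)"

text \<open>
  The coordinate ring is a ring \<^typ>\<open>'r\<close> presented by its residue class map \<open>cls\<close>: a surjective
  ring homomorphism from \<open>F[x,y]\<close> whose kernel is the ideal generated by the curve equation.
\<close>

locale mk_curve =
  fixes a b :: nat
    and c :: "nat \<Rightarrow> nat \<Rightarrow> 'a::field"
    and d :: 'a
    and cls :: "'a poly poly \<Rightarrow> 'r::comm_ring_1"
    and \<delta> :: "'r \<Rightarrow> int"
  assumes a_pos: "a > 0" and b_pos: "b > 0" and coprime_ab: "coprime a b"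
    and d_nonzero: "d \<noteq> 0"
    and irreducible_curve: "irreducible (mk_poly a b c d)"
    and cls_one: "cls 1 = 1"
    and cls_add: "cls (p + q) = cls p + cls q"
    and cls_mult: "cls (p * q) = cls p * cls q"
    and cls_surj: "surj cls"
    and cls_kernel: "cls p = 0 \<longleftrightarrow> mk_poly a b c d dvd p"
    and pole_order: "pole_order_at_infinity cls \<delta>"
begin

definition const :: "'a \<Rightarrow> 'r" where
  "const k = cls [:[:k:]:]"

definition xR :: 'r where
  "xR = cls [:[:0, 1:]:]"

definition yR :: 'r where
  "yR = cls [:0, 1:]"

definition monomials :: "'r set" where
  "monomials = {xR ^ i * yR ^ j | i j. j < a}"

definition nongaps :: "int set" where
  "nongaps = {\<delta> f | f. f \<noteq> 0}"

definition \<phi> :: "int \<Rightarrow> 'r" where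
  "\<phi> s = (THE m. m \<in> monomials \<and> \<delta> m = s)"

text \<open>Coefficient of the monomial \<open>m\<close> of \<open>R\<close> in \<open>f\<close>, with respect to the basis of monomials.\<close>

definition coef :: "'r \<Rightarrow> 'r \<Rightarrow> 'a" where
  "coef f m = module.representation (\<lambda>k r. const k * r) monomials f m"

definition lm :: "'r \<Rightarrow> 'r" where
  "lm f = \<phi> (\<delta> f)"

definition lc :: "'r \<Rightarrow> 'a" where
  "lc f = coef f (lm f)"

definition \<delta>_less :: "'r \<Rightarrow> 'r \<Rightarrow> bool" where
  "\<delta>_less f g \<longleftrightarrow> g \<noteq> 0 \<and> (f = 0 \<or> \<delta> f < \<delta> g)"

definition pt_value :: "'r \<Rightarrow> 'a \<times> 'a \<Rightarrow> 'a" where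
  "pt_value f Q = eval2 (SOME p. cls p = f) Q"

definition max_ideal :: "'a \<times> 'a \<Rightarrow> 'r set" where
  "max_ideal Q = {f. pt_value f Q = 0}"


subsection \<open>Divisibility of monomials\<close>

text \<open>
  The product of two monomials may have a leading coefficient other than one: the leading
  coefficient of \<open>y * y^(a-1) = y^a\<close> is \<open>- d\<close>. For divisibility of \<open>\<phi> t\<close> by \<open>\<phi> s\<close> to mean that
  \<open>t - s\<close> is a nongap, the quotient therefore has to be a monomial up to a scalar factor. The
  factor is one whenever \<open>d = - 1\<close>.
\<close>

definition terms :: "'r set" where
  "terms = {const k * m | k m. m \<in> monomials}"

definition divides :: "'r \<Rightarrow> 'r \<Rightarrow> bool" where
  "divides m m' \<longleftrightarrow> (\<exists>!l. l \<in> terms \<and> \<delta>_less (m' - l * m) m')"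

definition mono_quot :: "'r \<Rightarrow> 'r \<Rightarrow> 'r" where
  "mono_quot m' m = (THE l. l \<in> terms \<and> \<delta>_less (m' - l * m) m')"

definition lcms :: "'r \<Rightarrow> 'r \<Rightarrow> 'r set" where
  "lcms m m' =
     (if divides m m' then {m'}
      else if divides m' m then {m}
      else (THE L. \<exists>l1 l2. L = {l1, l2} \<and> L \<subseteq> monomials \<and>
              (\<forall>l\<in>L. divides m l \<and> divides m' l) \<and>
              (\<forall>k\<in>monomials. divides m k \<and> divides m' k \<longrightarrow> divides l1 k \<or> divides l2 k)))"

definition \<Sigma> :: "'r \<Rightarrow> 'r set" where
  "\<Sigma> f = {m \<in> monomials. divides (lm f) m}"

text \<open>\<open>\<Delta>_ideal\<close> is for ideals, \<open>\<Delta>_set\<close> for arbitrary sets of nonzero elements.\<close>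

definition \<Delta>_ideal :: "'r set \<Rightarrow> 'r set" where
  "\<Delta>_ideal I = {m \<in> monomials. \<not> (\<exists>f\<in>I. f \<noteq> 0 \<and> lm f = m)}"

definition \<Delta>_set :: "'r set \<Rightarrow> 'r set" where
  "\<Delta>_set T = {m \<in> monomials. \<forall>f\<in>T. \<not> divides (lm f) m}"

definition groebner_ideal :: "'r set \<Rightarrow> 'r set \<Rightarrow> bool" where
  "groebner_ideal I E \<longleftrightarrow>
     finite E \<and> E \<subseteq> I - {0} \<and> (\<forall>f\<in>I. f \<noteq> 0 \<longrightarrow> (\<exists>g\<in>E. divides (lm g) (lm f)))"


subsection \<open>The module \<open>R z + R\<close>\<close>

text \<open>
  The pair \<open>(g, h)\<close> stands for \<open>g * z + h\<close>. Accordingly a monomial \<open>m\<close> of the module belongs to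
  \<open>R z\<close> if \<open>snd m = 0\<close> and to \<open>R\<close> if \<open>fst m = 0\<close>.
\<close>

definition mod_monomials :: "('r \<times> 'r) set" where
  "mod_monomials = {(m, 0) | m. m \<in> monomials} \<union> {(0, m) | m. m \<in> monomials}"

definition mod_smult :: "'r \<Rightarrow> 'r \<times> 'r \<Rightarrow> 'r \<times> 'r" where
  "mod_smult r f = (r * fst f, r * snd f)"

definition mod_subst :: "'r \<times> 'r \<Rightarrow> 'r \<Rightarrow> 'r \<times> 'r" where
  "mod_subst f g = (fst f, fst f * g + snd f)"

definition mod_coef :: "'r \<times> 'r \<Rightarrow> 'r \<times> 'r \<Rightarrow> 'a" where
  "mod_coef f m = (if snd m = 0 then coef (fst f) (fst m) else coef (snd f) (snd m))"

definition wdeg :: "int \<Rightarrow> 'r \<times> 'r \<Rightarrow> int" where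
  "wdeg s m = (if snd m = 0 then \<delta> (fst m) + s else \<delta> (snd m))"

definition mod_gt :: "int \<Rightarrow> 'r \<times> 'r \<Rightarrow> 'r \<times> 'r \<Rightarrow> bool" where
  "mod_gt s m m' \<longleftrightarrow>
     wdeg s m > wdeg s m' \<or> (wdeg s m = wdeg s m' \<and> snd m = 0 \<and> snd m' \<noteq> 0)"

definition mod_lm :: "int \<Rightarrow> 'r \<times> 'r \<Rightarrow> 'r \<times> 'r" where
  "mod_lm s f = (THE m. m \<in> mod_monomials \<and> mod_coef f m \<noteq> 0 \<and>
     (\<forall>m'\<in>mod_monomials. mod_coef f m' \<noteq> 0 \<and> m' \<noteq> m \<longrightarrow> mod_gt s m m'))"

definition mod_lc :: "int \<Rightarrow> 'r \<times> 'r \<Rightarrow> 'a" where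
  "mod_lc s f = mod_coef f (mod_lm s f)"

definition mod_divides :: "'r \<times> 'r \<Rightarrow> 'r \<times> 'r \<Rightarrow> bool" where
  "mod_divides m m' \<longleftrightarrow>
     (snd m = 0 \<and> snd m' = 0 \<and> divides (fst m) (fst m')) \<or>
     (fst m = 0 \<and> fst m' = 0 \<and> divides (snd m) (snd m'))"

end


section \<open>The code and its decoder\<close>

definition wt :: "'a::zero ^ 'n \<Rightarrow> nat" where
  "wt v = card {i. v $ i \<noteq> 0}"

locale mk_code = mk_curve a b c d cls \<delta>
  for a b :: nat
    and c :: "nat \<Rightarrow> nat \<Rightarrow> 'a::field"
    and d :: 'a
    and cls :: "'a poly poly \<Rightarrow> 'r::comm_ring_1"
    and \<delta> :: "'r \<Rightarrow> int" +
  fixes P :: "'n::finite \<Rightarrow> 'a \<times> 'a"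
    and u :: nat
  assumes P_inj: "inj P"
    and P_nonsingular: "nonsingular_point (mk_poly a b c d) (P i)"
    and u_pos: "0 < u" and u_less: "u < CARD('n)"
begin

definition ev :: "'r \<Rightarrow> 'a ^ 'n" where
  "ev f = (\<chi> i. pt_value f (P i))"

definition L_u :: "'r set" where
  "L_u = {f. f = 0 \<or> \<delta> f \<le> int u}"

definition C_u :: "('a ^ 'n) set" where
  "C_u = ev ` L_u"

definition J :: "'r set" where
  "J = (\<Inter>i. max_ideal (P i))"

definition \<nu> :: "int \<Rightarrow> int" where
  "\<nu> s = int (card (\<Delta>_ideal J \<union> \<Delta>_ideal {r * \<phi> s | r. True})) - s"

definition d_u :: int where
  "d_u = Min (\<nu> ` {s \<in> nongaps. s \<le> int u})"


subsection \<open>Step M1\<close>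

definition G_part :: "int \<Rightarrow> ('r \<times> 'r) set \<Rightarrow> ('r \<times> 'r) set" where
  "G_part s B = {f \<in> B. fst (mod_lm s f) = 0}"

definition F_part :: "int \<Rightarrow> ('r \<times> 'r) set \<Rightarrow> ('r \<times> 'r) set" where
  "F_part s B = {f \<in> B. snd (mod_lm s f) = 0}"

text \<open>
  The divisor is the leading coefficient of \<open>F\<^sup>U * \<phi> s\<close>, which makes the coefficient of
  \<open>lm (F\<^sup>U * \<phi> s)\<close> vanish in the \<open>R\<close>-component of \<open>F (z + w * \<phi> s)\<close>. It equals \<open>lc (F\<^sup>U)\<close> if
  \<open>d = - 1\<close>; for other \<open>d\<close> it can differ from it by the factor \<open>- d\<close>.
\<close>

definition w_of :: "int \<Rightarrow> 'r \<times> 'r \<Rightarrow> 'a" where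
  "w_of s F = - coef (snd F) (lm (fst F * \<phi> s)) / lc (fst F * \<phi> s)"

definition candidates :: "int \<Rightarrow> ('r \<times> 'r) set \<Rightarrow> 'a set" where
  "candidates s B = w_of s ` F_part s B"

definition votes :: "int \<Rightarrow> ('r \<times> 'r) set \<Rightarrow> 'a \<Rightarrow> nat" where
  "votes s B k =
     card ((\<Union>F\<in>{F \<in> F_part s B. w_of s F = k}. \<Sigma> (fst F * \<phi> s)) \<inter> \<Delta>_set (snd ` G_part s B))"

definition step_M1 ::
    "int \<Rightarrow> ('r \<times> 'r) set \<Rightarrow> (int \<Rightarrow> 'a) \<Rightarrow> ('r \<times> 'r) set \<Rightarrow> (int \<Rightarrow> 'a) \<Rightarrow> bool" where
  "step_M1 s B w B' w' \<longleftrightarrow>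
     (if s \<in> nongaps \<and> s \<le> int u
      then \<exists>k\<in>candidates s B.
             (\<forall>k'\<in>candidates s B. votes s B k' \<le> votes s B k) \<and>
             B' = (\<lambda>f. mod_subst f (const k * \<phi> s)) ` B \<and>
             w' = w(s := k)
      else B' = B \<and> w' = w)"


subsection \<open>Step M2\<close>

text \<open>\<open>Gs\<close> is the set of all \<open>G\<^sub>i\<close>, and \<open>\<Sigma>_R\<close>, \<open>\<Delta>_R\<close> are taken with respect to it.\<close>

definition \<Sigma>_R :: "int \<Rightarrow> ('r \<times> 'r) set \<Rightarrow> 'r set" where
  "\<Sigma>_R s Gs = {m \<in> monomials. \<exists>G\<in>Gs. mod_divides (mod_lm s G) (0, m)}"

definition \<Delta>_R :: "int \<Rightarrow> ('r \<times> 'r) set \<Rightarrow> 'r set" where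
  "\<Delta>_R s Gs = monomials - \<Sigma>_R s Gs"

text \<open>\<open>ch F\<close> is the element \<open>G\<^sub>i\<close> chosen for \<open>F\<close> in the second case.\<close>

definition spoly ::
    "int \<Rightarrow> ('r \<times> 'r) set \<Rightarrow> ('r \<times> 'r \<Rightarrow> 'r \<times> 'r) \<Rightarrow> 'r \<times> 'r \<Rightarrow> ('r \<times> 'r) set" where
  "spoly s Gs ch F =
     (let m = mod_lm (s - 1) F; k = mod_lc (s - 1) F in
      if snd m = 0 then {F}
      else if snd m \<in> \<Sigma>_R s Gs then
        {mod_smult (const (inverse k)) F
         - mod_smult (const (inverse (mod_lc s (ch F))) * mono_quot (snd m) (snd (mod_lm s (ch F))))
             (ch F)}
      else
        {mod_smult (const (inverse k) * mono_quot p (snd m)) F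
         - mod_smult (const (inverse (mod_lc s G)) * mono_quot p (snd (mod_lm s G))) G
         | G p. G \<in> Gs \<and> p \<in> lcms (snd m) (snd (mod_lm s G))})"

definition valid_choice :: "int \<Rightarrow> ('r \<times> 'r) set \<Rightarrow> ('r \<times> 'r \<Rightarrow> 'r \<times> 'r) \<Rightarrow> 'r \<times> 'r \<Rightarrow> bool" where
  "valid_choice s Gs ch F \<longleftrightarrow>
     (snd (mod_lm (s - 1) F) \<in> \<Sigma>_R s Gs \<longrightarrow>
        ch F \<in> Gs \<and> mod_divides (mod_lm s (ch F)) (mod_lm (s - 1) F))"

text \<open>
  \<open>A'\<close> is a possible result of removing from \<open>A\<close>, one after the other, elements whose leading
  term is divisible by that of another remaining element, until there are none left. The removal
  is successive, so of several elements with the same leading monomial one can survive.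
\<close>

definition reduction :: "int \<Rightarrow> ('r \<times> 'r) set \<Rightarrow> ('r \<times> 'r) set \<Rightarrow> bool" where
  "reduction s A A' \<longleftrightarrow>
     A' \<subseteq> A \<and>
     (\<forall>f\<in>A'. \<forall>g\<in>A'. g \<noteq> f \<longrightarrow> \<not> mod_divides (mod_lm s g) (mod_lm s f)) \<and>
     (\<forall>f\<in>A - A'. \<exists>g\<in>A'. mod_divides (mod_lm s g) (mod_lm s f))"

definition step_M2 :: "int \<Rightarrow> ('r \<times> 'r) set \<Rightarrow> ('r \<times> 'r) set \<Rightarrow> bool" where
  "step_M2 s B B' \<longleftrightarrow>
     (let Gs = G_part s B; Fs = F_part s B in
      \<exists>ch A1 A2.
        (\<forall>F\<in>Fs. valid_choice s Gs ch F) \<and>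
        reduction (s - 1) (Gs \<union> {F \<in> Fs. snd (mod_lm (s - 1) F) \<in> \<Delta>_R s Gs}) A1 \<and>
        reduction (s - 1) (\<Union>F\<in>Fs. spoly s Gs ch F) A2 \<and>
        B' = A1 \<union> A2)"


subsection \<open>Executions\<close>

definition main_step ::
    "int \<Rightarrow> ('r \<times> 'r) set \<Rightarrow> (int \<Rightarrow> 'a) \<Rightarrow> ('r \<times> 'r) set \<Rightarrow> (int \<Rightarrow> 'a) \<Rightarrow> bool" where
  "main_step s B w B' w' \<longleftrightarrow> (\<exists>Bt. step_M1 s B w Bt w' \<and> step_M2 s Bt B')"

text \<open>
  \<open>exec v s B w\<close>: on input \<open>v\<close>, the algorithm can reach the state in which iteration \<open>s\<close> is about
  to be performed with \<open>B\<^sup>(\<^sup>s\<^sup>) = B\<close>, where \<open>w\<close> records the values found so far. All choices left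
  open by the algorithm are nondeterministic. The algorithm has ended when \<open>s = - 1\<close>.

  The values \<open>w\<close> start at zero, so that is the output for nongaps in \<open>{\<delta> h<..u}\<close>, which are not
  visited. If \<open>h = 0\<close> there is no iteration at all.
\<close>

inductive exec :: "'a ^ 'n \<Rightarrow> int \<Rightarrow> ('r \<times> 'r) set \<Rightarrow> (int \<Rightarrow> 'a) \<Rightarrow> bool" for v where
  initialize: "exec v (if h = 0 then - 1 else \<delta> h) ({(0, \<eta>) | \<eta>. \<eta> \<in> E} \<union> {(1, - h)}) (\<lambda>_. 0)"
    if "groebner_ideal J E" and "ev h = v"
| main: "exec v (s - 1) B' w'"
    if "exec v s B w" and "0 \<le> s" and "main_step s B w B' w'"

text \<open>
  Total correctness: an execution can be started, none gets stuck before the end, and every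
  completed one yields \<open>w (s) = \<omega> s\<close> for all nongaps \<open>s \<le> u\<close>.
\<close>

definition outputs :: "'a ^ 'n \<Rightarrow> (int \<Rightarrow> 'a) \<Rightarrow> bool" where
  "outputs v \<omega> \<longleftrightarrow>
     (\<exists>s B w. exec v s B w) \<and>
     (\<forall>s B w. exec v s B w \<and> 0 \<le> s \<longrightarrow> (\<exists>B' w'. main_step s B w B' w')) \<and>
     (\<forall>B w. exec v (- 1) B w \<longrightarrow> (\<forall>s\<in>nongaps. s \<le> int u \<longrightarrow> w s = \<omega> s))"

end

end

theory Submission
  imports Defs
begin

text \<open>
  At iteration \<open>s\<close> the set \<open>B\<close> is a Groebner basis, with respect to \<open>>\<^sub>s\<close>, of the module \<open>M\<close> of all
  \<open>f\<^sup>U z + f\<^sup>D\<close> interpolating the points \<open>(P\<^sub>i, v\<^sub>i)\<close>, where \<open>v = ev \<mu> + e\<close> and \<open>\<mu>\<close> is the part of the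
  message of degree at most \<open>s\<close>. Step M2 is Buchberger's completion on passing from \<open>>\<^sub>s\<close> to
  \<open>>\<^sub>s\<^sub>-\<^sub>1\<close>. For step M1, let \<open>DG\<close> and \<open>DF\<close> be the sets of degrees of the monomials in \<open>R\<close> and \<open>R z\<close>
  that are not leading monomials of \<open>M\<close>. Both \<open>\<Delta>(J)\<close> and \<open>DG \<union> DF\<close> have \<open>n\<close> elements, because
  each of the \<open>n\<close> interpolation conditions removes exactly one leading monomial. Two elements of \<open>M\<close>
  with the same leading monomial voting for different values at a position produce a leading monomial
  in \<open>R\<close> there, so votes at positions in \<open>DG\<close> are unambiguous. If \<open>f\<close> vanishes on the support of
  \<open>e\<close>, then \<open>f (z - \<mu>)\<close> lies in \<open>M\<close> and votes correctly. Hence at most \<open>wt e - |DF|\<close> positions vote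
  for wrong values, and at least \<open>\<nu> s - |DF| - wt e\<close> vote correctly, which is more as soon as
  \<open>\<nu> s > 2 wt e\<close>.
\<close>

section \<open>The coordinate ring and its pole order\<close>

context mk_curve
begin

text \<open>The assumptions on \<open>\<delta>\<close> describe only a normalised valuation with
  some pole, so the values \<open>a\<close> and \<open>b\<close> at the generators must be extracted
  from the curve equation before any monomial arithmetic is possible. From then on the argument runs
  on integer degrees. The bound for correct votes starts from the degrees \<open>T\<close> in
  \<open>\<Delta>(J)\<close> for which \<open>T - s\<close> is a nongap. There are at least
  \<open>\<nu> s\<close> of them, because at most \<open>s\<close> nongaps \<open>T\<close> have
  \<open>T - s\<close> a gap. Of these, \<open>|DF|\<close> are lost since \<open>DG\<close> is
  smaller than \<open>\<Delta>(J)\<close> by that number, and at most \<open>wt e\<close> are lost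
  where \<open>T - s\<close> is not the degree of a function vanishing on the support of
  \<open>e\<close>. Part of the output is not decided by votes at all: nongaps between
  \<open>\<delta> h\<close> and \<open>u\<close> are never visited and keep the value zero. A
  nonzero message coefficient there would yield a function of some degree \<open>m \<le> u\<close>
  evaluating to \<open>e\<close>, against \<open>\<nu> m > wt e\<close>.\<close>

lemma cls_0: "cls 0 = 0"
  using cls_add[of 0 0] by simp

lemma cls_minus: "cls (- p) = - cls p"
  using cls_add[of p "- p"] by (simp add: cls_0 add_eq_0_iff)

lemma cls_diff: "cls (p - q) = cls p - cls q"
  using cls_add[of p "- q"] by (simp add: cls_minus)

lemma cls_sum: "cls (sum f A) = (\<Sum>i\<in>A. cls (f i))"
  by (induction A rule: infinite_finite_induct) (auto simp: cls_0 cls_add)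

lemma const_0 [simp]: "const 0 = 0"
  by (simp add: const_def cls_0)

lemma const_1 [simp]: "const 1 = 1"
  using cls_one by (simp add: const_def one_pCons)

lemma const_add: "const (k + l) = const k + const l"
  by (simp add: const_def flip: cls_add)

lemma const_mult: "const (k * l) = const k * const l"
  by (simp add: const_def flip: cls_mult)

lemma const_minus: "const (- k) = - const k"
  using const_add[of k "- k"] by (simp add: add_eq_0_iff)

lemma const_diff: "const (k - l) = const k - const l"
  using const_add[of k "- l"] by (simp add: const_minus)

lemma const_inverse: "k \<noteq> 0 \<Longrightarrow> const (inverse k) * const k = 1"
  by (simp flip: const_mult)

lemma const_eq_0_iff [simp]: "const k = 0 \<longleftrightarrow> k = 0"
  using const_inverse[of k] by (metis const_0 mult_zero_right zero_neq_one)

end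

text \<open>\<open>coef\<close> is \<open>module.representation\<close> for exactly this scalar
  multiplication, so the instance opens the theory of spans and bases to it.\<close>

sublocale mk_curve \<subseteq> vs: module "\<lambda>k r. const k * r"
  by unfold_locales (simp_all add: const_add const_mult algebra_simps)

section \<open>Integrality of \<open>R\<close> and the calculus of degree bounds\<close>

context mk_curve
begin

lemma \<delta>_mult: "f \<noteq> 0 \<Longrightarrow> g \<noteq> 0 \<Longrightarrow> \<delta> (f * g) = \<delta> f + \<delta> g"
  using pole_order unfolding pole_order_at_infinity_def by blast

lemma \<delta>_add: "f \<noteq> 0 \<Longrightarrow> g \<noteq> 0 \<Longrightarrow> f + g \<noteq> 0 \<Longrightarrow> \<delta> (f + g) \<le> max (\<delta> f) (\<delta> g)"
  using pole_order unfolding pole_order_at_infinity_def by blast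

lemma \<delta>_const: "k \<noteq> 0 \<Longrightarrow> \<delta> (const k) = 0"
  using pole_order unfolding pole_order_at_infinity_def const_def by blast

text \<open>
  If \<open>f * g = 0\<close> with nonzero factors, additivity of \<open>\<delta>\<close> forces every element with a pole to
  annihilate \<open>g\<close>; but with \<open>h\<close> also \<open>h + 1\<close> has a pole.
\<close>

lemma no_zero_divisors:
  fixes f g :: 'r
  assumes "f \<noteq> 0" "g \<noteq> 0"
  shows "f * g \<noteq> 0"
proof
  assume fg: "f * g = 0"
  have ann: "p * g = 0" if "p \<noteq> 0" "\<delta> p > 0" for p
  proof (rule ccontr)
    assume pg: "p * g \<noteq> 0"
    have "f * (p * g) = 0"
      using fg by (metis mult.left_commute mult_zero_right)
    then show False
      using \<delta>_mult[OF assms] \<delta>_mult[OF \<open>f \<noteq> 0\<close> pg] \<delta>_mult[OF \<open>p \<noteq> 0\<close> \<open>g \<noteq> 0\<close>] fg that by simp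
  qed
  obtain h where h: "h \<noteq> 0" "\<delta> h > 0"
    using pole_order unfolding pole_order_at_infinity_def by blast
  have m1: "\<delta> (- 1) = 0"
    using \<delta>_const[of "- 1"] by (simp add: const_minus)
  have ne: "h + 1 \<noteq> 0"
    using h m1 by (metis eq_neg_iff_add_eq_0 less_irrefl)
  have "\<delta> h \<le> max (\<delta> (h + 1)) (\<delta> (- 1))"
    using \<delta>_add[of "h + 1" "- 1"] ne h by simp
  then have "\<delta> (h + 1) > 0"
    using h m1 by simp
  then have "(h + 1) * g = 0" "h * g = 0"
    using ann ne h by auto
  then show False
    using assms by (simp add: distrib_right)
qed

lemma mult_eq_0_iff': "(f :: 'r) * g = 0 \<longleftrightarrow> f = 0 \<or> g = 0"
  using no_zero_divisors by auto

text \<open>Zero counts as having degree minus infinity. Together with \<open>has_deg\<close> this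
  replaces comparisons of \<open>\<delta>\<close>, whose value at zero is unspecified, and gives the
  ultrametric rules without side conditions.\<close>

definition below :: "int \<Rightarrow> 'r \<Rightarrow> bool" where
  "below n f \<longleftrightarrow> f = 0 \<or> \<delta> f < n"

definition has_deg :: "int \<Rightarrow> 'r \<Rightarrow> bool" where
  "has_deg n f \<longleftrightarrow> f \<noteq> 0 \<and> \<delta> f = n"

lemma has_degI: "f \<noteq> 0 \<Longrightarrow> has_deg (\<delta> f) f"
  by (simp add: has_deg_def)

lemma below_0 [simp]: "below n 0"
  by (simp add: below_def)

lemma has_deg_nonzero: "has_deg n f \<Longrightarrow> f \<noteq> 0"
  by (simp add: has_deg_def)

lemma has_deg_mult: "has_deg m f \<Longrightarrow> has_deg n g \<Longrightarrow> has_deg (m + n) (f * g)"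
  by (simp add: has_deg_def \<delta>_mult no_zero_divisors)

lemma has_deg_const: "k \<noteq> 0 \<Longrightarrow> has_deg 0 (const k)"
  by (simp add: has_deg_def \<delta>_const)

lemma has_deg_const_mult: "k \<noteq> 0 \<Longrightarrow> has_deg n f \<Longrightarrow> has_deg n (const k * f)"
  using has_deg_mult[OF has_deg_const] by fastforce

lemma has_deg_const_mult_iff: "has_deg n (const k * f) \<longleftrightarrow> k \<noteq> 0 \<and> has_deg n f"
  using \<delta>_const[of k] by (auto simp: has_deg_def mult_eq_0_iff' \<delta>_mult)

lemma has_deg_power: "has_deg n f \<Longrightarrow> has_deg (int k * n) (f ^ k)"
proof (induction k)
  case 0
  then show ?case using has_deg_const[of 1] by simp
next
  case (Suc k)
  then show ?case using has_deg_mult[of n f "int k * n" "f ^ k"] by (simp add: algebra_simps)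
qed

lemma below_mult: "has_deg m f \<Longrightarrow> below n g \<Longrightarrow> below (m + n) (f * g)"
  by (cases "g = 0") (auto simp: below_def has_deg_def \<delta>_mult)

lemma below_mult_right: "below n g \<Longrightarrow> has_deg m f \<Longrightarrow> below (n + m) (g * f)"
  using below_mult[of m f n g] by (simp add: ac_simps)

lemma below_const_mult: "below n f \<Longrightarrow> below n (const k * f)"
  using below_mult[OF has_deg_const, of k n f] by (cases "k = 0") auto

lemma below_minus: "below n f \<Longrightarrow> below n (- f)"
  using below_const_mult[of n f "- 1"] by (simp add: const_minus)

lemma below_add: "below n f \<Longrightarrow> below n g \<Longrightarrow> below n (f + g)"
  using \<delta>_add[of f g] by (fastforce simp: below_def)

lemma below_diff: "below n f \<Longrightarrow> below n g \<Longrightarrow> below n (f - g)"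
  using below_add[of n f "- g"] below_minus by simp

lemma below_sum: "(\<And>i. i \<in> A \<Longrightarrow> below n (f i)) \<Longrightarrow> below n (sum f A)"
  by (induction A rule: infinite_finite_induct) (auto intro: below_add)

lemma below_mono: "below n f \<Longrightarrow> n \<le> m \<Longrightarrow> below m f"
  by (auto simp: below_def)

lemma has_deg_imp_below: "has_deg n f \<Longrightarrow> n < m \<Longrightarrow> below m f"
  by (auto simp: below_def has_deg_def)

lemma has_deg_not_below: "has_deg n f \<Longrightarrow> m \<le> n \<Longrightarrow> \<not> below m f"
  by (auto simp: below_def has_deg_def)

lemma has_deg_add_below:
  assumes "has_deg n f" "below n g"
  shows "has_deg n (f + g)"
proof -
  have "f + g \<noteq> 0"
    using assms below_minus[of n g] has_deg_not_below[of n f n] by (auto simp: eq_neg_iff_add_eq_0[symmetric])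
  moreover have "\<not> below n (f + g)"
    using assms has_deg_not_below[of n f n] below_diff[of n "f + g" g] by auto
  moreover have "below (n + 1) (f + g)"
    using assms by (intro below_add) (auto intro: below_mono has_deg_imp_below)
  ultimately show ?thesis
    by (auto simp: below_def has_deg_def)
qed

lemma has_deg_minus: "has_deg n f \<Longrightarrow> has_deg n (- f)"
  using has_deg_const_mult[of "- 1" n f] by (simp add: const_minus)

lemma has_deg_diff_below: "has_deg n f \<Longrightarrow> below n g \<Longrightarrow> has_deg n (f - g)"
  using has_deg_add_below[of n f "- g"] below_minus[of n g] by simp

lemma has_deg_below_diff: "has_deg n f \<Longrightarrow> below n g \<Longrightarrow> has_deg n (g - f)"
  using has_deg_add_below[of n "- f" g] has_deg_minus[of n f] by simp

lemma below_Suc_cases: "below (n + 1) f \<longleftrightarrow> below n f \<or> has_deg n f"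
  by (auto simp: below_def has_deg_def)

lemma below_iff: "below n f \<longleftrightarrow> (\<forall>m. has_deg m f \<longrightarrow> m < n)"
  by (auto simp: below_def has_deg_def)

text \<open>The lattice points strictly below the edge of the Newton polygon that joins
  \<open>(b, 0)\<close> to \<open>(0, a)\<close>; its ends belong to \<open>x ^ b\<close> and
  \<open>y ^ a\<close>.\<close>

definition exps :: "(nat \<times> nat) set" where
  "exps = {(i, j). a * i + b * j < a * b}"

lemma exps_bounds: "(i, j) \<in> exps \<Longrightarrow> i < b" "(i, j) \<in> exps \<Longrightarrow> j < a"
proof -
  assume "(i, j) \<in> exps"
  then have "a * i + b * j < a * b" by (simp add: exps_def)
  then have "a * i < a * b" "b * j < b * a" by (linarith, subst mult.commute, linarith)
  then show "i < b" "j < a" by simp_all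
qed

section \<open>Spanning of \<open>R\<close> by monomials of degree less than \<open>a\<close> in
  \<open>y\<close>\<close>

lemma cls_power: "cls (p ^ n) = cls p ^ n"
  by (induction n) (simp_all add: cls_one cls_mult)

lemma cls_monom: "cls (monom (monom k i) j) = const k * (xR ^ i * yR ^ j)"
proof -
  have "monom (monom k i) j = [:[:k:]:] * [:[:0, 1:]:] ^ i * [:0, 1:] ^ j"
  proof -
    have *: "[:p:] ^ i = [:p ^ i:]" for p :: "'a poly"
      by (induction i) (simp_all add: one_pCons)
    have "[:0, 1:] ^ j = (monom 1 j :: 'a poly poly)"
      by (simp add: monom_altdef)
    moreover have "[:0, 1:] ^ i = (monom 1 i :: 'a poly)"
      by (simp add: monom_altdef)
    ultimately show ?thesis
      by (simp add: * smult_monom)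
  qed
  then show ?thesis
    by (simp only: cls_mult cls_power const_def xR_def yR_def mult.assoc)
qed

lemma curve_equation:
  "yR ^ a + (\<Sum>(i, j)\<in>exps. const (c i j) * (xR ^ i * yR ^ j)) + const d * xR ^ b = 0"
proof -
  have "cls (monom 1 a) = yR ^ a"
    using cls_monom[of 1 0 a] by (simp add: monom_0 one_pCons)
  moreover have "cls [:monom d b:] = const d * xR ^ b"
    using cls_monom[of d b 0] by (simp add: monom_0)
  moreover have "cls (mk_poly a b c d) = 0"
    by (simp add: cls_kernel)
  ultimately show ?thesis
    by (simp add: mk_poly_def cls_add cls_sum case_prod_unfold cls_monom exps_def)
qed

lemma cls_in_span: "cls p \<in> vs.span {xR ^ i * yR ^ j | i j. True}"
proof -
  have "p = (\<Sum>j\<le>degree p. monom (\<Sum>i\<le>degree (coeff p j). monom (coeff (coeff p j) i) i) j)"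
    by (simp add: poly_as_sum_of_monoms)
  also have "\<dots> = (\<Sum>j\<le>degree p. \<Sum>i\<le>degree (coeff p j). monom (monom (coeff (coeff p j) i) i) j)"
    by (simp add: poly_eq_iff coeff_sum sum.If_cases if_distrib[of "\<lambda>x. coeff x _"] cong: if_cong)
  finally have "cls p = (\<Sum>j\<le>degree p. \<Sum>i\<le>degree (coeff p j).
      const (coeff (coeff p j) i) * (xR ^ i * yR ^ j))"
    by (metis (no_types, lifting) cls_sum cls_monom sum.cong)
  also have "\<dots> \<in> vs.span {xR ^ i * yR ^ j | i j. True}"
    by (intro vs.span_sum vs.span_scale vs.span_base) auto
  finally show ?thesis .
qed

text \<open>The curve equation trades \<open>y ^ a\<close> for terms of smaller degree in
  \<open>y\<close>. Exponents of \<open>x\<close> may grow, hence the induction on \<open>j\<close>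
  with \<open>i\<close> arbitrary.\<close>

lemma power_in_span_monomials: "xR ^ i * yR ^ j \<in> vs.span monomials"
proof (induction j arbitrary: i rule: less_induct)
  case (less j)
  show ?case
  proof (cases "j < a")
    case True
    then show ?thesis
      by (auto simp: monomials_def intro!: vs.span_base)
  next
    case False
    have e: "(\<Sum>p\<in>exps. const (c (fst p) (snd p)) * (xR ^ fst p * yR ^ snd p)) =
          - (yR ^ a) - const d * xR ^ b"
      using curve_equation by (simp add: case_prod_unfold algebra_simps eq_neg_iff_add_eq_0)
    have "xR ^ i * yR ^ j = xR ^ i * yR ^ (j - a) * yR ^ a"
      using False by (simp add: mult.assoc flip: power_add)
    also have "yR ^ a = - (\<Sum>p\<in>exps. const (c (fst p) (snd p)) * (xR ^ fst p * yR ^ snd p))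
        - const d * xR ^ b"
      unfolding e by simp
    also have "xR ^ i * yR ^ (j - a) * \<dots> =
        - (\<Sum>p\<in>exps. const (c (fst p) (snd p)) * (xR ^ (i + fst p) * yR ^ (j - a + snd p)))
        - const d * (xR ^ (i + b) * yR ^ (j - a))"
      by (simp add: algebra_simps sum_distrib_left power_add)
    also have "\<dots> \<in> vs.span monomials"
    proof (intro vs.span_diff vs.span_neg vs.span_sum vs.span_scale less.IH)
      fix p assume "p \<in> exps"
      then show "j - a + snd p < j"
        using exps_bounds[of "fst p" "snd p"] False by simp
    next
      show "j - a < j" using False a_pos by simp
    qed
    finally show ?thesis .
  qed
qed

lemma span_monomials: "f \<in> vs.span monomials"
proof -
  obtain p where "f = cls p" using cls_surj by (metis surjD)
  then have "f \<in> vs.span {xR ^ i * yR ^ j | i j. True}" using cls_in_span by simp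
  moreover have "vs.span {xR ^ i * yR ^ j | i j. True} \<subseteq> vs.span monomials"
    using power_in_span_monomials by (intro vs.span_minimal) auto
  ultimately show ?thesis by blast
qed

end

section \<open>Monomials\<close>

context mk_curve
begin

section \<open>Pole orders of the generators\<close>

lemma has_deg_monomial:
  "has_deg m xR \<Longrightarrow> has_deg n yR \<Longrightarrow> has_deg (int i * m + int j * n) (xR ^ i * yR ^ j)"
  by (intro has_deg_mult has_deg_power)

text \<open>The bound is asked for only where the product can be nonzero: before the pole orders are
  known, a generator might vanish and its \<open>\<delta>\<close> would mean nothing.\<close>

lemma below_power_product:
  assumes "i = 0 \<or> xR \<noteq> 0 \<Longrightarrow> j = 0 \<or> yR \<noteq> 0 \<Longrightarrow> int i * \<delta> xR + int j * \<delta> yR < n"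
  shows "below n (xR ^ i * yR ^ j)"
proof (cases "xR ^ i * yR ^ j = 0")
  case False
  have pow: "i = 0 \<or> g \<noteq> 0" if "g ^ i \<noteq> 0" for g :: 'r and i :: nat
    using that by (cases i) auto
  have x: "i = 0 \<or> xR \<noteq> 0" and y: "j = 0 \<or> yR \<noteq> 0"
    using False pow by (auto simp: mult_eq_0_iff')
  have "has_deg (int i * \<delta> xR) (xR ^ i)" "has_deg (int j * \<delta> yR) (yR ^ j)"
    using x y has_deg_power[OF has_degI[of xR], of i] has_deg_power[OF has_degI[of yR], of j]
      has_deg_const[of 1] by auto
  then have "has_deg (int i * \<delta> xR + int j * \<delta> yR) (xR ^ i * yR ^ j)"
    by (rule has_deg_mult)
  then show ?thesis
    using assms x y by (auto intro: has_deg_imp_below)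
qed simp

text \<open>Otherwise every product of powers, and by spanning every element, would have
  \<open>\<delta>\<close> at most zero, although some element has a pole.\<close>

lemma some_generator_has_pole: "xR \<noteq> 0 \<and> \<delta> xR > 0 \<or> yR \<noteq> 0 \<and> \<delta> yR > 0"
proof (rule ccontr)
  assume neg: "\<not> ?thesis"
  obtain h where h: "h \<noteq> 0" "\<delta> h > 0"
    using pole_order unfolding pole_order_at_infinity_def by blast
  have le: "int i * \<delta> g \<le> 0" if "\<not> (g \<noteq> 0 \<and> \<delta> g > 0)" "i = 0 \<or> g \<noteq> 0" for g and i
    using that by (auto simp: mult_nonneg_nonpos)
  have mono: "below 1 (xR ^ i * yR ^ j)" for i j
    using le[of xR i] le[of yR j] neg by (intro below_power_product) force
  have "below 1 h"
    using span_monomials[of h]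
    by (induction rule: vs.span_induct_alt)
       (auto simp: monomials_def mono intro!: below_add below_const_mult)
  with h show False by (auto simp: below_def)
qed

text \<open>The exponents satisfy \<open>i / b + j / a < 1\<close>; with
  \<open>p \<le> n / b\<close> and \<open>q \<le> n / a\<close> the weight is at most
  \<open>n * (i / b + j / a)\<close>. The proof clears denominators.\<close>

lemma exps_below:
  assumes "(i, j) \<in> exps" "int b * p \<le> n" "int a * q \<le> n" "n > 0"
  shows "int i * p + int j * q < n"
proof -
  have "int (a * i + b * j) < int (a * b)"
    using assms(1) unfolding exps_def by (simp only: of_nat_less_iff mem_Collect_eq split)
  then have "(int a * int i + int b * int j) * n < (int a * int b) * n"
    using \<open>n > 0\<close> by simp
  moreover have "(int a * int i) * (int b * p) + (int b * int j) * (int a * q)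
      \<le> (int a * int i) * n + (int b * int j) * n"
    using assms by (intro add_mono mult_left_mono) auto
  ultimately have "(int a * int b) * (int i * p + int j * q) < (int a * int b) * n"
    by (simp add: algebra_simps)
  then show ?thesis
    using a_pos b_pos by (simp add: mult_less_cancel_left)
qed

text \<open>
  In the curve equation the pole orders of \<open>y ^ a\<close> and \<open>x ^ b\<close> dominate those of the remaining
  terms, hence must be equal.
\<close>

lemma pole_orders_of_generators_eq:
  "xR \<noteq> 0" "yR \<noteq> 0" "int a * \<delta> yR = int b * \<delta> xR" "\<delta> xR > 0"
proof -
  let ?S = "\<Sum>p\<in>exps. const (c (fst p) (snd p)) * (xR ^ fst p * yR ^ snd p)"
  have eq: "yR ^ a + ?S + const d * xR ^ b = 0"
    using curve_equation by (simp add: case_prod_unfold)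
  have S: "below n ?S"
    if "xR \<noteq> 0 \<Longrightarrow> int b * \<delta> xR \<le> n" "yR \<noteq> 0 \<Longrightarrow> int a * \<delta> yR \<le> n" "n > 0" for n
  proof (intro below_sum below_const_mult below_power_product)
    fix p assume p: "p \<in> exps" and x: "fst p = 0 \<or> xR \<noteq> 0" and y: "snd p = 0 \<or> yR \<noteq> 0"
    \<comment> \<open>A vanishing generator enters with weight \<open>0\<close>: its exponent is
      zero here, and \<open>0 < n\<close> keeps the hypotheses of \<open>exps_below\<close>
      true.\<close>
    show "int (fst p) * \<delta> xR + int (snd p) * \<delta> yR < n"
      using exps_below[of "fst p" "snd p" "if xR = 0 then 0 else \<delta> xR" n "if yR = 0 then 0 else \<delta> yR"]
        p x y that by (auto split: if_splits)
  qed
  have y: "xR \<noteq> 0 \<and> int b * \<delta> xR \<ge> int a * \<delta> yR" if "yR \<noteq> 0" "\<delta> yR > 0"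
  proof (rule ccontr)
    assume neg: "\<not> ?thesis"
    let ?n = "int a * \<delta> yR"
    have "below ?n (xR ^ b * yR ^ 0)"
      using neg b_pos that by (intro below_power_product) auto
    moreover have "below ?n ?S"
      using neg that a_pos by (intro S) auto
    ultimately have "below ?n (- (?S + const d * xR ^ b))"
      by (intro below_minus below_add below_const_mult) auto
    moreover have "yR ^ a = - (?S + const d * xR ^ b)"
      unfolding eq_neg_iff_add_eq_0 using eq by (simp only: add.assoc)
    ultimately show False
      using has_deg_power[OF has_degI[OF \<open>yR \<noteq> 0\<close>], of a] has_deg_not_below by fastforce
  qed
  have x: "yR \<noteq> 0 \<and> int a * \<delta> yR \<ge> int b * \<delta> xR" if "xR \<noteq> 0" "\<delta> xR > 0"
  proof (rule ccontr)
    assume neg: "\<not> ?thesis"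
    let ?n = "int b * \<delta> xR"
    have "below ?n (xR ^ 0 * yR ^ a)"
      using neg a_pos that by (intro below_power_product) auto
    moreover have "below ?n ?S"
      using neg that b_pos by (intro S) auto
    ultimately have "below ?n (- (?S + yR ^ a))"
      by (intro below_minus below_add) auto
    moreover have "const d * xR ^ b = - (?S + yR ^ a)"
      unfolding eq_neg_iff_add_eq_0 using eq by (simp only: ac_simps)
    ultimately show False
      using has_deg_const_mult[OF d_nonzero has_deg_power[OF has_degI[OF \<open>xR \<noteq> 0\<close>], of b]]
        has_deg_not_below by fastforce
  qed

  have pos: "q > 0" if "int m * p \<le> int n * q" "p > 0" "m > 0" for m n :: nat and p q :: int
  proof -
    have "0 < int m * p" using that by simp
    then have "0 < int n * q" using that(1) by linarith
    then show ?thesis by (simp add: zero_less_mult_iff)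
  qed
  have "(xR \<noteq> 0 \<and> \<delta> xR > 0) \<and> (yR \<noteq> 0 \<and> \<delta> yR > 0)"
    using some_generator_has_pole
  proof
    assume "xR \<noteq> 0 \<and> \<delta> xR > 0"
    with x pos[of b "\<delta> xR" a "\<delta> yR"] b_pos show ?thesis by simp
  next
    assume "yR \<noteq> 0 \<and> \<delta> yR > 0"
    with y pos[of a "\<delta> yR" b "\<delta> xR"] a_pos show ?thesis by simp
  qed
  then show "xR \<noteq> 0" "yR \<noteq> 0" "int a * \<delta> yR = int b * \<delta> xR" "\<delta> xR > 0"
    using x y by (auto intro: antisym)
qed

lemma combination_eq_cases:
  fixes i i' j j' :: int
  assumes "int a * i + int b * j = int a * i' + int b * j'"
    and "0 \<le> j" "j < int a" "0 \<le> j'" "j' < int a"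
  shows "i = i' \<and> j = j'"
proof -
  have "int a * (i - i') = int b * (j' - j)"
    using assms(1) by (simp add: algebra_simps)
  then have "int a dvd int b * (j' - j)"
    by (metis dvd_triv_left)
  then have "int a dvd j' - j"
    using coprime_ab by (simp add: coprime_dvd_mult_right_iff)
  then have "j = j'"
    using assms(2-5) dvd_imp_le_int[of "j' - j" "int a"] by linarith
  then show ?thesis
    using assms(1) a_pos by simp
qed

text \<open>The largest degree occurs only once, so nothing can cancel it.\<close>

lemma sum_distinct_degrees:
  assumes "finite A" "A \<noteq> {}" "inj_on \<delta> A" "0 \<notin> A" "\<And>m. m \<in> A \<Longrightarrow> k m \<noteq> 0"
  shows "\<exists>m\<in>A. has_deg (\<delta> m) (\<Sum>m\<in>A. const (k m) * m) \<and> (\<forall>m'\<in>A. \<delta> m' \<le> \<delta> m)"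
proof -
  obtain m where m: "m \<in> A" "\<And>m'. m' \<in> A \<Longrightarrow> \<delta> m' \<le> \<delta> m"
  proof -
    have "Max (\<delta> ` A) \<in> \<delta> ` A"
      using assms(1,2) by (intro Max_in) auto
    then obtain m where "m \<in> A" "\<delta> m = Max (\<delta> ` A)"
      by auto
    then show thesis
      using assms(1) by (intro that[of m]) auto
  qed
  have "\<delta> m' < \<delta> m" if "m' \<in> A - {m}" for m'
    using that m assms(3) by (metis DiffE inj_onD insertI1 order_le_neq_trans)
  then have "below (\<delta> m) (\<Sum>m'\<in>A - {m}. const (k m') * m')"
    by (intro below_sum below_const_mult) (simp add: below_def)
  moreover have "has_deg (\<delta> m) (const (k m) * m)"
    using m assms by (intro has_deg_const_mult has_degI) auto
  ultimately have "has_deg (\<delta> m) (\<Sum>m\<in>A. const (k m) * m)"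
    using m assms(1) by (simp add: has_deg_add_below sum.remove)
  with m show ?thesis by blast
qed

text \<open>Distinctness of the degrees is a hypothesis because the lemma is applied already while
  the pole orders of the generators are known only up to a common factor.\<close>

lemma degree_attained_by_monomial:
  assumes "inj_on \<delta> monomials" "0 \<notin> monomials" "f \<noteq> 0"
  shows "\<exists>m\<in>monomials. \<delta> f = \<delta> m"
proof -
  obtain k where k: "\<And>m. k m \<noteq> 0 \<Longrightarrow> m \<in> monomials" "finite {m. k m \<noteq> 0}"
      "(\<Sum>m | k m \<noteq> 0. const (k m) * m) = f"
    using span_monomials[of f] by (auto simp: vs.span_explicit')
  have "{m. k m \<noteq> 0} \<noteq> {}"
  proof
    assume "{m. k m \<noteq> 0} = {}"
    then have "f = 0" using k(3) by simp
    then show False using assms by simp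
  qed
  moreover have "inj_on \<delta> {m. k m \<noteq> 0}"
    by (rule inj_on_subset[OF assms(1)]) (use k(1) in blast)
  moreover have "0 \<notin> {m. k m \<noteq> 0}"
    using k(1) assms(2) by blast
  ultimately have "\<exists>m\<in>{m. k m \<noteq> 0}. has_deg (\<delta> m) f"
    using sum_distinct_degrees[OF k(2), of k] k(3) by blast
  then show ?thesis
    using k(1) by (auto simp: has_deg_def)
qed

text \<open>Coprimality turns \<open>a * \<delta> y = b * \<delta> x\<close> into
  \<open>\<delta> x = a * t\<close> and \<open>\<delta> y = b * t\<close>. Then \<open>t\<close>
  divides every value of \<open>\<delta>\<close>, and since two of the values differ by one,
  \<open>t = 1\<close>.\<close>

lemma \<delta>_generators: "\<delta> xR = int a" "\<delta> yR = int b"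
proof -
  note gens = pole_orders_of_generators_eq
  have "int a dvd int b * \<delta> xR"
    using gens(3) by (metis dvd_triv_left)
  then obtain t where t: "\<delta> xR = int a * t"
    using coprime_ab by (auto simp: coprime_dvd_mult_right_iff elim: dvdE)
  then have t': "\<delta> yR = int b * t"
    using gens(3) a_pos by simp
  have "t > 0"
    using gens(4) t a_pos by (simp add: zero_less_mult_iff)
  have deg: "has_deg (t * (int a * int i + int b * int j)) (xR ^ i * yR ^ j)" for i j
    using has_deg_monomial[OF has_degI[OF gens(1)] has_degI[OF gens(2)], of i j]
    by (simp add: t t' algebra_simps)
  have dvd: "t dvd \<delta> f" if f: "f \<noteq> 0" for f
  proof -
    have "inj_on \<delta> monomials"
    proof (rule inj_onI)
      fix m m' assume m: "m \<in> monomials" "m' \<in> monomials" "\<delta> m = \<delta> m'"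
      obtain i j i' j' where ij: "m = xR ^ i * yR ^ j" "m' = xR ^ i' * yR ^ j'" "j < a" "j' < a"
        using m by (auto simp: monomials_def)
      have "int a * int i + int b * int j = int a * int i' + int b * int j'"
        using m ij deg[of i j] deg[of i' j'] \<open>t > 0\<close> by (simp add: has_deg_def)
      then show "m = m'"
        using combination_eq_cases[of "int i" "int j" "int i'" "int j'"] ij by simp
    qed
    moreover have "0 \<notin> monomials"
      using deg by (force simp: monomials_def has_deg_def)
    ultimately obtain m where m: "m \<in> monomials" "\<delta> f = \<delta> m"
      using degree_attained_by_monomial f by blast
    obtain i j where "m = xR ^ i * yR ^ j"
      using m by (auto simp: monomials_def)
    then show ?thesis
      using m deg[of i j] by (simp add: has_deg_def)
  qed
  obtain f g where "f \<noteq> 0" "g \<noteq> 0" "\<delta> f - \<delta> g = 1"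
    using pole_order unfolding pole_order_at_infinity_def by blast
  then have "t dvd 1"
    using dvd by (metis dvd_diff)
  then have "t = 1"
    using \<open>t > 0\<close> by simp
  then show "\<delta> xR = int a" "\<delta> yR = int b"
    using t t' by simp_all
qed

section \<open>The monomial basis and the semigroup of nongaps\<close>

lemma has_deg_power_product: "has_deg (int a * int i + int b * int j) (xR ^ i * yR ^ j)"
  using has_deg_monomial[OF has_degI has_degI, of i j] pole_orders_of_generators_eq
  by (simp add: \<delta>_generators algebra_simps)

lemma inj_on_\<delta>_monomials: "inj_on \<delta> monomials"
proof (rule inj_onI)
  fix m m' assume "m \<in> monomials" "m' \<in> monomials" "\<delta> m = \<delta> m'"
  moreover from this obtain i j i' j' where ij: "m = xR ^ i * yR ^ j" "m' = xR ^ i' * yR ^ j'" "j < a" "j' < a"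
    by (auto simp: monomials_def)
  ultimately have "int a * int i + int b * int j = int a * int i' + int b * int j'"
    using has_deg_power_product[of i j] has_deg_power_product[of i' j'] by (simp add: has_deg_def)
  then show "m = m'"
    using combination_eq_cases[of "int i" "int j" "int i'" "int j'"] ij by simp
qed

lemma monomial_nonzero: "m \<in> monomials \<Longrightarrow> m \<noteq> 0"
  using has_deg_power_product by (auto simp: monomials_def has_deg_def)

lemma zero_notin_monomials [simp]: "0 \<notin> monomials"
  using monomial_nonzero by blast

lemma independent_monomials: "vs.independent monomials"
proof
  assume "vs.dependent monomials"
  then obtain A k m where A: "finite A" "A \<subseteq> monomials" "(\<Sum>m\<in>A. const (k m) * m) = 0" "m \<in> A" "k m \<noteq> 0"
    by (auto simp: vs.dependent_explicit)
  let ?A = "{m \<in> A. k m \<noteq> 0}"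
  have sum: "(\<Sum>m\<in>?A. const (k m) * m) = 0"
    using A(1,3) by (subst sum.mono_neutral_left[of A]) auto
  have inj: "inj_on \<delta> ?A"
    by (rule inj_on_subset[OF inj_on_\<delta>_monomials]) (use A(2) in auto)
  have "finite ?A" "?A \<noteq> {}" "0 \<notin> ?A"
    using A zero_notin_monomials by auto
  from sum_distinct_degrees[OF this(1,2) inj this(3), of k] obtain m' where "has_deg (\<delta> m') 0"
    unfolding sum by blast
  then show False
    by (simp add: has_deg_def)
qed

lemma nongaps_eq: "nongaps = {int a * int i + int b * int j | i j. j < a}"
proof (intro equalityI subsetI)
  fix t assume "t \<in> nongaps"
  then obtain f where f: "f \<noteq> 0" "\<delta> f = t" by (auto simp: nongaps_def)
  obtain m where m: "m \<in> monomials" "\<delta> f = \<delta> m"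
    using degree_attained_by_monomial[OF inj_on_\<delta>_monomials zero_notin_monomials f(1)] by blast
  obtain i j where "m = xR ^ i * yR ^ j" "j < a"
    using m by (auto simp: monomials_def)
  then show "t \<in> {int a * int i + int b * int j | i j. j < a}"
    using m has_deg_power_product[of i j] f(2) unfolding has_deg_def mem_Collect_eq by metis
next
  fix t assume "t \<in> {int a * int i + int b * int j | i j. j < a}"
  then obtain i j where "t = int a * int i + int b * int j"
    by blast
  then show "t \<in> nongaps"
    using has_deg_power_product[of i j] unfolding nongaps_def has_deg_def mem_Collect_eq by metis
qed

lemma nongaps_nonneg: "t \<in> nongaps \<Longrightarrow> t \<ge> 0"
  by (auto simp: nongaps_eq)

lemma nongaps_0 [simp]: "0 \<in> nongaps"
  using has_deg_const[of 1] by (force simp: nongaps_def has_deg_def)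

lemma nongaps_add: "s \<in> nongaps \<Longrightarrow> t \<in> nongaps \<Longrightarrow> s + t \<in> nongaps"
proof -
  assume "s \<in> nongaps" "t \<in> nongaps"
  then obtain f g where "has_deg s f" "has_deg t g"
    by (auto simp: nongaps_def has_deg_def)
  from has_deg_mult[OF this] show ?thesis
    unfolding nongaps_def has_deg_def mem_Collect_eq by metis
qed

lemma has_deg_nongap: "has_deg t f \<Longrightarrow> t \<in> nongaps"
  by (auto simp: has_deg_def nongaps_def)

lemma \<phi>_nongap:
  assumes "s \<in> nongaps"
  shows "\<phi> s \<in> monomials" "\<delta> (\<phi> s) = s"
proof -
  obtain i j where ij: "s = int a * int i + int b * int j" "j < a"
    using assms by (auto simp: nongaps_eq)
  have "\<exists>!m. m \<in> monomials \<and> \<delta> m = s"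
    using ij has_deg_power_product[of i j] inj_on_\<delta>_monomials
    by (intro ex_ex1I) (auto simp: monomials_def has_deg_def inj_on_def)
  from theI'[OF this] show "\<phi> s \<in> monomials" "\<delta> (\<phi> s) = s"
    by (simp_all add: \<phi>_def)
qed

lemma has_deg_\<phi>: "s \<in> nongaps \<Longrightarrow> has_deg s (\<phi> s)"
  using \<phi>_nongap monomial_nonzero by (auto simp: has_deg_def)

lemma \<phi>_\<delta>: "m \<in> monomials \<Longrightarrow> \<phi> (\<delta> m) = m"
  using \<phi>_nongap[of "\<delta> m"] inj_on_\<delta>_monomials monomial_nonzero[of m]
  by (auto simp: nongaps_def inj_on_def)

lemma monomials_eq_\<phi>: "monomials = \<phi> ` nongaps"
proof (intro equalityI subsetI)
  fix m assume "m \<in> monomials"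
  then show "m \<in> \<phi> ` nongaps"
    using \<phi>_\<delta>[of m] has_deg_nongap[OF has_degI[OF monomial_nonzero]] by force
qed (auto simp: \<phi>_nongap)

lemma inj_on_\<phi>: "inj_on \<phi> nongaps"
  by (metis \<phi>_nongap(2) inj_onI)

section \<open>Coefficients and cancellation of leading terms\<close>

lemma coef_in_monomials: "coef f m \<noteq> 0 \<Longrightarrow> m \<in> monomials"
  unfolding coef_def by (rule vs.representation_ne_zero)

lemma coef_diff: "coef (f - g) m = coef f m - coef g m"
  unfolding coef_def by (simp add: vs.representation_diff independent_monomials span_monomials)

lemma coef_const_mult: "coef (const k * f) m = k * coef f m"
  unfolding coef_def by (simp add: vs.representation_scale independent_monomials span_monomials)

lemma coef_monomial: "m \<in> monomials \<Longrightarrow> coef m m' = (if m' = m then 1 else 0)"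
  unfolding coef_def by (simp add: vs.representation_basis independent_monomials)

lemma coef_0 [simp]: "coef 0 m = 0"
  using coef_const_mult[of 0 0 m] by simp



lemma coef_support:
  assumes "has_deg t f"
  shows "coef f (\<phi> t) \<noteq> 0" "coef f m \<noteq> 0 \<Longrightarrow> \<delta> m \<le> t"
proof -
  let ?A = "{m. coef f m \<noteq> 0}"
  have sum: "(\<Sum>m\<in>?A. const (coef f m) * m) = f"
    unfolding coef_def
    by (rule vs.sum_nonzero_representation_eq) (simp_all add: independent_monomials span_monomials)
  have fin: "finite ?A"
    unfolding coef_def by (rule vs.finite_representation)
  have sub: "?A \<subseteq> monomials"
    using coef_in_monomials by blast
  have ne: "?A \<noteq> {}"
  proof
    assume "?A = {}"
    with sum have "f = 0" by simp
    with assms show False by (simp add: has_deg_def)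
  qed
  have inj: "inj_on \<delta> ?A"
    using inj_on_\<delta>_monomials sub by (rule inj_on_subset)
  have z: "0 \<notin> ?A"
    using sub zero_notin_monomials by blast
  have "\<exists>m\<in>?A. has_deg (\<delta> m) f \<and> (\<forall>m'\<in>?A. \<delta> m' \<le> \<delta> m)"
    using sum_distinct_degrees[OF fin ne inj z, of "coef f"] unfolding sum by blast
  then obtain m where m: "m \<in> ?A" "has_deg (\<delta> m) f" "\<And>m'. m' \<in> ?A \<Longrightarrow> \<delta> m' \<le> \<delta> m"
    by blast
  then have "\<delta> m = t"
    using assms by (simp add: has_deg_def)
  then show "coef f (\<phi> t) \<noteq> 0" "coef f m' \<noteq> 0 \<Longrightarrow> \<delta> m' \<le> t" for m'
    using m \<phi>_\<delta>[of m] sub by auto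
qed

lemma below_imp_coef_0: "below t f \<Longrightarrow> t \<in> nongaps \<Longrightarrow> coef f (\<phi> t) = 0"
  using coef_support(2)[of "\<delta> f" f "\<phi> t"] \<phi>_nongap[of t] by (cases "f = 0") (auto simp: below_def has_deg_def)

lemma below_Suc_coef:
  assumes "below (t + 1) f" "t \<in> nongaps"
  shows "below t (f - const k * \<phi> t) \<longleftrightarrow> coef f (\<phi> t) = k"
proof -
  have "below (t + 1) (f - const k * \<phi> t)"
    using assms has_deg_\<phi>[of t] by (intro below_diff below_const_mult) (auto intro: has_deg_imp_below)
  then have "below t (f - const k * \<phi> t) \<longleftrightarrow> coef (f - const k * \<phi> t) (\<phi> t) = 0"
    using coef_support(1)[of t] below_imp_coef_0 assms(2) by (auto simp: below_Suc_cases)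
  also have "\<dots> \<longleftrightarrow> coef f (\<phi> t) = k"
    using assms by (simp add: coef_diff coef_const_mult coef_monomial \<phi>_nongap)
  finally show ?thesis .
qed

lemma lm_eq: "has_deg t f \<Longrightarrow> lm f = \<phi> t"
  by (simp add: lm_def has_deg_def)

lemma lc_eq: "has_deg t f \<Longrightarrow> lc f = coef f (\<phi> t)"
  by (simp add: lc_def lm_eq)

text \<open>There is only one monomial of each degree, so leading terms of equal degree are
  proportional. Every elimination below rests on this.\<close>

lemma cancel_leading:
  assumes "has_deg t f" "has_deg t g"
  shows "\<exists>k. k \<noteq> 0 \<and> below t (f - const k * g)"
proof -
  let ?k = "coef f (\<phi> t) / coef g (\<phi> t)"
  have t: "t \<in> nongaps" using assms has_deg_nongap by blast
  have "below (t + 1) (f - const ?k * g)"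
    using assms by (intro below_diff below_const_mult) (auto intro: has_deg_imp_below)
  moreover have "coef (f - const ?k * g) (\<phi> t) = 0"
    using coef_support(1)[OF assms(2)] by (simp add: coef_diff coef_const_mult)
  ultimately have "below t (f - const ?k * g)"
    using below_Suc_coef[OF _ t, of _ 0] by fastforce
  then show ?thesis
    using coef_support(1)[OF assms(1)] coef_support(1)[OF assms(2)] by (intro exI[of _ ?k]) simp
qed

end

section \<open>Degrees under functionals and common multiples\<close>

lemma integer_combination_exists:
  assumes "a > 0" "coprime a b"
  shows "\<exists>i j. n = int a * i + int b * j \<and> 0 \<le> j \<and> j < int a"
proof -
  obtain p q where pq: "p * int a + q * int b = 1"
    using bezout_int[of "int a" "int b"] assms(2) by auto
  define e where "e = (n * q) div int a"
  define j where "j = (n * q) mod int a"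
  have "n = n * (p * int a + q * int b)"
    using pq by simp
  also have "\<dots> = int a * (n * p) + int b * (n * q)"
    by (simp add: algebra_simps)
  also have "\<dots> = int a * (n * p) + int b * (int a * e + j)"
    by (simp add: e_def j_def)
  also have "\<dots> = int a * (n * p + int b * e) + int b * j"
    by (simp add: algebra_simps)
  finally show ?thesis
    using assms(1) by (intro exI[of _ "n * p + int b * e"] exI[of _ j]) (simp add: j_def)
qed

text \<open>Abstracts a degree whose successive quotients are at most one-dimensional
  (\<open>D_cancel\<close>). It is instantiated for \<open>R\<close> and for the orders
  \<open>>\<^sub>s\<close> with \<open>s \<ge> 0\<close> on the module, so that the dimension count
  is done only once.\<close>

locale leafwise_degree =
  fixes smul :: "'k::field \<Rightarrow> 'v::ab_group_add \<Rightarrow> 'v"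
    and D :: "int \<Rightarrow> 'v \<Rightarrow> bool"
  assumes D_exists: "f \<noteq> 0 \<Longrightarrow> \<exists>n. D n f"
    and D_nonneg: "D n f \<Longrightarrow> n \<ge> 0"
    and D_diff: "D n f \<Longrightarrow> D m g \<Longrightarrow> m < n \<Longrightarrow> D n (f - smul k g)"
    and D_cancel: "D n f \<Longrightarrow> D n g \<Longrightarrow> \<exists>k. f - smul k g = 0 \<or> (\<exists>m<n. D m (f - smul k g))"
begin

definition degs :: "'v set \<Rightarrow> int set" where
  "degs M = {n. \<exists>f\<in>M. D n f}"

text \<open>
  The degree lost on passing to the kernel of a functional is the least degree of an element
  outside the kernel.
\<close>

lemma degs_kernel:
  fixes L :: "'v \<Rightarrow> 'k"
  assumes M: "\<And>f g k. f \<in> M \<Longrightarrow> g \<in> M \<Longrightarrow> f - smul k g \<in> M"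
    and L: "\<And>f g k. L (f - smul k g) = L f - k * L g" and L0: "L 0 = 0"
    and ex: "f1 \<in> M" "L f1 \<noteq> 0"
  shows "\<exists>n\<in>degs M. degs {f \<in> M. L f = 0} = degs M - {n}"
proof -
  let ?Q = "\<lambda>n. \<exists>f\<in>M. L f \<noteq> 0 \<and> D (int n) f"
  obtain n1 where "D n1 f1"
    using ex L0 D_exists[of f1] by auto
  then have "?Q (nat n1)"
    using ex D_nonneg by auto
  define n0 where "n0 = (LEAST n. ?Q n)"
  have "?Q n0"
    unfolding n0_def by (rule LeastI) fact
  then obtain f0 where f0: "f0 \<in> M" "L f0 \<noteq> 0" "D (int n0) f0"
    by blast
  have least: "int n0 \<le> n" if "f \<in> M" "L f \<noteq> 0" "D n f" for f n
    using Least_le[of ?Q "nat n"] that D_nonneg[of n f] unfolding n0_def by (auto simp: le_nat_iff)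
  have "degs {f \<in> M. L f = 0} = degs M - {int n0}"
  proof (intro equalityI subsetI)
    fix n assume "n \<in> degs {f \<in> M. L f = 0}"
    then obtain f where f: "f \<in> M" "L f = 0" "D n f" by (auto simp: degs_def)
    \<comment> \<open>Cancelling against \<open>f0\<close> would leave an element of smaller degree
      that is still outside the kernel, contradicting the minimality of \<open>n0\<close>.\<close>
    have "n \<noteq> int n0"
    proof
      assume "n = int n0"
      with D_cancel f0 f obtain k
        where k: "f0 - smul k f = 0 \<or> (\<exists>m<int n0. D m (f0 - smul k f))" by metis
      have "L (f0 - smul k f) \<noteq> 0" "f0 - smul k f \<in> M"
        using f0 f L M by auto
      with k L0 least show False by force
    qed
    then show "n \<in> degs M - {int n0}"
      using f by (auto simp: degs_def)
  next
    fix n assume "n \<in> degs M - {int n0}"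
    then obtain f where f: "f \<in> M" "D n f" "n \<noteq> int n0" by (auto simp: degs_def)
    show "n \<in> degs {f \<in> M. L f = 0}"
    proof (cases "L f = 0")
      case False
      then have "int n0 < n"
        using least f by fastforce
      \<comment> \<open>Since \<open>n0 < n\<close>, correcting by a multiple of \<open>f0\<close>
        moves \<open>f\<close> into the kernel without touching its degree.\<close>
      then have "D n (f - smul (L f / L f0) f0)"
        using D_diff f f0 by blast
      moreover have "L (f - smul (L f / L f0) f0) = 0" "f - smul (L f / L f0) f0 \<in> M"
        using f f0 L M by auto
      ultimately show ?thesis by (auto simp: degs_def)
    qed (use f in \<open>auto simp: degs_def\<close>)
  qed
  moreover have "int n0 \<in> degs M"
    using f0 by (auto simp: degs_def)
  ultimately show ?thesis by blast
qed

text \<open>Each functional costs one degree. The elements seen by one functional alone ensure that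
  a new functional does not vanish on the common kernel of the earlier ones; this is how
  independence of the conditions enters.\<close>

lemma degs_common_kernel:
  fixes L :: "'i \<Rightarrow> 'v \<Rightarrow> 'k"
  assumes "finite I"
    and L: "\<And>i f g k. L i (f - smul k g) = L i f - k * L i g" and L0: "\<And>i. L i 0 = 0"
    and ex: "\<And>i. i \<in> I \<Longrightarrow> \<exists>f. L i f \<noteq> 0 \<and> (\<forall>j\<in>I - {i}. L j f = 0)"
  shows "\<exists>X\<subseteq>degs UNIV. finite X \<and> card X = card I \<and> degs {f. \<forall>i\<in>I. L i f = 0} = degs UNIV - X"
  using \<open>finite I\<close> ex
proof (induction I)
  case empty
  then show ?case by (intro exI[of _ "{}"]) auto
next
  case (insert i I)
  have "\<exists>f. L j f \<noteq> 0 \<and> (\<forall>j'\<in>I - {j}. L j' f = 0)" if "j \<in> I" for j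
    using insert.prems[of j] that by blast
  with insert.IH obtain X where X: "X \<subseteq> degs UNIV" "finite X" "card X = card I"
      "degs {f. \<forall>i\<in>I. L i f = 0} = degs UNIV - X"
    by blast
  obtain f1 where "L i f1 \<noteq> 0" "\<forall>j\<in>I. L j f1 = 0"
    using insert.prems[of i] insert.hyps by blast
  then obtain n where n: "n \<in> degs {f. \<forall>i\<in>I. L i f = 0}"
      "degs {f \<in> {f. \<forall>i\<in>I. L i f = 0}. L i f = 0} = degs {f. \<forall>i\<in>I. L i f = 0} - {n}"
    using degs_kernel[of "{f. \<forall>i\<in>I. L i f = 0}" "L i" f1] by (auto simp: L L0)
  have "{f \<in> {f. \<forall>i\<in>I. L i f = 0}. L i f = 0} = {f. \<forall>i\<in>insert i I. L i f = 0}"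
    by auto
  with n X insert.hyps show ?case
    by (intro exI[of _ "insert n X"]) auto
qed

end

section \<open>Gaps, quotients of monomials and least common multiples\<close>

context mk_curve
begin

text \<open>Once the remainder \<open>j\<close> is reduced modulo \<open>a\<close>, being a nongap
  is just the sign of \<open>i\<close>.\<close>

lemma nongap_iff:
  fixes i j :: int
  assumes "0 \<le> j" "j < int a"
  shows "int a * i + int b * j \<in> nongaps \<longleftrightarrow> i \<ge> 0"
proof
  assume "int a * i + int b * j \<in> nongaps"
  then obtain i' j' where "int a * i + int b * j = int a * int i' + int b * int j'" "j' < a"
    by (auto simp: nongaps_eq)
  then show "i \<ge> 0"
    using combination_eq_cases[of i j "int i'" "int j'"] assms by simp
next
  assume "i \<ge> 0"
  then show "int a * i + int b * j \<in> nongaps"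
    unfolding nongaps_eq mem_Collect_eq using assms
    by (intro exI[of _ "nat i"] exI[of _ "nat j"]) auto
qed

text \<open>
  With \<open>t - s = a i + b j\<close>, \<open>0 \<le> j < a\<close>, the two minimal common multiples are \<open>s + b j\<close> and
  \<open>t + b (a - j)\<close>.
\<close>

lemma two_minimal_common_multiples:
  assumes "t - s \<notin> nongaps" "s - t \<notin> nongaps"
  obtains l1 l2 where "l1 - s \<in> nongaps" "l1 - t \<in> nongaps" "l2 - s \<in> nongaps" "l2 - t \<in> nongaps"
    "l1 - l2 \<notin> nongaps" "l2 - l1 \<notin> nongaps"
    "\<And>n. n - s \<in> nongaps \<Longrightarrow> n - t \<in> nongaps \<Longrightarrow> n - l1 \<in> nongaps \<or> n - l2 \<in> nongaps"
proof -
  obtain i j where ij: "t - s = int a * i + int b * j" "0 \<le> j" "j < int a"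
    using integer_combination_exists[OF a_pos coprime_ab] by blast
  then have i: "i < 0"
    using assms(1) nongap_iff[of j i] by auto
  have j: "j > 0"
  proof (rule ccontr)
    assume "\<not> j > 0"
    then have "s - t = int a * (- i) + int b * 0"
      using ij by (simp add: algebra_simps)
    then show False
      using assms(2) nongap_iff[of 0 "- i"] i a_pos by auto
  qed
  have "s - t = int a * (- i - int b) + int b * (int a - j)"
    using ij by (simp add: algebra_simps)
  then have i': "- i - int b < 0"
    using assms(2) nongap_iff[of "int a - j" "- i - int b"] ij j by auto
  \<comment> \<open>Each difference is put into the normal form of \<open>nongap_iff\<close>, zero
    coefficients included, which is why the closing call must not simplify these away.\<close>
  have e: "s + int b * j - s = int a * 0 + int b * j"
      "s + int b * j - t = int a * (- i) + int b * 0"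
      "t + int b * (int a - j) - s = int a * (i + int b) + int b * 0"
      "t + int b * (int a - j) - t = int a * 0 + int b * (int a - j)"
      "s + int b * j - (t + int b * (int a - j)) = int a * (- i - int b) + int b * j"
      "t + int b * (int a - j) - (s + int b * j) = int a * i + int b * (int a - j)"
    using ij(1) by (simp_all add: algebra_simps)
  show thesis
  proof (rule that[of "s + int b * j" "t + int b * (int a - j)"])
    fix n assume n: "n - s \<in> nongaps" "n - t \<in> nongaps"
    obtain p q where pq: "n - t = int a * p + int b * q" "0 \<le> q" "q < int a"
      using integer_combination_exists[OF a_pos coprime_ab] by blast
    have p: "p \<ge> 0"
      using n(2) pq nongap_iff by auto
    \<comment> \<open>The remainders \<open>q\<close> and \<open>j\<close> are added modulo
      \<open>a\<close>: without a carry \<open>n\<close> lies above the first common multiple, with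
      a carry above the second.\<close>
    show "n - (s + int b * j) \<in> nongaps \<or> n - (t + int b * (int a - j)) \<in> nongaps"
    proof (cases "q + j < int a")
      case True
      have "n - s = int a * (p + i) + int b * (q + j)"
        using pq ij by (simp add: algebra_simps)
      then have "p + i \<ge> 0"
        using n(1) nongap_iff[of "q + j" "p + i"] True pq ij by auto
      moreover have "n - (s + int b * j) = int a * (p + i) + int b * q"
        using pq ij by (simp add: algebra_simps)
      ultimately show ?thesis
        using nongap_iff[of q "p + i"] pq by auto
    next
      case False
      have "n - (t + int b * (int a - j)) = int a * p + int b * (q + j - int a)"
        using pq by (simp add: algebra_simps)
      then show ?thesis
        using nongap_iff[of "q + j - int a" p] False pq ij p by auto
    qed
  qed (unfold e, use i i' j ij in \<open>auto simp del: mult_zero_right mult_minus_right simp: nongap_iff\<close>)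
qed

lemma \<delta>_less_\<phi>: "t \<in> nongaps \<Longrightarrow> \<delta>_less f (\<phi> t) \<longleftrightarrow> below t f"
  using has_deg_\<phi>[of t] by (auto simp: \<delta>_less_def below_def has_deg_def)

lemma has_deg_quotient:
  assumes "has_deg t (l * g)" "has_deg s g"
  shows "has_deg (t - s) l"
proof -
  have "l \<noteq> 0"
    using assms(1) by (auto simp: has_deg_def)
  with assms \<delta>_mult[of l g] show ?thesis
    by (auto simp: has_deg_def)
qed

text \<open>Comparing degrees forces the monomial of the quotient; its scalar is then forced by the
  leading coefficient of \<open>\<phi> (t - s) * \<phi> s\<close>.\<close>

lemma quotient_exists:
  assumes "s \<in> nongaps" "t - s \<in> nongaps"
  shows "\<exists>!l. l \<in> terms \<and> below t (\<phi> t - l * \<phi> s)"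
proof -
  let ?q = "t - s"
  have t: "t \<in> nongaps" using nongaps_add[OF assms] by simp
  have prod: "has_deg t (\<phi> ?q * \<phi> s)"
    using has_deg_mult[OF has_deg_\<phi>[OF assms(2)] has_deg_\<phi>[OF assms(1)]] by simp
  obtain k where k: "k \<noteq> 0" "below t (\<phi> t - const k * (\<phi> ?q * \<phi> s))"
    using cancel_leading[OF has_deg_\<phi>[OF t] prod] by blast
  show ?thesis
  proof (intro ex1I[of _ "const k * \<phi> ?q"] conjI)
    show "const k * \<phi> ?q \<in> terms"
      using \<phi>_nongap[OF assms(2)] by (auto simp: terms_def)
    show "below t (\<phi> t - const k * \<phi> ?q * \<phi> s)"
      using k by (simp add: mult.assoc)
    fix l assume l: "l \<in> terms \<and> below t (\<phi> t - l * \<phi> s)"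
    then obtain k' m where m: "l = const k' * m" "m \<in> monomials" by (auto simp: terms_def)
    have "has_deg t (l * \<phi> s)"
      using has_deg_diff_below[OF has_deg_\<phi>[OF t], of "\<phi> t - l * \<phi> s"] l by simp
    then have "has_deg ?q l"
      using has_deg_\<phi>[OF assms(1)] has_deg_quotient by blast
    then have "\<delta> m = ?q"
      using has_deg_const_mult_iff[of ?q k' m] by (simp add: m has_deg_def)
    then have m': "m = \<phi> ?q"
      using \<phi>_\<delta>[OF m(2)] by simp
    have "below t ((\<phi> t - const k * (\<phi> ?q * \<phi> s)) - (\<phi> t - l * \<phi> s))"
      using k l below_diff by blast
    also have "(\<phi> t - const k * (\<phi> ?q * \<phi> s)) - (\<phi> t - l * \<phi> s) = const (k' - k) * (\<phi> ?q * \<phi> s)"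
      by (simp add: m m' const_diff algebra_simps)
    finally have "k' = k"
      using has_deg_const_mult_iff[of t "k' - k"] has_deg_not_below[of t _ t] prod by force
    then show "l = const k * \<phi> ?q"
      by (simp add: m m')
  qed
qed

lemma divides_\<phi>:
  assumes "s \<in> nongaps" "t \<in> nongaps"
  shows "divides (\<phi> s) (\<phi> t) \<longleftrightarrow> t - s \<in> nongaps"
proof
  assume "divides (\<phi> s) (\<phi> t)"
  then obtain l where l: "below t (\<phi> t - l * \<phi> s)"
    using assms by (auto simp: divides_def \<delta>_less_\<phi>)
  have "has_deg t (l * \<phi> s)"
    using has_deg_diff_below[OF has_deg_\<phi>[OF assms(2)], of "\<phi> t - l * \<phi> s"] l by simp
  then have "has_deg (t - s) l"
    using has_deg_\<phi>[OF assms(1)] has_deg_quotient by blast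
  then show "t - s \<in> nongaps"
    by (rule has_deg_nongap)
next
  assume "t - s \<in> nongaps"
  then show "divides (\<phi> s) (\<phi> t)"
    using quotient_exists[of s t] assms by (simp add: divides_def \<delta>_less_\<phi>)
qed

lemma mono_quot_\<phi>:
  assumes "s \<in> nongaps" "t - s \<in> nongaps"
  shows "has_deg (t - s) (mono_quot (\<phi> t) (\<phi> s))"
    and "below t (\<phi> t - mono_quot (\<phi> t) (\<phi> s) * \<phi> s)"
proof -
  let ?l = "mono_quot (\<phi> t) (\<phi> s)"
  have t: "t \<in> nongaps" using nongaps_add[OF assms] by simp
  show l: "below t (\<phi> t - ?l * \<phi> s)"
    using theI'[OF quotient_exists[OF assms]] t by (simp add: mono_quot_def \<delta>_less_\<phi>)
  have "has_deg t (?l * \<phi> s)"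
    using has_deg_diff_below[OF has_deg_\<phi>[OF t] l] by simp
  then show "has_deg (t - s) ?l"
    using has_deg_\<phi>[OF assms(1)] has_deg_quotient by blast
qed

text \<open>A covering set \<open>K\<close> treats comparable and incomparable arguments alike. In
  the incomparable case the description by \<open>THE\<close> must be shown unique: two covering
  pairs dominate each other, and domination is antisymmetric because nongaps are
  nonnegative.\<close>

lemma lcms_\<phi>:
  assumes s: "s \<in> nongaps" and t: "t \<in> nongaps"
  shows "\<exists>K. finite K \<and> lcms (\<phi> s) (\<phi> t) = \<phi> ` K \<and> (\<forall>k\<in>K. k - s \<in> nongaps \<and> k - t \<in> nongaps) \<and>
    (\<forall>n. n - s \<in> nongaps \<longrightarrow> n - t \<in> nongaps \<longrightarrow> (\<exists>k\<in>K. n - k \<in> nongaps))"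
proof (cases "t - s \<in> nongaps \<or> s - t \<in> nongaps")
  case True
  then consider "t - s \<in> nongaps" | "t - s \<notin> nongaps" "s - t \<in> nongaps" by blast
  then show ?thesis
  proof cases
    case 1
    then show ?thesis
      using s t by (intro exI[of _ "{t}"]) (simp add: lcms_def divides_\<phi>)
  next
    case 2
    then show ?thesis
      using s t by (intro exI[of _ "{s}"]) (simp add: lcms_def divides_\<phi>)
  qed
next
  case False
  obtain l1 l2 where l: "l1 - s \<in> nongaps" "l1 - t \<in> nongaps" "l2 - s \<in> nongaps" "l2 - t \<in> nongaps"
    "l1 - l2 \<notin> nongaps" "l2 - l1 \<notin> nongaps"
    "\<And>n. n - s \<in> nongaps \<Longrightarrow> n - t \<in> nongaps \<Longrightarrow> n - l1 \<in> nongaps \<or> n - l2 \<in> nongaps"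
    using two_minimal_common_multiples[of t s] False by blast
  have l': "l1 \<in> nongaps" "l2 \<in> nongaps"
    using nongaps_add[OF l(1) s] nongaps_add[OF l(3) s] by auto
  let ?C = "\<lambda>L. \<exists>l1 l2. L = {l1, l2} \<and> L \<subseteq> monomials \<and>
              (\<forall>l\<in>L. divides (\<phi> s) l \<and> divides (\<phi> t) l) \<and>
              (\<forall>k\<in>monomials. divides (\<phi> s) k \<and> divides (\<phi> t) k \<longrightarrow> divides l1 k \<or> divides l2 k)"
  have C: "?C L \<longleftrightarrow> L = {\<phi> l1, \<phi> l2}" for L
  proof
    assume "L = {\<phi> l1, \<phi> l2}"
    then show "?C L"
      using l l' s t
      by (intro exI[of _ "\<phi> l1"] exI[of _ "\<phi> l2"]) (auto simp: monomials_eq_\<phi> divides_\<phi>)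
  next
    assume "?C L"
    then obtain m1 m2 where m: "L = {\<phi> m1, \<phi> m2}" "m1 \<in> nongaps" "m2 \<in> nongaps"
        "m1 - s \<in> nongaps" "m1 - t \<in> nongaps" "m2 - s \<in> nongaps" "m2 - t \<in> nongaps"
        "\<And>n. n \<in> nongaps \<Longrightarrow> n - s \<in> nongaps \<Longrightarrow> n - t \<in> nongaps \<Longrightarrow> n - m1 \<in> nongaps \<or> n - m2 \<in> nongaps"
      using s t by (auto simp: monomials_eq_\<phi> divides_\<phi>)
    have tr: "n - k \<in> nongaps" if "n - m \<in> nongaps" "m - k \<in> nongaps" for n m k
      using nongaps_add[OF that] by simp
    have as: "n = m" if "n - m \<in> nongaps" "m - n \<in> nongaps" for n m
      using nongaps_nonneg[OF that(1)] nongaps_nonneg[OF that(2)] by simp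
    \<comment> \<open>\<open>l1\<close> lies above one of \<open>m1\<close>, \<open>m2\<close>,
      which in turn lies above one of \<open>l1\<close>, \<open>l2\<close>. As these two are
      incomparable, the chain returns to \<open>l1\<close>, so all its members agree; likewise for
      \<open>l2\<close>.\<close>
    have "l1 = m1 \<or> l1 = m2" "l2 = m1 \<or> l2 = m2"
      using m(8)[of l1] m(8)[of l2] l l' l(7)[of m1] l(7)[of m2] m(4-7) tr as by meson+
    moreover have "l1 \<noteq> l2"
      using l(5) by auto
    ultimately show "L = {\<phi> l1, \<phi> l2}"
      using m(1) by auto
  qed
  have "lcms (\<phi> s) (\<phi> t) = {\<phi> l1, \<phi> l2}"
    using False s t unfolding lcms_def C by (simp add: divides_\<phi>)
  then show ?thesis
    using l by (intro exI[of _ "{l1, l2}"]) auto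
qed

end

section \<open>Leading monomials in the module\<close>

context mk_curve
begin

text \<open>
  The leading monomial of \<open>f\<close> with respect to \<open>>\<^sub>s\<close> is \<open>\<phi>\<^sub>t\<close> for \<open>isG s t f\<close> and \<open>\<phi>\<^sub>t z\<close> for
  \<open>isF s t f\<close>.
\<close>

definition isG :: "int \<Rightarrow> int \<Rightarrow> 'r \<times> 'r \<Rightarrow> bool" where
  "isG s t f \<longleftrightarrow> has_deg t (snd f) \<and> below (t - s) (fst f)"

definition isF :: "int \<Rightarrow> int \<Rightarrow> 'r \<times> 'r \<Rightarrow> bool" where
  "isF s t f \<longleftrightarrow> has_deg t (fst f) \<and> below (t + s + 1) (snd f)"

lemma isG_or_isF:
  assumes "f \<noteq> 0"
  obtains t where "isG s t f" | t where "isF s t f"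
proof (cases "fst f = 0")
  case True
  then have "snd f \<noteq> 0"
    using assms by (metis prod_eq_iff zero_prod_def fst_conv snd_conv)
  then show thesis
    using True that(1)[of "\<delta> (snd f)"] by (simp add: isG_def has_degI)
next
  case False
  show thesis
  proof (cases "below (\<delta> (fst f) + s + 1) (snd f)")
    case True
    then show thesis
      using False that(2)[of "\<delta> (fst f)"] by (simp add: isF_def has_degI)
  next
    case False
    then show thesis
      using that(1)[of "\<delta> (snd f)"] by (auto simp: isG_def has_deg_def below_def)
  qed
qed

lemma isG_unique: "isG s t f \<Longrightarrow> isG s t' f \<Longrightarrow> t = t'"
  by (simp add: isG_def has_deg_def)

lemma isF_unique: "isF s t f \<Longrightarrow> isF s t' f \<Longrightarrow> t = t'"
  by (simp add: isF_def has_deg_def)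

lemma isG_not_isF: "isG s t f \<Longrightarrow> \<not> isF s t' f"
  by (auto simp: isG_def isF_def has_deg_def below_def)

lemma isG_nonzero: "isG s t f \<Longrightarrow> f \<noteq> 0"
  by (auto simp: isG_def has_deg_def)

lemma isF_nonzero: "isF s t f \<Longrightarrow> f \<noteq> 0"
  by (auto simp: isF_def has_deg_def)

lemma isG_nongap: "isG s t f \<Longrightarrow> t \<in> nongaps"
  using has_deg_nongap by (auto simp: isG_def)

lemma isF_nongap: "isF s t f \<Longrightarrow> t \<in> nongaps"
  using has_deg_nongap by (auto simp: isF_def)

lemma mod_lm_eqI:
  assumes "m \<in> mod_monomials" "mod_coef f m \<noteq> 0"
    and "\<And>m'. m' \<in> mod_monomials \<Longrightarrow> mod_coef f m' \<noteq> 0 \<Longrightarrow> m' \<noteq> m \<Longrightarrow> mod_gt s m m'"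
  shows "mod_lm s f = m"
  unfolding mod_lm_def
proof (rule the_equality)
  fix m' assume m': "m' \<in> mod_monomials \<and> mod_coef f m' \<noteq> 0 \<and>
    (\<forall>m''\<in>mod_monomials. mod_coef f m'' \<noteq> 0 \<and> m'' \<noteq> m' \<longrightarrow> mod_gt s m' m'')"
  show "m' = m"
  proof (rule ccontr)
    assume "m' \<noteq> m"
    then have "mod_gt s m m'" "mod_gt s m' m"
      using m' assms by auto
    then show False by (auto simp: mod_gt_def)
  qed
qed (use assms in auto)

lemma mod_monomials_cases:
  assumes "m \<in> mod_monomials"
  obtains n where "n \<in> nongaps" "m = (\<phi> n, 0)" | n where "n \<in> nongaps" "m = (0, \<phi> n)"
  using assms by (auto simp: mod_monomials_def monomials_eq_\<phi>)

lemma \<phi>_nonzero [simp]: "n \<in> nongaps \<Longrightarrow> \<phi> n \<noteq> 0"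
  using \<phi>_nongap(1) monomial_nonzero by blast

lemma coef_\<phi>_le: "has_deg t f \<Longrightarrow> coef f (\<phi> n) \<noteq> 0 \<Longrightarrow> n \<in> nongaps \<Longrightarrow> n \<le> t"
  using coef_support(2)[of t f "\<phi> n"] by (simp add: \<phi>_nongap)

lemma mod_lm_G:
  assumes "isG s t f"
  shows "mod_lm s f = (0, \<phi> t)" "mod_lc s f = coef (snd f) (\<phi> t)"
proof -
  have t: "t \<in> nongaps" "has_deg t (snd f)" "below (t - s) (fst f)"
    using assms isG_nongap by (auto simp: isG_def)
  show *: "mod_lm s f = (0, \<phi> t)"
  proof (rule mod_lm_eqI)
    show "(0, \<phi> t) \<in> mod_monomials"
      using t by (simp add: mod_monomials_def \<phi>_nongap)
    show "mod_coef f (0, \<phi> t) \<noteq> 0"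
      using t coef_support(1) by (simp add: mod_coef_def)
    fix m assume m: "m \<in> mod_monomials" "mod_coef f m \<noteq> 0" "m \<noteq> (0, \<phi> t)"
    from m(1) show "mod_gt s (0, \<phi> t) m"
    proof (cases rule: mod_monomials_cases)
      case (1 n)
      then have c: "coef (fst f) (\<phi> n) \<noteq> 0"
        using m by (simp add: mod_coef_def)
      then have "fst f \<noteq> 0" by auto
      then have "n < t - s"
        using coef_\<phi>_le[OF has_degI c 1(1)] t(3) by (simp add: below_def)
      then show ?thesis
        using 1 t by (simp add: mod_gt_def wdeg_def \<phi>_nongap)
    next
      case (2 n)
      then have "n \<le> t" "n \<noteq> t"
        using m t coef_\<phi>_le[of t "snd f" n] by (auto simp: mod_coef_def)
      then show ?thesis
        using 2 t by (simp add: mod_gt_def wdeg_def \<phi>_nongap)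
    qed
  qed
  show "mod_lc s f = coef (snd f) (\<phi> t)"
    using t by (simp add: mod_lc_def * mod_coef_def)
qed

lemma mod_lm_F:
  assumes "isF s t f"
  shows "mod_lm s f = (\<phi> t, 0)"
proof -
  have t: "t \<in> nongaps" "has_deg t (fst f)" "below (t + s + 1) (snd f)"
    using assms isF_nongap by (auto simp: isF_def)
  show ?thesis
  proof (rule mod_lm_eqI)
    show "(\<phi> t, 0) \<in> mod_monomials"
      using t by (simp add: mod_monomials_def \<phi>_nongap)
    show "mod_coef f (\<phi> t, 0) \<noteq> 0"
      using t coef_support(1) by (simp add: mod_coef_def)
    fix m assume m: "m \<in> mod_monomials" "mod_coef f m \<noteq> 0" "m \<noteq> (\<phi> t, 0)"
    from m(1) show "mod_gt s (\<phi> t, 0) m"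
    proof (cases rule: mod_monomials_cases)
      case (1 n)
      then have "n \<le> t" "n \<noteq> t"
        using m t coef_\<phi>_le[of t "fst f" n] by (auto simp: mod_coef_def)
      then show ?thesis
        using 1 t by (simp add: mod_gt_def wdeg_def \<phi>_nongap)
    next
      case (2 n)
      then have c: "coef (snd f) (\<phi> n) \<noteq> 0"
        using m by (simp add: mod_coef_def)
      then have "snd f \<noteq> 0" by auto
      then have "n < t + s + 1"
        using coef_\<phi>_le[OF has_degI c 2(1)] t(3) by (simp add: below_def)
      then show ?thesis
        using 2 t by (auto simp: mod_gt_def wdeg_def \<phi>_nongap)
    qed
  qed
qed

lemma mod_divides_GG:
  "isG s t g \<Longrightarrow> isG s t' f \<Longrightarrow> mod_divides (mod_lm s g) (mod_lm s f) \<longleftrightarrow> t' - t \<in> nongaps"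
  using isG_nongap[of s t g] isG_nongap[of s t' f] by (simp add: mod_lm_G mod_divides_def divides_\<phi>)

lemma mod_divides_FF:
  "isF s t g \<Longrightarrow> isF s t' f \<Longrightarrow> mod_divides (mod_lm s g) (mod_lm s f) \<longleftrightarrow> t' - t \<in> nongaps"
  using isF_nongap[of s t g] isF_nongap[of s t' f] by (simp add: mod_lm_F mod_divides_def divides_\<phi>)

lemma mod_divides_GF: "isG s t g \<Longrightarrow> isF s t' f \<Longrightarrow> \<not> mod_divides (mod_lm s g) (mod_lm s f)"
  using isG_nongap[of s t g] isF_nongap[of s t' f] by (simp add: mod_lm_G mod_lm_F mod_divides_def)

lemma mod_divides_FG: "isF s t g \<Longrightarrow> isG s t' f \<Longrightarrow> \<not> mod_divides (mod_lm s g) (mod_lm s f)"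
  using isF_nongap[of s t g] isG_nongap[of s t' f] by (simp add: mod_lm_G mod_lm_F mod_divides_def)

lemma mod_divides_iff:
  assumes "f \<noteq> 0" "g \<noteq> 0"
  shows "mod_divides (mod_lm s g) (mod_lm s f) \<longleftrightarrow>
    (\<exists>t t'. isG s t g \<and> isG s t' f \<and> t' - t \<in> nongaps) \<or>
    (\<exists>t t'. isF s t g \<and> isF s t' f \<and> t' - t \<in> nongaps)" (is "_ \<longleftrightarrow> ?R")
proof
  assume "mod_divides (mod_lm s g) (mod_lm s f)"
  then show ?R
    using assms mod_divides_GG mod_divides_FF mod_divides_GF mod_divides_FG isG_or_isF by metis
qed (use mod_divides_GG mod_divides_FF in blast)

lemma mod_divides_refl: "f \<noteq> 0 \<Longrightarrow> mod_divides (mod_lm s f) (mod_lm s f)"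
  by (rule isG_or_isF[of f s]) (auto simp: mod_divides_GG mod_divides_FF)

lemma nongaps_diff_trans: "n - m \<in> nongaps \<Longrightarrow> m - k \<in> nongaps \<Longrightarrow> n - k \<in> nongaps"
  using nongaps_add[of "n - m" "m - k"] by simp

lemma mod_divides_trans:
  assumes "f \<noteq> 0" "g \<noteq> 0" "h \<noteq> 0"
    and "mod_divides (mod_lm s f) (mod_lm s g)" "mod_divides (mod_lm s g) (mod_lm s h)"
  shows "mod_divides (mod_lm s f) (mod_lm s h)"
  using assms(4,5) unfolding mod_divides_iff[OF assms(2,1)] mod_divides_iff[OF assms(3,2)]
    mod_divides_iff[OF assms(3,1)]
  by (metis isG_unique isF_unique isG_not_isF nongaps_diff_trans)

section \<open>Submodules, Groebner bases and S-polynomials\<close>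

definition submod :: "('r \<times> 'r) set \<Rightarrow> bool" where
  "submod M \<longleftrightarrow> (\<forall>f\<in>M. \<forall>g\<in>M. f - g \<in> M) \<and> (\<forall>r. \<forall>f\<in>M. mod_smult r f \<in> M)"

lemma submod_diff: "submod M \<Longrightarrow> f \<in> M \<Longrightarrow> g \<in> M \<Longrightarrow> f - g \<in> M"
  by (simp add: submod_def)

lemma submod_smult: "submod M \<Longrightarrow> f \<in> M \<Longrightarrow> mod_smult r f \<in> M"
  by (simp add: submod_def)

lemma mod_smult_sel [simp]: "fst (mod_smult r f) = r * fst f" "snd (mod_smult r f) = r * snd f"
  by (simp_all add: mod_smult_def)

lemma isG_smult: "has_deg q r \<Longrightarrow> isG s t f \<Longrightarrow> isG s (q + t) (mod_smult r f)"
  using below_mult[of q r "t - s" "fst f"] by (simp add: isG_def has_deg_mult algebra_simps)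

lemma isF_smult: "has_deg q r \<Longrightarrow> isF s t f \<Longrightarrow> isF s (q + t) (mod_smult r f)"
  using below_mult[of q r "t + s + 1" "snd f"] by (simp add: isF_def has_deg_mult algebra_simps)

text \<open>Minimality is not demanded, so that the unreduced candidate sets inside an update
  qualify as well as the bases the algorithm stores.\<close>

definition gb :: "int \<Rightarrow> ('r \<times> 'r) set \<Rightarrow> ('r \<times> 'r) set \<Rightarrow> bool" where
  "gb s M B \<longleftrightarrow> finite B \<and> B \<subseteq> M \<and> 0 \<notin> B \<and>
     (\<forall>f\<in>M. f \<noteq> 0 \<longrightarrow> (\<exists>g\<in>B. mod_divides (mod_lm s g) (mod_lm s f)))"

text \<open>Divisibility never crosses between \<open>R\<close> and \<open>R z\<close>, so the
  divisor is of the same kind.\<close>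

lemma gb_G:
  assumes "gb s M B" "f \<in> M" "isG s t f"
  obtains G q where "G \<in> B" "isG s q G" "t - q \<in> nongaps"
proof -
  obtain g where g: "g \<in> B" "mod_divides (mod_lm s g) (mod_lm s f)" "g \<noteq> 0"
    using assms isG_nonzero unfolding gb_def by metis
  then show thesis
    using that assms mod_divides_iff[of f g s] isG_unique isG_not_isF isG_nonzero by metis
qed

lemma gb_F:
  assumes "gb s M B" "f \<in> M" "isF s t f"
  obtains F q where "F \<in> B" "isF s q F" "t - q \<in> nongaps"
proof -
  obtain g where g: "g \<in> B" "mod_divides (mod_lm s g) (mod_lm s f)" "g \<noteq> 0"
    using assms isF_nonzero unfolding gb_def by metis
  then show thesis
    using that assms mod_divides_iff[of f g s] isF_unique isG_not_isF isF_nonzero by metis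
qed

lemma gbI:
  assumes "finite B" "B \<subseteq> M" "0 \<notin> B"
    and "\<And>f t. f \<in> M \<Longrightarrow> isG s t f \<Longrightarrow> \<exists>G\<in>B. \<exists>q. isG s q G \<and> t - q \<in> nongaps"
    and "\<And>f t. f \<in> M \<Longrightarrow> isF s t f \<Longrightarrow> \<exists>F\<in>B. \<exists>q. isF s q F \<and> t - q \<in> nongaps"
  shows "gb s M B"
  unfolding gb_def
proof (intro conjI ballI impI assms(1-3))
  fix f assume f: "f \<in> M" "f \<noteq> 0"
  from f(2) show "\<exists>g\<in>B. mod_divides (mod_lm s g) (mod_lm s f)"
  proof (cases rule: isG_or_isF[of f s])
    case (1 t)
    with assms(4) f show ?thesis by (metis mod_divides_GG)
  next
    case (2 t)
    with assms(5) f show ?thesis by (metis mod_divides_FF)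
  qed
qed

text \<open>Division by the leading coefficient makes \<open>f\<close> equal to
  \<open>\<phi> n\<close> up to lower degree, and multiplication by \<open>q\<close> turns this into
  \<open>\<phi> k\<close> up to lower degree. Both halves of an S-polynomial have this shape and
  therefore cancel.\<close>

lemma normalized_multiple:
  assumes "has_deg n f" "below k (\<phi> k - q * \<phi> n)" "has_deg (k - n) q"
  shows "below k (const (inverse (coef f (\<phi> n))) * q * f - \<phi> k)"
proof -
  let ?c = "coef f (\<phi> n)"
  have n: "n \<in> nongaps" using assms(1) by (rule has_deg_nongap)
  have c: "?c \<noteq> 0" using assms(1) by (rule coef_support)
  have "below n (f - const ?c * \<phi> n)"
    using below_Suc_coef[OF has_deg_imp_below[OF assms(1)] n] by simp
  then have "below n (const (inverse ?c) * (f - const ?c * \<phi> n))"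
    by (rule below_const_mult)
  also have "const (inverse ?c) * (f - const ?c * \<phi> n) = const (inverse ?c) * f - \<phi> n"
    using const_inverse[OF c] by (simp add: right_diff_distrib flip: mult.assoc)
  finally have "below ((k - n) + n) (q * (const (inverse ?c) * f - \<phi> n))"
    using assms(3) below_mult by blast
  then have "below k (q * (const (inverse ?c) * f - \<phi> n) - (\<phi> k - q * \<phi> n))"
    using assms(2) by (intro below_diff[of k "q * (const (inverse ?c) * f - \<phi> n)"]) simp_all
  also have "q * (const (inverse ?c) * f - \<phi> n) - (\<phi> k - q * \<phi> n) = const (inverse ?c) * q * f - \<phi> k"
    by (simp add: algebra_simps)
  finally show ?thesis .
qed

text \<open>In \<open>R\<close> the two multiples agree up to degree below \<open>k\<close>; in
  \<open>R z\<close> the multiple of \<open>F\<close> prevails, since \<open>isG\<close> bounds that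
  component of \<open>G\<close> strictly. What remains leads in \<open>R z\<close> even for the
  order of \<open>s - 1\<close>.\<close>

lemma isF_spoly:
  assumes F: "isF s t F" "has_deg (t + s) (snd F)" and G: "isG s m G"
    and p: "has_deg (k - (t + s)) p" "below k (p * snd F - \<phi> k)"
    and q: "has_deg (k - m) q" "below k (q * snd G - \<phi> k)"
  shows "isF (s - 1) (k - s) (mod_smult p F - mod_smult q G)"
proof -
  have "has_deg (k - s) (p * fst F)"
    using has_deg_mult[OF p(1), of t "fst F"] F by (simp add: isF_def)
  moreover have "below (k - s) (q * fst G)"
    using below_mult[OF q(1), of "m - s" "fst G"] G by (simp add: isG_def)
  ultimately have "has_deg (k - s) (p * fst F - q * fst G)"
    by (rule has_deg_diff_below)
  moreover have "below k (p * snd F - q * snd G)"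
    using below_diff[OF p(2) q(2)] by simp
  ultimately show ?thesis
    by (simp add: isF_def)
qed

lemma isG_pred: "isG s t f \<Longrightarrow> isG (s - 1) t f"
  by (auto simp: isG_def intro: below_mono)

text \<open>Lowering \<open>s\<close> by one affects only ties: \<open>f\<close> changes sides
  exactly if its component in \<open>R\<close> reaches degree \<open>t + s\<close>, where
  \<open>>\<^sub>s\<close> still prefers \<open>R z\<close>.\<close>

lemma isF_pred_cases:
  assumes "isF s t f"
  obtains "isF (s - 1) t f" | "isG (s - 1) (t + s) f" "has_deg (t + s) (snd f)"
  using assms by (auto simp: isF_def isG_def below_Suc_cases has_deg_imp_below)

text \<open>
  Cancelling the leading terms in \<open>R z\<close> exposes the component in \<open>R\<close>, whose weighted degree reaches
  \<open>t + s\<close> in exactly one of \<open>f\<close> and the multiple of \<open>F\<close>.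
\<close>

lemma subtract_F_multiple:
  assumes M: "submod M" "f \<in> M" "F \<in> M" and f: "isF s t f" and F: "isF s q F"
    and tq: "t - q \<in> nongaps"
    and one: "has_deg (t + s) (snd f) \<noteq> has_deg (q + s) (snd F)"
  obtains g where "g \<in> M" "isG s (t + s) g"
proof -
  have e: "has_deg t (\<phi> (t - q) * fst F)"
    using has_deg_mult[OF has_deg_\<phi>[OF tq], of q "fst F"] F by (simp add: isF_def)
  obtain k where k: "k \<noteq> 0" "below t (fst f - const k * (\<phi> (t - q) * fst F))"
    using cancel_leading[of t "fst f"] e f by (auto simp: isF_def)
  let ?r = "const k * \<phi> (t - q)"
  let ?g = "f - mod_smult ?r F"
  have r: "has_deg (t - q) ?r"
    using k tq by (intro has_deg_const_mult has_deg_\<phi>)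
  have "has_deg (t + s) (snd f - ?r * snd F)"
  proof (cases "has_deg (t + s) (snd f)")
    case True
    then have "below (q + s) (snd F)"
      using one F by (simp add: isF_def below_Suc_cases)
    from below_mult[OF r this] True show ?thesis
      by (intro has_deg_diff_below) (simp_all add: algebra_simps)
  next
    case False
    then have "below (t + s) (snd f)" "has_deg (q + s) (snd F)"
      using one f by (simp_all add: isF_def below_Suc_cases)
    with has_deg_mult[OF r this(2)] show ?thesis
      by (intro has_deg_below_diff) (simp_all add: algebra_simps)
  qed
  then have "isG s (t + s) ?g"
    using k(2) by (simp add: isG_def mult.assoc)
  then show thesis
    using that M submod_diff submod_smult by blast
qed

end

section \<open>Classification and reduction of a basis\<close>

context mk_code
begin

lemma G_part_eq: "0 \<notin> B \<Longrightarrow> G_part s B = {f \<in> B. \<exists>t. isG s t f}"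
  unfolding G_part_def
  by (intro Collect_cong conj_cong refl)
     (metis isG_or_isF mod_lm_G(1) mod_lm_F fst_conv \<phi>_nonzero isF_nongap isG_not_isF)

lemma F_part_eq: "0 \<notin> B \<Longrightarrow> F_part s B = {f \<in> B. \<exists>t. isF s t f}"
  unfolding F_part_def
  by (intro Collect_cong conj_cong refl)
     (metis isG_or_isF mod_lm_G(1) mod_lm_F snd_conv \<phi>_nonzero isG_nongap isG_not_isF)

lemma \<Sigma>_R_iff:
  assumes "\<And>G. G \<in> Gs \<Longrightarrow> \<exists>t. isG s t G" "n \<in> nongaps"
  shows "\<phi> n \<in> \<Sigma>_R s Gs \<longleftrightarrow> (\<exists>G\<in>Gs. \<exists>t. isG s t G \<and> n - t \<in> nongaps)"
proof -
  have "mod_divides (mod_lm s G) (0, \<phi> n) \<longleftrightarrow> (\<exists>t. isG s t G \<and> n - t \<in> nongaps)" if "G \<in> Gs" for G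
  proof -
    obtain t where t: "isG s t G" using assms(1) \<open>G \<in> Gs\<close> by blast
    have "mod_divides (mod_lm s G) (0, \<phi> n) \<longleftrightarrow> n - t \<in> nongaps"
      using isG_nongap[OF t] assms(2) by (simp add: mod_lm_G[OF t] mod_divides_def divides_\<phi>)
    then show ?thesis
      using t isG_unique by blast
  qed
  then show ?thesis
    using assms(2) by (auto simp: \<Sigma>_R_def \<phi>_nongap)
qed

text \<open>Inserting \<open>f\<close> may evict survivors; by transitivity of divisibility
  \<open>f\<close> takes over everything an evicted element covered.\<close>

lemma reduction_exists:
  assumes "finite A" "0 \<notin> A"
  shows "\<exists>A'. reduction s A A'"
  using assms
proof (induction A)
  case empty
  then show ?case by (intro exI[of _ "{}"]) (simp add: reduction_def)
next
  case (insert f A)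
  let ?div = "\<lambda>g f. mod_divides (mod_lm s g) (mod_lm s f)"
  obtain A' where A': "A' \<subseteq> A" "\<And>f g. f \<in> A' \<Longrightarrow> g \<in> A' \<Longrightarrow> g \<noteq> f \<Longrightarrow> \<not> ?div g f"
      "\<And>f. f \<in> A - A' \<Longrightarrow> \<exists>g\<in>A'. ?div g f"
  proof -
    obtain A' where "reduction s A A'"
      using insert by auto
    then show thesis
      by (intro that[of A']) (auto simp: reduction_def)
  qed
  have tr: "?div g k" if "?div g h" "?div h k" "{g, h, k} \<subseteq> insert f A" for g h k
    using mod_divides_trans[of g h k s] that insert.prems by auto
  show ?case
  proof (cases "\<exists>g\<in>A'. ?div g f")
    case True
    with A' show ?thesis
      by (intro exI[of _ A']) (auto simp: reduction_def)
  next
    case False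
    let ?A = "insert f {g \<in> A'. \<not> ?div f g}"
    have "\<exists>g\<in>?A. ?div g h" if h: "h \<in> insert f A - ?A" for h
    proof (cases "h \<in> A'")
      case False
      then obtain g where g: "g \<in> A'" "?div g h"
        using A'(3) h by blast
      show ?thesis
      proof (cases "?div f g")
        case True
        then show ?thesis
          using tr[OF True g(2)] g A'(1) h by auto
      next
        case False
        then show ?thesis using g by blast
      qed
    qed (use h in auto)
    then have "reduction s (insert f A) ?A"
      using A'(1,2) False by (auto simp: reduction_def)
    then show ?thesis by blast
  qed
qed

lemma reduction_covers:
  assumes "reduction s A A'" "f \<in> A" "0 \<notin> A"
  shows "\<exists>g\<in>A'. mod_divides (mod_lm s g) (mod_lm s f)"
proof (cases "f \<in> A'")
  case True
  moreover have "f \<noteq> 0" using assms by blast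
  ultimately show ?thesis using mod_divides_refl by blast
qed (use assms in \<open>auto simp: reduction_def\<close>)

end

section \<open>The Groebner basis update\<close>

context mk_code
begin

text \<open>The last case does not name the polynomials. It records that they jointly cover every
  common multiple \<open>n\<close> of \<open>t + s\<close> and the degree \<open>m\<close> of some
  \<open>G\<close>, which is the form the completeness argument uses.\<close>

lemma spoly_cases:
  assumes M: "submod M" "Gs \<subseteq> M" "F \<in> M"
    and Gs: "\<forall>G\<in>Gs. \<exists>t. isG s t G" "finite Gs"
    and F: "isF s t F" and ch: "valid_choice s Gs ch F"
  obtains
      (kept) "isF (s - 1) t F" "spoly s Gs ch F = {F}"
    | (reduced) H where "has_deg (t + s) (snd F)" "\<phi> (t + s) \<in> \<Sigma>_R s Gs"
        "H \<in> M" "isF (s - 1) t H" "spoly s Gs ch F = {H}"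
    | (lcm) "has_deg (t + s) (snd F)" "\<phi> (t + s) \<notin> \<Sigma>_R s Gs"
        "finite (spoly s Gs ch F)"
        "\<And>H. H \<in> spoly s Gs ch F \<Longrightarrow> H \<in> M \<and> (\<exists>t'. isF (s - 1) t' H)"
        "\<And>G m n. G \<in> Gs \<Longrightarrow> isG s m G \<Longrightarrow> n - (t + s) \<in> nongaps \<Longrightarrow> n - m \<in> nongaps \<Longrightarrow>
           \<exists>H\<in>spoly s Gs ch F. \<exists>k. isF (s - 1) (k - s) H \<and> n - k \<in> nongaps"
  using F
proof (cases rule: isF_pred_cases)
  case 1
  then show thesis
    by (intro kept) (simp_all add: spoly_def mod_lm_F)
next
  case 2
  let ?n = "t + s"
  have n: "?n \<in> nongaps" and FU: "has_deg t (fst F)"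
    using 2 F has_deg_nongap by (auto simp: isF_def)
  have lmF: "mod_lm (s - 1) F = (0, \<phi> ?n)" "mod_lc (s - 1) F = coef (snd F) (\<phi> ?n)"
    using 2(1) by (simp_all add: mod_lm_G)
  show thesis
  proof (cases "\<phi> ?n \<in> \<Sigma>_R s Gs")
    case True
    let ?G = "ch F"
    have chG: "?G \<in> Gs" "mod_divides (mod_lm s ?G) (0, \<phi> ?n)"
      using ch True by (auto simp: valid_choice_def lmF)
    obtain m where m: "isG s m ?G" using Gs chG by blast
    have m': "m \<in> nongaps" "has_deg m (snd ?G)"
      using m isG_nongap by (auto simp: isG_def)
    have nm: "?n - m \<in> nongaps"
      using chG(2) m' n by (simp add: mod_lm_G[OF m] mod_divides_def divides_\<phi>)
    let ?p = "const (inverse (coef (snd F) (\<phi> ?n)))"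
    let ?q = "const (inverse (coef (snd ?G) (\<phi> m))) * mono_quot (\<phi> ?n) (\<phi> m)"
    let ?H = "mod_smult ?p F - mod_smult ?q ?G"
    \<comment> \<open>The lcm is the leading monomial of \<open>F\<close> itself, so the degree in
      \<open>R z\<close> is \<open>?n - s = t\<close>, unchanged.\<close>
    have "isF (s - 1) (?n - s) ?H"
    proof (rule isF_spoly[OF F 2(2) m])
      show "has_deg (?n - ?n) ?p"
        using coef_support(1)[OF 2(2)] by (simp add: has_deg_const)
      show "below ?n (?p * snd F - \<phi> ?n)"
        using normalized_multiple[OF 2(2), of ?n 1] has_deg_const[of 1] by simp
      show "has_deg (?n - m) ?q"
        using coef_support(1)[OF m'(2)] mono_quot_\<phi>[OF m'(1) nm] by (intro has_deg_const_mult) auto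
      show "below ?n (?q * snd ?G - \<phi> ?n)"
        using normalized_multiple[OF m'(2) mono_quot_\<phi>(2,1)[OF m'(1) nm]] .
    qed
    moreover have "?H \<in> M"
      using M chG by (intro submod_diff submod_smult) auto
    moreover have "spoly s Gs ch F = {?H}"
      using True n by (simp add: spoly_def Let_def lmF mod_lm_G[OF m])
    ultimately show thesis
      using 2(2) True by (intro reduced) simp_all
  next
    case False
    let ?H = "\<lambda>G p. mod_smult (const (inverse (coef (snd F) (\<phi> ?n))) * mono_quot p (\<phi> ?n)) F
         - mod_smult (const (inverse (mod_lc s G)) * mono_quot p (snd (mod_lm s G))) G"
    have sp: "spoly s Gs ch F = {?H G p | G p. G \<in> Gs \<and> p \<in> lcms (\<phi> ?n) (snd (mod_lm s G))}"
      using False n by (simp add: spoly_def Let_def lmF)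
    have fin: "finite (lcms (\<phi> ?n) (snd (mod_lm s G)))" if "G \<in> Gs" for G
    proof -
      obtain m where m: "isG s m G" using Gs(1) \<open>G \<in> Gs\<close> by blast
      then show ?thesis
        using lcms_\<phi>[OF n isG_nongap[OF m]] by (auto simp: mod_lm_G)
    qed
    have "spoly s Gs ch F = (\<Union>G\<in>Gs. ?H G ` lcms (\<phi> ?n) (snd (mod_lm s G)))"
      unfolding sp by blast
    then have finsp: "finite (spoly s Gs ch F)"
      using fin Gs(2) by simp
    have H: "isF (s - 1) (k - s) (?H G (\<phi> k))"
      if "isG s m G" "k - ?n \<in> nongaps" "k - m \<in> nongaps" for G m k
    proof -
      have m': "m \<in> nongaps" "has_deg m (snd G)"
        using that isG_nongap by (auto simp: isG_def)
      show ?thesis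
        unfolding mod_lm_G[OF that(1)] snd_conv
      proof (rule isF_spoly[OF F 2(2) that(1)])
        show "has_deg (k - ?n) (const (inverse (coef (snd F) (\<phi> ?n))) * mono_quot (\<phi> k) (\<phi> ?n))"
          using coef_support(1)[OF 2(2)] mono_quot_\<phi>[OF n that(2)] by (intro has_deg_const_mult) auto
        show "has_deg (k - m) (const (inverse (coef (snd G) (\<phi> m))) * mono_quot (\<phi> k) (\<phi> m))"
          using coef_support(1)[OF m'(2)] mono_quot_\<phi>[OF m'(1) that(3)] by (intro has_deg_const_mult) auto
      qed (rule normalized_multiple[OF 2(2) mono_quot_\<phi>(2,1)[OF n that(2)]]
          normalized_multiple[OF m'(2) mono_quot_\<phi>(2,1)[OF m'(1) that(3)]])+
    qed
    show thesis
    proof (rule lcm[OF 2(2) False finsp])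
      fix H assume "H \<in> spoly s Gs ch F"
      then obtain G p where G: "G \<in> Gs" "p \<in> lcms (\<phi> ?n) (snd (mod_lm s G))" "H = ?H G p"
        unfolding sp by blast
      obtain m where m: "isG s m G" using Gs G by blast
      obtain k where k: "p = \<phi> k" "k - ?n \<in> nongaps" "k - m \<in> nongaps"
        using lcms_\<phi>[OF n isG_nongap[OF m]] G(2) by (auto simp: mod_lm_G[OF m])
      have "H \<in> M"
        using M G by (auto intro: submod_diff submod_smult)
      then show "H \<in> M \<and> (\<exists>t'. isF (s - 1) t' H)"
        using H[OF m k(2,3)] G(3) k(1) by blast
    next
      fix G m k0 assume G: "G \<in> Gs" and m: "isG s m G" and k0: "k0 - ?n \<in> nongaps" "k0 - m \<in> nongaps"
      obtain K where K: "lcms (\<phi> ?n) (\<phi> m) = \<phi> ` K"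
          "\<And>k. k \<in> K \<Longrightarrow> k - ?n \<in> nongaps \<and> k - m \<in> nongaps"
          "\<And>j. j - ?n \<in> nongaps \<Longrightarrow> j - m \<in> nongaps \<Longrightarrow> \<exists>k\<in>K. j - k \<in> nongaps"
        using lcms_\<phi>[OF n isG_nongap[OF m]] by metis
      obtain k where k: "k \<in> K" "k0 - k \<in> nongaps"
        using K(3)[OF k0] by blast
      have "?H G (\<phi> k) \<in> spoly s Gs ch F"
        unfolding sp mem_Collect_eq using G k(1) K(1)
        by (intro exI[of _ G] exI[of _ "\<phi> k"]) (simp add: mod_lm_G[OF m])
      moreover have "isF (s - 1) (k - s) (?H G (\<phi> k))"
        using H[OF m] K(2)[OF k(1)] by blast
      ultimately show "\<exists>H\<in>spoly s Gs ch F. \<exists>k. isF (s - 1) (k - s) H \<and> k0 - k \<in> nongaps"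
        using k(2) by blast
    qed
  qed
qed

lemma spoly_sound:
  assumes "submod M" "Gs \<subseteq> M" "F \<in> M" "\<forall>G\<in>Gs. \<exists>t. isG s t G" "finite Gs"
    and "isF s t F" "valid_choice s Gs ch F"
  shows "finite (spoly s Gs ch F)" "H \<in> spoly s Gs ch F \<Longrightarrow> H \<in> M \<and> (\<exists>t'. isF (s - 1) t' H)"
  by (rule spoly_cases[OF assms]; use assms(3) in auto)+

text \<open>An element of \<open>M\<close> whose leading monomial keeps its side, and whose divisor
  in \<open>B\<close> keeps it too, stays covered. Trouble comes only from ties: the element
  \<open>f\<close> or the \<open>F\<close> dividing it moves from \<open>R z\<close> to
  \<open>R\<close>, and the cases distinguish which of the two does.\<close>

lemma candidates_cover:
  assumes gb: "gb s M B" and M: "submod M"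
    and ch: "\<forall>F\<in>F_part s B. valid_choice s (G_part s B) ch F"
    and A1: "A1 = G_part s B \<union> {F \<in> F_part s B. snd (mod_lm (s - 1) F) \<in> \<Delta>_R s (G_part s B)}"
    and A2: "A2 = (\<Union>F\<in>F_part s B. spoly s (G_part s B) ch F)"
  shows "gb (s - 1) M (A1 \<union> A2)"
proof -
  let ?Gs = "G_part s B" and ?Fs = "F_part s B"
  have B: "finite B" "B \<subseteq> M" "0 \<notin> B"
    using gb by (auto simp: gb_def)
  note parts = G_part_eq[OF B(3)] F_part_eq[OF B(3)]
  have Gs: "\<forall>G\<in>?Gs. \<exists>t. isG s t G" "finite ?Gs" "?Gs \<subseteq> M"
    using B by (auto simp: parts)
  have FsM: "F \<in> M" if "F \<in> ?Fs" for F
    using B that by (auto simp: parts)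

  note sound = spoly_sound[OF M Gs(3) FsM Gs(1,2) _ ch[rule_format]]
  have FsF: "\<exists>t. isF s t F" "F \<noteq> 0" if "F \<in> ?Fs" for F
    using that B(3) by (auto simp: parts)
  have sp: "finite (spoly s ?Gs ch F)" "H \<in> spoly s ?Gs ch F \<Longrightarrow> H \<in> M \<and> H \<noteq> 0" if "F \<in> ?Fs" for F H
    using FsF(1)[OF that] sound[OF that _ that] isF_nonzero by blast+
  have "finite ?Fs"
    using B(1) by (simp add: parts)
  then have fin: "finite (A1 \<union> A2)"
    using Gs(2) sp(1) unfolding A1 A2 by simp
  have sub: "A1 \<union> A2 \<subseteq> M"
    using Gs(3) FsM sp(2) unfolding A1 A2 by blast
  have nz: "0 \<notin> A1 \<union> A2"
    using Gs(1) isG_nonzero FsF(2) sp(2) unfolding A1 A2 by blast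
  have G: "\<exists>G\<in>A1. \<exists>q. isG (s - 1) q G \<and> t - q \<in> nongaps" if f: "f \<in> M" "isG s t f" for f t
  proof -
    obtain G q where "G \<in> B" "isG s q G" "t - q \<in> nongaps"
      using gb_G[OF gb f] by metis
    then show ?thesis
      using isG_pred unfolding A1 parts by blast
  qed
  show ?thesis
  proof (rule gbI[OF fin sub nz])
    fix f t assume f: "f \<in> M" "isG (s - 1) t f"
    have "\<exists>G\<in>A1. \<exists>q. isG (s - 1) q G \<and> t - q \<in> nongaps"
    proof (cases "isG s t f")
      case True
      then show ?thesis using G f by blast
    next
      case False
      then have fU: "isF s (t - s) f"
        using f(2) below_Suc_cases[of "t - s" "fst f"]
        by (auto simp: isG_def isF_def algebra_simps intro: has_deg_imp_below)
      then obtain F q where F: "F \<in> B" "isF s q F" "t - s - q \<in> nongaps"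
        using gb_F[OF gb f(1)] by metis
      show ?thesis
      proof (cases "has_deg (q + s) (snd F)")
        case True
        then have F': "isG (s - 1) (q + s) F"
          using F(2) by (auto simp: isG_def isF_def intro: has_deg_imp_below)
        have qs: "q + s \<in> nongaps" "\<phi> (q + s) \<in> monomials"
          using True has_deg_nongap \<phi>_nongap by blast+
        \<comment> \<open>Here \<open>f\<close> and \<open>F\<close> change sides together. Either
          \<open>F\<close> is kept in \<open>A1\<close>, or some \<open>G\<close> divides its new
          leading monomial and with it that of \<open>f\<close>.\<close>
        show ?thesis
        proof (cases "\<phi> (q + s) \<in> \<Sigma>_R s ?Gs")
          case True
          then obtain G m where "G \<in> ?Gs" "isG s m G" "q + s - m \<in> nongaps"
            using \<Sigma>_R_iff[OF Gs(1)[rule_format] qs(1)] by blast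
          moreover from this have "t - m \<in> nongaps"
            using nongaps_diff_trans[of t "q + s" m] F(3) by (simp add: algebra_simps)
          ultimately show ?thesis
            using isG_pred unfolding A1 by blast
        next
          case False
          then have "F \<in> A1"
            using F F' qs unfolding A1 by (auto simp: parts \<Delta>_R_def mod_lm_G[OF F'])
          then show ?thesis
            using F F' by (intro bexI[of _ F] exI[of _ "q + s"]) (auto simp: algebra_simps)
        qed
      next
        case False
        \<comment> \<open>Only \<open>f\<close> changes sides. Subtracting a multiple of
          \<open>F\<close> exposes an element of \<open>M\<close> with leading monomial
          \<open>\<phi> t\<close> in \<open>R\<close> already for \<open>>\<^sub>s\<close>, so an
          old \<open>G\<close> divides.\<close>
        then obtain g where "g \<in> M" "isG s (t - s + s) g"
          using subtract_F_multiple[OF M f(1) _ fU F(2,3)] F(1) B(2) f(2) by (auto simp: isG_def)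
        then show ?thesis
          using G by simp
      qed
    qed
    then show "\<exists>G\<in>A1 \<union> A2. \<exists>q. isG (s - 1) q G \<and> t - q \<in> nongaps"
      by blast
  next
    fix f t assume f: "f \<in> M" "isF (s - 1) t f"
    then have f': "isF s t f" "\<not> has_deg (t + s) (snd f)"
      using has_deg_not_below by (fastforce simp: isF_def intro: below_mono)+
    then obtain F q where F: "F \<in> B" "isF s q F" "t - q \<in> nongaps"
      using gb_F[OF gb f(1)] by metis
    then have FFs: "F \<in> ?Fs" by (auto simp: parts)
    have "\<exists>H\<in>spoly s ?Gs ch F. \<exists>q. isF (s - 1) q H \<and> t - q \<in> nongaps"
    proof (cases rule: spoly_cases[OF M Gs(3) FsM[OF FFs] Gs(1,2) F(2) ch[rule_format, OF FFs],
          case_names kept reduced lcm])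
      case kept
      with F show ?thesis by auto
    next
      case (reduced H)
      with F show ?thesis by auto
    next
      case lcm
      have FM: "F \<in> M" using F B by auto
      \<comment> \<open>Only \<open>F\<close> changes sides. The subtraction shows that
        \<open>t + s\<close> is the degree of an element leading in \<open>R\<close>; it is thus a
        common multiple of \<open>q + s\<close> and the degree of some \<open>G\<close>, and an
        S-polynomial covers it.\<close>
      obtain g where g: "g \<in> M" "isG s (t + s) g"
        using subtract_F_multiple[OF M f(1) FM f'(1) F(2,3)] f'(2) lcm(1) by metis
      obtain G m where G: "G \<in> B" "isG s m G" "t + s - m \<in> nongaps"
        using gb_G[OF gb g] by metis
      then have "G \<in> ?Gs" by (auto simp: parts)
      moreover have "t + s - (q + s) \<in> nongaps"
        using F by simp
      ultimately obtain H k where "H \<in> spoly s ?Gs ch F" "isF (s - 1) (k - s) H" "t + s - k \<in> nongaps"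
        using lcm(5) G by blast
      then show ?thesis
        by (intro bexI[of _ H] exI[of _ "k - s"]) (auto simp: algebra_simps)
    qed
    then show "\<exists>F\<in>A1 \<union> A2. \<exists>q. isF (s - 1) q F \<and> t - q \<in> nongaps"
      using FFs unfolding A2 by blast
  qed
qed

lemma gb_reduction:
  assumes gb: "gb s M (A1 \<union> A2)" and r: "reduction s A1 B1" "reduction s A2 B2"
  shows "gb s M (B1 \<union> B2)"
proof -
  have sub: "B1 \<subseteq> A1" "B2 \<subseteq> A2"
    using r by (auto simp: reduction_def)
  have A: "finite (A1 \<union> A2)" "A1 \<union> A2 \<subseteq> M" "0 \<notin> A1 \<union> A2"
    using gb by (auto simp: gb_def)
  have "\<exists>h\<in>B1 \<union> B2. mod_divides (mod_lm s h) (mod_lm s f)" if f: "f \<in> M" "f \<noteq> 0" for f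
  proof -
    obtain g where g: "g \<in> A1 \<union> A2" "mod_divides (mod_lm s g) (mod_lm s f)"
      using gb f unfolding gb_def by blast
    then obtain h where h: "h \<in> B1 \<union> B2" "mod_divides (mod_lm s h) (mod_lm s g)"
      using reduction_covers[OF r(1), of g] reduction_covers[OF r(2), of g] A(3) by blast
    have "h \<noteq> 0" "g \<noteq> 0" using g h sub A(3) by blast+
    then show ?thesis
      using mod_divides_trans g(2) h f(2) by blast
  qed
  moreover have "finite (B1 \<union> B2)"
    using sub A(1) by (meson Un_mono finite_subset)
  moreover have "B1 \<union> B2 \<subseteq> M" "0 \<notin> B1 \<union> B2"
    using sub A(2,3) by auto
  ultimately show ?thesis
    unfolding gb_def by blast
qed

lemma step_M2_gb:
  assumes "gb s M B" "submod M" "step_M2 s B B'"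
  shows "gb (s - 1) M B'"
proof -
  obtain ch A1 A2 where ch: "\<forall>F\<in>F_part s B. valid_choice s (G_part s B) ch F"
    and r: "reduction (s - 1) (G_part s B \<union> {F \<in> F_part s B. snd (mod_lm (s - 1) F) \<in> \<Delta>_R s (G_part s B)}) A1"
      "reduction (s - 1) (\<Union>F\<in>F_part s B. spoly s (G_part s B) ch F) A2"
    and B': "B' = A1 \<union> A2"
    using assms(3) unfolding step_M2_def Let_def by (elim exE conjE)
  show ?thesis
    unfolding B' by (rule gb_reduction[OF candidates_cover[OF assms(1,2) ch refl refl] r])
qed

lemma step_M2_exists:
  assumes gb: "gb s M B" and M: "submod M"
  shows "\<exists>B'. step_M2 s B B'"
proof -
  let ?Gs = "G_part s B" and ?Fs = "F_part s B"
  have B: "0 \<notin> B"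
    using gb by (auto simp: gb_def)
  note parts = G_part_eq[OF B(1)] F_part_eq[OF B(1)]
  have "\<exists>G. snd (mod_lm (s - 1) F) \<in> \<Sigma>_R s ?Gs \<longrightarrow>
        G \<in> ?Gs \<and> mod_divides (mod_lm s G) (mod_lm (s - 1) F)" if "F \<in> ?Fs" for F
  proof -
    obtain t where "isF s t F" using \<open>F \<in> ?Fs\<close> by (auto simp: parts)
    then show ?thesis
    proof (cases rule: isF_pred_cases)
      case 1
      then show ?thesis by (auto simp: mod_lm_F \<Sigma>_R_def)
    next
      case 2
      then show ?thesis by (auto simp: mod_lm_G \<Sigma>_R_def)
    qed
  qed
  then obtain ch where ch: "\<forall>F\<in>?Fs. valid_choice s ?Gs ch F"
    unfolding valid_choice_def by metis
  let ?A1 = "?Gs \<union> {F \<in> ?Fs. snd (mod_lm (s - 1) F) \<in> \<Delta>_R s ?Gs}"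
  let ?A2 = "\<Union>F\<in>?Fs. spoly s ?Gs ch F"
  have "finite (?A1 \<union> ?A2)" "0 \<notin> ?A1 \<union> ?A2"
    using candidates_cover[OF gb M ch refl refl] unfolding gb_def by blast+
  then obtain B1 B2 where "reduction (s - 1) ?A1 B1" "reduction (s - 1) ?A2 B2"
    using reduction_exists[of ?A1 "s - 1"] reduction_exists[of ?A2 "s - 1"] unfolding finite_Un by blast
  with ch show ?thesis
    unfolding step_M2_def Let_def by (intro exI[of _ "B1 \<union> B2"] exI[of _ ch] exI[of _ B1] exI[of _ B2] conjI refl)
qed

end

section \<open>Footprints\<close>

lemma eval2_add: "eval2 (p + q) Q = eval2 p Q + eval2 q Q"
  by (simp add: eval2_def)

lemma eval2_mult: "eval2 (p * q) Q = eval2 p Q * eval2 q Q"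
  by (simp add: eval2_def)

lemma eval2_diff: "eval2 (p - q) Q = eval2 p Q - eval2 q Q"
  by (simp add: eval2_def)

section \<open>Degree structures on the ring and on the module\<close>

context mk_curve
begin

lemma coef_add: "coef (f + g) m = coef f m + coef g m"
  unfolding coef_def by (simp add: vs.representation_add independent_monomials span_monomials)

sublocale R: leafwise_degree "\<lambda>k f. const k * f" has_deg
proof
  show "\<exists>n. has_deg n f" if "f \<noteq> 0" for f
    using has_degI[OF that] by blast
  show "n \<ge> 0" if "has_deg n f" for n f
    using has_deg_nongap[OF that] by (rule nongaps_nonneg)
  show "has_deg n (f - const k * g)" if "has_deg n f" "has_deg m g" "m < n" for n m f g k
    using that by (intro has_deg_diff_below below_const_mult has_deg_imp_below)
  show "\<exists>k. f - const k * g = 0 \<or> (\<exists>m<n. has_deg m (f - const k * g))"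
    if "has_deg n f" "has_deg n g" for n f g
    using cancel_leading[OF that] by (auto simp: below_def has_deg_def)
qed

lemma degs_R: "R.degs UNIV = nongaps"
  using has_deg_\<phi> has_deg_nongap by (auto simp: R.degs_def)

text \<open>
  The order \<open>>\<^sub>s\<close> as an integer-valued degree: even values belong to \<open>R\<close>, odd ones to \<open>R z\<close>.
\<close>

definition mod_key :: "int \<Rightarrow> int \<Rightarrow> 'r \<times> 'r \<Rightarrow> bool" where
  "mod_key s n f \<longleftrightarrow> (\<exists>t. isG s t f \<and> n = 2 * t) \<or> (\<exists>t. isF s t f \<and> n = 2 * (t + s) + 1)"

lemma mod_key_G: "isG s t f \<Longrightarrow> mod_key s (2 * t) f"
  by (auto simp: mod_key_def)

lemma mod_key_F: "isF s t f \<Longrightarrow> mod_key s (2 * (t + s) + 1) f"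
  by (auto simp: mod_key_def)

lemma mod_key_even: "mod_key s (2 * t) f \<longleftrightarrow> isG s t f"
proof -
  have "2 * t \<noteq> 2 * (t' + s) + 1" for t'
    by presburger
  then show ?thesis by (simp add: mod_key_def)
qed

lemma mod_key_odd: "mod_key s (2 * (t + s) + 1) f \<longleftrightarrow> isF s t f"
proof -
  have "2 * (t + s) + 1 \<noteq> 2 * t'" for t'
    by presburger
  then show ?thesis by (simp add: mod_key_def)
qed

text \<open>\<open>s \<ge> 0\<close> keeps the odd keys \<open>2 * (t + s) + 1\<close> nonnegative.
  Equal keys mean equal leading monomials, the side being encoded by parity, so cancellation reduces
  to \<open>cancel_leading\<close> in one component.\<close>

lemma leafwise_degree_module:
  assumes "s \<ge> 0"
  shows "leafwise_degree (\<lambda>k. mod_smult (const k)) (mod_key s)"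
proof
  show "\<exists>n. mod_key s n f" if "f \<noteq> 0" for f
    by (rule isG_or_isF[OF that, of s]) (use mod_key_G mod_key_F in blast)+
  show "n \<ge> 0" if "mod_key s n f" for n f
    using that unfolding mod_key_def
  proof (elim disjE exE conjE)
    fix t assume "isG s t f" "n = 2 * t"
    then show "n \<ge> 0" using nongaps_nonneg[OF isG_nongap[of s t f]] by simp
  next
    fix t assume "isF s t f" "n = 2 * (t + s) + 1"
    then show "n \<ge> 0" using nongaps_nonneg[OF isF_nongap[of s t f]] assms by simp
  qed
  show "mod_key s n (f - mod_smult (const k) g)"
    if f: "mod_key s n f" and g: "mod_key s m g" and mn: "m < n" for n m f g k
    using f unfolding mod_key_def
  proof (elim disjE exE conjE)
    fix t assume t: "isG s t f" "n = 2 * t"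
    have "below (t - s) (fst g)" "below t (snd g)"
      using g t mn by (auto simp: mod_key_def isG_def isF_def intro: below_mono has_deg_imp_below)
    then have "isG s t (f - mod_smult (const k) g)"
      using t unfolding isG_def by (auto intro!: has_deg_diff_below below_diff below_const_mult)
    then show "(\<exists>t. isG s t (f - mod_smult (const k) g) \<and> n = 2 * t) \<or>
        (\<exists>t. isF s t (f - mod_smult (const k) g) \<and> n = 2 * (t + s) + 1)"
      using t by blast
  next
    fix t assume t: "isF s t f" "n = 2 * (t + s) + 1"
    have "below t (fst g)" "below (t + s + 1) (snd g)"
      using g t mn by (auto simp: mod_key_def isG_def isF_def intro: below_mono has_deg_imp_below)
    then have "isF s t (f - mod_smult (const k) g)"
      using t unfolding isF_def by (auto intro!: has_deg_diff_below below_diff below_const_mult)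
    then show "(\<exists>t. isG s t (f - mod_smult (const k) g) \<and> n = 2 * t) \<or>
        (\<exists>t. isF s t (f - mod_smult (const k) g) \<and> n = 2 * (t + s) + 1)"
      using t by blast
  qed
  show "\<exists>k. f - mod_smult (const k) g = 0 \<or> (\<exists>m<n. mod_key s m (f - mod_smult (const k) g))"
    if f: "mod_key s n f" and g: "mod_key s n g" for n f g
  proof -
    have less: "\<exists>m<n. mod_key s m h"
      if h: "h \<noteq> 0" and "n = 2 * t \<and> below t (snd h) \<and> below (t - s) (fst h) \<or>
        n = 2 * (t + s) + 1 \<and> below t (fst h) \<and> below (t + s + 1) (snd h)" for h t
      using h
    proof (cases rule: isG_or_isF[of h s])
      case (1 q)
      then have "2 * q < n"
        using that(2) by (auto simp: isG_def below_iff)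
      then show ?thesis using mod_key_G[OF 1] by blast
    next
      case (2 q)
      then have "2 * (q + s) + 1 < n"
        using that(2) by (fastforce simp: isF_def below_iff)
      then show ?thesis using mod_key_F[OF 2] by blast
    qed
    from f show ?thesis unfolding mod_key_def[of s n f]
    proof (elim disjE exE conjE)
      fix t assume t: "isG s t f" "n = 2 * t"
      then have "isG s t g" using g mod_key_even by blast
      then obtain k where "below t (snd f - const k * snd g)"
        using cancel_leading[of t "snd f" "snd g"] t by (auto simp: isG_def)
      moreover have "below (t - s) (fst f - const k * fst g)"
        using t \<open>isG s t g\<close> by (auto simp: isG_def intro!: below_diff below_const_mult)
      ultimately show ?thesis
        using less[of "f - mod_smult (const k) g" t] t(2) by auto
    next
      fix t assume t: "isF s t f" "n = 2 * (t + s) + 1"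
      then have "isF s t g" using g mod_key_odd by blast
      then obtain k where "below t (fst f - const k * fst g)"
        using cancel_leading[of t "fst f" "fst g"] t by (auto simp: isF_def)
      moreover have "below (t + s + 1) (snd f - const k * snd g)"
        using t \<open>isF s t g\<close> by (auto simp: isF_def intro!: below_diff below_const_mult)
      ultimately show ?thesis
        using less[of "f - mod_smult (const k) g" t] t(2) by auto
    qed
  qed
qed

text \<open>This Apery set meets each residue class modulo \<open>s\<close> at most once: for
  \<open>t < t'\<close> in one class, \<open>t' - s\<close> is \<open>t\<close> plus a nonnegative
  multiple of \<open>s\<close> and so a nongap.\<close>

lemma nongaps_not_multiple:
  assumes "s \<in> nongaps"
  shows "finite {t \<in> nongaps. t - s \<notin> nongaps}" "int (card {t \<in> nongaps. t - s \<notin> nongaps}) \<le> s"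
proof -
  let ?A = "{t \<in> nongaps. t - s \<notin> nongaps}"
  have s: "s \<ge> 0" using assms by (rule nongaps_nonneg)
  have mult: "int k * s \<in> nongaps" for k
    by (induction k) (use assms nongaps_add in \<open>auto simp: algebra_simps\<close>)
  have no: "False" if tt: "t \<in> ?A" "t' \<in> ?A" "t mod s = t' mod s" "t < t'" for t t'
  proof -
    obtain k where k: "t' - t = s * k"
      using tt(3) by (metis mod_eq_dvd_iff dvdE)
    then have "0 < s * k" using tt by simp
    then have "s > 0" "k > 0"
      using s by (auto simp: zero_less_mult_iff)
    have "t' - s = t + int (nat (k - 1)) * s"
      using k \<open>k > 0\<close> by (simp add: algebra_simps)
    then show False
      using tt mult[of "nat (k - 1)"] nongaps_add by auto
  qed
  have inj: "inj_on (\<lambda>t. t mod s) ?A"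
  proof (rule inj_onI)
    fix t t' assume "t \<in> ?A" "t' \<in> ?A" "t mod s = t' mod s"
    then show "t = t'"
      using no[of t t'] no[of t' t] by (cases t t' rule: linorder_cases) simp_all
  qed
  have img: "(\<lambda>t. t mod s) ` ?A \<subseteq> {0..<s}"
  proof (cases "s = 0")
    case False
    with s show ?thesis by auto
  qed auto
  show "finite ?A"
    using finite_imageD[OF finite_subset[OF img] inj] by simp
  have "card ?A \<le> card {0..<s}"
    using card_inj_on_le[OF inj img] by simp
  then show "int (card ?A) \<le> s"
    using s by simp
qed

end

section \<open>Evaluation at the points and footprints of sets of points\<close>

context mk_code
begin

text \<open>The representative picked by \<open>SOME\<close> does not matter: two of them differ by
  a multiple of the curve polynomial, which vanishes at \<open>P i\<close>.\<close>

lemma pt_value_cls: "pt_value (cls p) (P i) = eval2 p (P i)"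
proof -
  have "cls (SOME q. cls q = cls p) = cls p"
    by (rule someI) simp
  then have "mk_poly a b c d dvd (SOME q. cls q = cls p) - p"
    by (simp add: cls_diff flip: cls_kernel)
  then obtain r where "(SOME q. cls q = cls p) - p = mk_poly a b c d * r" ..
  then have "eval2 ((SOME q. cls q = cls p) - p) (P i) = 0"
    using P_nonsingular[of i] by (simp add: eval2_mult nonsingular_point_def)
  then show ?thesis
    by (simp add: pt_value_def eval2_diff)
qed

lemma pt_value_simps [simp]:
  "pt_value (f + g) (P i) = pt_value f (P i) + pt_value g (P i)"
  "pt_value (f * g) (P i) = pt_value f (P i) * pt_value g (P i)"
  "pt_value (f - g) (P i) = pt_value f (P i) - pt_value g (P i)"
  "pt_value (const k) (P i) = k"
  "pt_value 0 (P i) = 0" "pt_value 1 (P i) = 1"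
  "pt_value xR (P i) = fst (P i)" "pt_value yR (P i) = snd (P i)"
proof -
  obtain p q where "f = cls p" "g = cls q" using cls_surj by (metis surjD)
  then show "pt_value (f + g) (P i) = pt_value f (P i) + pt_value g (P i)"
    "pt_value (f * g) (P i) = pt_value f (P i) * pt_value g (P i)"
    "pt_value (f - g) (P i) = pt_value f (P i) - pt_value g (P i)"
    by (simp_all add: pt_value_cls eval2_add eval2_mult eval2_diff flip: cls_add cls_mult cls_diff)
  show c: "pt_value (const k) (P i) = k" for k
    by (simp add: const_def pt_value_cls eval2_def)
  show "pt_value 0 (P i) = 0" "pt_value 1 (P i) = 1"
    using c[of 0] c[of 1] by simp_all
  show "pt_value xR (P i) = fst (P i)" "pt_value yR (P i) = snd (P i)"
    by (simp_all add: xR_def yR_def pt_value_cls eval2_def)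
qed

lemma pt_value_minus [simp]: "pt_value (- f) (P i) = - pt_value f (P i)"
  using pt_value_simps(3)[of 0 f i] by simp

lemma pt_value_prod: "pt_value (prod f A) (P i) = (\<Prod>x\<in>A. pt_value (f x) (P i))"
  by (induction A rule: infinite_finite_induct) auto

lemma pt_value_sum: "pt_value (sum f A) (P i) = (\<Sum>x\<in>A. pt_value (f x) (P i))"
  by (induction A rule: infinite_finite_induct) auto

lemma ev_nth [simp]: "ev f $ i = pt_value f (P i)"
  by (simp add: ev_def)

lemma interpolation: "\<exists>f. pt_value f (P i) \<noteq> 0 \<and> (\<forall>j. j \<noteq> i \<longrightarrow> pt_value f (P j) = 0)"
proof -
  \<comment> \<open>A linear polynomial vanishing at \<open>P j\<close>, taken in a coordinate in
    which \<open>P i\<close> and \<open>P j\<close> differ.\<close>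
  define g where "g j = (if fst (P i) \<noteq> fst (P j) then xR - const (fst (P j)) else yR - const (snd (P j)))" for j
  have "pt_value (g j) (P j) = 0" for j
    by (simp add: g_def)
  moreover have "pt_value (g j) (P i) \<noteq> 0" if "j \<noteq> i" for j
    using injD[OF P_inj, of i j] that by (auto simp: g_def prod_eq_iff)
  ultimately show ?thesis
    by (intro exI[of _ "\<Prod>j\<in>UNIV - {i}. g j"]) (auto simp: pt_value_prod)
qed

lemma ev_surj: "\<exists>h. ev h = v"
proof -
  obtain g where g: "\<And>i. pt_value (g i) (P i) \<noteq> 0" "\<And>i j. j \<noteq> i \<Longrightarrow> pt_value (g i) (P j) = 0"
    using interpolation by metis
  let ?h = "\<Sum>i\<in>UNIV. const (v $ i / pt_value (g i) (P i)) * g i"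
  have "ev ?h $ j = v $ j" for j
  proof -
    have "ev ?h $ j = (\<Sum>i\<in>UNIV. if i = j then v $ j else 0)"
      unfolding ev_nth pt_value_sum by (intro sum.cong) (use g in auto)
    then show ?thesis by simp
  qed
  then show ?thesis by (metis vec_eq_iff)
qed

text \<open>The degrees of the monomials in \<open>\<Delta>\<close> of the ideal of functions
  vanishing at the points with index in \<open>I\<close>. \<open>UNIV\<close> gives
  \<open>\<Delta>(J)\<close>; the support of \<open>e\<close> gives the footprint of the
  error-locator ideal.\<close>

definition footprint :: "'n set \<Rightarrow> int set" where
  "footprint I = {t \<in> nongaps. \<not> (\<exists>f. has_deg t f \<and> (\<forall>i\<in>I. pt_value f (P i) = 0))}"

lemma footprint_nongaps: "t \<in> footprint I \<Longrightarrow> t \<in> nongaps"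
  by (simp add: footprint_def)

lemma card_footprint: "finite (footprint I)" "card (footprint I) = card I"
proof -
  have ex: "\<exists>f. pt_value f (P i) \<noteq> 0 \<and> (\<forall>j\<in>I - {i}. pt_value f (P j) = 0)" for i
    using interpolation[of i] by blast
  have "\<exists>X\<subseteq>R.degs UNIV. finite X \<and> card X = card I \<and>
      R.degs {f. \<forall>i\<in>I. pt_value f (P i) = 0} = R.degs UNIV - X"
    by (rule R.degs_common_kernel) (use ex in auto)
  then obtain X where X: "X \<subseteq> nongaps" "finite X" "card X = card I"
    "R.degs {f. \<forall>i\<in>I. pt_value f (P i) = 0} = nongaps - X"
    unfolding degs_R by blast
  moreover have "footprint I = nongaps - R.degs {f. \<forall>i\<in>I. pt_value f (P i) = 0}"
    by (auto simp: footprint_def R.degs_def)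
  ultimately have "footprint I = X" by auto
  with X show "finite (footprint I)" "card (footprint I) = card I" by simp_all
qed

section \<open>Counting standard monomials of the interpolation module\<close>

definition interp_module :: "'a ^ 'n \<Rightarrow> ('r \<times> 'r) set" where
  "interp_module v = {f. \<forall>i. pt_value (fst f) (P i) * v $ i + pt_value (snd f) (P i) = 0}"

lemma submod_interp_module: "submod (interp_module v)"
  unfolding submod_def
proof (intro conjI ballI allI)
  fix f g assume "f \<in> interp_module v" "g \<in> interp_module v"
  then show "f - g \<in> interp_module v"
    by (simp add: interp_module_def left_diff_distrib diff_add_eq add_eq_0_iff2)
next
  fix r f assume f: "f \<in> interp_module v"
  have "pt_value (r * fst f) (P i) * v $ i + pt_value (r * snd f) (P i) =
      pt_value r (P i) * (pt_value (fst f) (P i) * v $ i + pt_value (snd f) (P i))" for i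
    by (simp add: algebra_simps)
  with f show "mod_smult r f \<in> interp_module v"
    by (simp add: interp_module_def)
qed

definition stairG :: "int \<Rightarrow> ('r \<times> 'r) set \<Rightarrow> int set" where
  "stairG s M = {t \<in> nongaps. \<not> (\<exists>f\<in>M. isG s t f)}"

text \<open>Degrees are not shifted by \<open>s\<close> here, so that this set, the
  \<open>DF\<close> of the overview, can be compared with \<open>footprint\<close>.\<close>

definition stairF :: "int \<Rightarrow> ('r \<times> 'r) set \<Rightarrow> int set" where
  "stairF s M = {t \<in> nongaps. \<not> (\<exists>f\<in>M. isF s t f)}"

text \<open>The dimension count behind \<open>card_footprint\<close>, now for the conditions
  defining the module. The parity of \<open>mod_key\<close> distributes the missing degrees over the
  two stairs.\<close>

lemma card_stairs:
  assumes "s \<ge> 0"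
  shows "finite (stairG s (interp_module v))" "finite (stairF s (interp_module v))"
    and "card (stairG s (interp_module v)) + card (stairF s (interp_module v)) = CARD('n)"
proof -
  let ?M = "interp_module v" and ?key = "mod_key s"
  interpret Mo: leafwise_degree "\<lambda>k. mod_smult (const k)" ?key
    by (rule leafwise_degree_module) fact
  let ?L = "\<lambda>i f. pt_value (fst f) (P i) * v $ i + pt_value (snd f) (P i)"
  have M: "?M = {f. \<forall>i\<in>UNIV. ?L i f = 0}"
    by (simp add: interp_module_def)
  have ex: "\<exists>f. ?L i f \<noteq> 0 \<and> (\<forall>j\<in>UNIV - {i}. ?L j f = 0)" for i
  proof -
    obtain g where "pt_value g (P i) \<noteq> 0 \<and> (\<forall>j. j \<noteq> i \<longrightarrow> pt_value g (P j) = 0)"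
      using interpolation by blast
    then show ?thesis by (intro exI[of _ "(0, g)"]) simp
  qed
  have "\<exists>X\<subseteq>Mo.degs UNIV. finite X \<and> card X = card (UNIV :: 'n set) \<and>
      Mo.degs {f. \<forall>i\<in>UNIV. ?L i f = 0} = Mo.degs UNIV - X"
    by (rule Mo.degs_common_kernel) (use ex in \<open>auto simp: algebra_simps\<close>)
  then obtain X where X: "finite X" "card X = CARD('n)" "X = Mo.degs UNIV - Mo.degs ?M"
    unfolding M by blast
  let ?e = "\<lambda>t. 2 * t :: int" and ?o = "\<lambda>t. 2 * (t + s) + 1 :: int"
  have eG: "isG s t (0, \<phi> t)" and eF: "isF s t (\<phi> t, 0)" if "t \<in> nongaps" for t
    using has_deg_\<phi>[OF that] by (simp_all add: isG_def isF_def)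
  have "Mo.degs N = ?e ` {t. \<exists>f\<in>N. isG s t f} \<union> ?o ` {t. \<exists>f\<in>N. isF s t f}" for N
    by (auto simp: Mo.degs_def mod_key_def)
  moreover have "{t. \<exists>f\<in>UNIV. isG s t f} = nongaps" "{t. \<exists>f\<in>UNIV. isF s t f} = nongaps"
    using eG eF isG_nongap isF_nongap by blast+
  ultimately have "X = (?e ` nongaps \<union> ?o ` nongaps) -
      (?e ` {t. \<exists>f\<in>?M. isG s t f} \<union> ?o ` {t. \<exists>f\<in>?M. isF s t f})"
    using X(3) by simp
  moreover have "?e t \<noteq> ?o t'" for t t'
    by presburger
  then have eo: "?e ` A \<inter> ?o ` A' = {}" for A A'
    by blast
  ultimately have X': "X = (?e ` nongaps - ?e ` {t. \<exists>f\<in>?M. isG s t f}) \<union>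
      (?o ` nongaps - ?o ` {t. \<exists>f\<in>?M. isF s t f})"
    by blast
  have inj: "inj_on ?e A" "inj_on ?o A" for A
    by (auto intro: inj_onI)
  have diff: "stairG s ?M = nongaps - {t. \<exists>f\<in>?M. isG s t f}"
      "stairF s ?M = nongaps - {t. \<exists>f\<in>?M. isF s t f}"
    by (auto simp: stairG_def stairF_def)
  have Xeq: "X = ?e ` stairG s ?M \<union> ?o ` stairF s ?M"
    unfolding X' diff image_set_diff[OF inj(1)] image_set_diff[OF inj(2)] by (rule refl)
  have fin: "finite (?e ` stairG s ?M)" "finite (?o ` stairF s ?M)"
    using X(1) Xeq by auto
  then show "finite (stairG s ?M)" "finite (stairF s ?M)"
    using finite_imageD inj by blast+
  have "card X = card (?e ` stairG s ?M) + card (?o ` stairF s ?M)"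
    unfolding Xeq using fin eo by (rule card_Un_disjoint)
  then show "card (stairG s ?M) + card (stairF s ?M) = CARD('n)"
    using X(2) card_image[OF inj(1), of "stairG s ?M"] card_image[OF inj(2), of "stairF s ?M"] by simp
qed

section \<open>The function \<open>\<nu>\<close> in terms of degrees, and its bounds\<close>

lemma \<Delta>_ideal_eq: "\<Delta>_ideal I = \<phi> ` {t \<in> nongaps. \<not> (\<exists>f\<in>I. has_deg t f)}"
proof -
  have "(\<exists>f\<in>I. f \<noteq> 0 \<and> lm f = \<phi> t) \<longleftrightarrow> (\<exists>f\<in>I. has_deg t f)" if t: "t \<in> nongaps" for t
  proof
    assume "\<exists>f\<in>I. f \<noteq> 0 \<and> lm f = \<phi> t"
    then obtain f where f: "f \<in> I" "f \<noteq> 0" "\<phi> (\<delta> f) = \<phi> t" by (auto simp: lm_def)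
    then have "\<delta> f = t"
      using inj_onD[OF inj_on_\<phi> f(3)] has_deg_nongap[OF has_degI[OF f(2)]] t by blast
    then show "\<exists>f\<in>I. has_deg t f" using f by (auto simp: has_deg_def)
  qed (metis lm_eq has_deg_nonzero)
  then show ?thesis
    unfolding \<Delta>_ideal_def monomials_eq_\<phi> by (intro equalityI subsetI) auto
qed

lemma J_iff: "f \<in> J \<longleftrightarrow> (\<forall>i. pt_value f (P i) = 0)"
  by (simp add: J_def max_ideal_def)

lemma \<nu>_eq: "\<nu> s = int (card (footprint UNIV \<union> {t \<in> nongaps. t - s \<notin> nongaps})) - s"
  if s: "s \<in> nongaps"
proof -
  have "\<Delta>_ideal J = \<phi> ` footprint UNIV"
    unfolding \<Delta>_ideal_eq footprint_def by (auto simp: J_iff intro!: arg_cong[where f = "image \<phi>"])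
  moreover have "\<Delta>_ideal {r * \<phi> s | r. True} = \<phi> ` {t \<in> nongaps. t - s \<notin> nongaps}"
  proof -
    have "(\<exists>f\<in>{r * \<phi> s | r. True}. has_deg t f) \<longleftrightarrow> t - s \<in> nongaps" for t
    proof
      assume "\<exists>f\<in>{r * \<phi> s | r. True}. has_deg t f"
      then show "t - s \<in> nongaps"
        using has_deg_quotient[OF _ has_deg_\<phi>[OF s]] has_deg_nongap by blast
    next
      assume "t - s \<in> nongaps"
      from has_deg_mult[OF has_deg_\<phi>[OF this] has_deg_\<phi>[OF s]]
      show "\<exists>f\<in>{r * \<phi> s | r. True}. has_deg t f" by auto
    qed
    then show ?thesis unfolding \<Delta>_ideal_eq by simp
  qed
  moreover have "inj_on \<phi> (footprint UNIV \<union> {t \<in> nongaps. t - s \<notin> nongaps})"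
    by (rule inj_on_subset[OF inj_on_\<phi>]) (auto simp: footprint_nongaps)
  ultimately show ?thesis
    by (simp only: \<nu>_def card_image flip: image_Un)
qed

text \<open>\<open>\<Delta>(J)\<close> alone already contributes as many elements as there are
  points.\<close>

lemma \<nu>_ge: "s \<in> nongaps \<Longrightarrow> \<nu> s \<ge> int CARD('n) - s"
proof -
  assume s: "s \<in> nongaps"
  have "card (footprint UNIV) \<le> card (footprint UNIV \<union> {t \<in> nongaps. t - s \<notin> nongaps})"
    using card_footprint(1)[of UNIV] nongaps_not_multiple(1)[OF s] by (intro card_mono) auto
  then show ?thesis
    using card_footprint(2)[of UNIV] by (simp add: \<nu>_eq[OF s])
qed

text \<open>The second set of the union has at most \<open>s\<close> elements, which the subtraction
  of \<open>s\<close> absorbs. What is left are the positions where a leading monomial multiplied by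
  \<open>\<phi> s\<close> can land.\<close>

lemma \<nu>_le: "s \<in> nongaps \<Longrightarrow> \<nu> s \<le> int (card {t \<in> footprint UNIV. t - s \<in> nongaps})"
proof -
  assume s: "s \<in> nongaps"
  let ?A = "{t \<in> nongaps. t - s \<notin> nongaps}"
  have "footprint UNIV \<union> ?A = {t \<in> footprint UNIV. t - s \<in> nongaps} \<union> ?A"
    using footprint_nongaps by auto
  then have "card (footprint UNIV \<union> ?A) \<le> card {t \<in> footprint UNIV. t - s \<in> nongaps} + card ?A"
    by (simp only: card_Un_le)
  then show ?thesis
    using nongaps_not_multiple(2)[OF s] by (simp add: \<nu>_eq[OF s])
qed

lemma nongaps_upto_u: "finite {s \<in> nongaps. s \<le> int u}" "{s \<in> nongaps. s \<le> int u} \<noteq> {}"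
proof -
  have "{s \<in> nongaps. s \<le> int u} \<subseteq> {0..int u}"
    using nongaps_nonneg by auto
  then show "finite {s \<in> nongaps. s \<le> int u}"
    by (rule finite_subset) simp
  have "0 \<in> {s \<in> nongaps. s \<le> int u}"
    by simp
  then show "{s \<in> nongaps. s \<le> int u} \<noteq> {}"
    by blast
qed

lemma d_u_le: "s \<in> nongaps \<Longrightarrow> s \<le> int u \<Longrightarrow> d_u \<le> \<nu> s"
  unfolding d_u_def using nongaps_upto_u by (intro Min_le) auto

lemma d_u_ge: "d_u \<ge> int CARD('n) - int u"
proof -
  have "d_u \<in> \<nu> ` {s \<in> nongaps. s \<le> int u}"
    unfolding d_u_def using nongaps_upto_u by (intro Min_in) auto
  then obtain s where "s \<in> nongaps" "s \<le> int u" "d_u = \<nu> s" by auto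
  then show ?thesis using \<nu>_ge[of s] by simp
qed

text \<open>Multiplication by \<open>f\<close> maps the ideal of the support of \<open>ev f\<close> into \<open>J\<close>.\<close>

lemma \<nu>_le_wt_ev:
  assumes "has_deg s f"
  shows "\<nu> s \<le> int (wt (ev f))"
proof -
  let ?E = "{i. ev f $ i \<noteq> 0}"
  have s: "s \<in> nongaps" using assms by (rule has_deg_nongap)
  have "(\<lambda>t. t - s) ` {t \<in> footprint UNIV. t - s \<in> nongaps} \<subseteq> footprint ?E"
  proof safe
    fix t assume t: "t \<in> footprint UNIV" "t - s \<in> nongaps"
    have "\<not> (has_deg (t - s) g \<and> (\<forall>i\<in>?E. pt_value g (P i) = 0))" for g
    proof
      assume g: "has_deg (t - s) g \<and> (\<forall>i\<in>?E. pt_value g (P i) = 0)"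
      then have "has_deg t (g * f)"
        using has_deg_mult[of "t - s" g s f] assms by simp
      moreover have "pt_value (g * f) (P i) = 0" for i
        using g by (cases "i \<in> ?E") auto
      ultimately show False
        using t by (auto simp: footprint_def)
    qed
    then show "t - s \<in> footprint ?E"
      using t(2) by (auto simp: footprint_def)
  qed
  then have "card {t \<in> footprint UNIV. t - s \<in> nongaps} \<le> card (footprint ?E)"
    using card_inj_on_le[of "\<lambda>t. t - s"] card_footprint(1)[of ?E] by (auto simp: inj_on_def)
  then show ?thesis
    using \<nu>_le[OF s] card_footprint(2)[of ?E] by (simp add: wt_def)
qed

end

section \<open>Voting\<close>

context mk_curve
begin

text \<open>\<open>f (z + k \<phi>\<^sub>s)\<close> has leading monomial \<open>\<phi>\<^sub>t z\<close> even with respect to \<open>>\<^sub>s\<^sub>-\<^sub>1\<close>.\<close>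

definition votes_for :: "int \<Rightarrow> int \<Rightarrow> 'a \<Rightarrow> 'r \<times> 'r \<Rightarrow> bool" where
  "votes_for s t k f \<longleftrightarrow> has_deg t (fst f) \<and> below (t + s) (snd f + const k * (fst f * \<phi> s))"

lemma votes_for_smult:
  assumes "has_deg q r" "votes_for s t k f"
  shows "votes_for s (q + t) k (mod_smult r f)"
proof -
  have "below (q + (t + s)) (r * (snd f + const k * (fst f * \<phi> s)))"
    using assms by (intro below_mult) (auto simp: votes_for_def)
  also have "r * (snd f + const k * (fst f * \<phi> s)) = r * snd f + const k * (r * fst f * \<phi> s)"
    by (simp add: algebra_simps)
  finally show ?thesis
    using assms has_deg_mult by (simp add: votes_for_def add.assoc)
qed

text \<open>Once the leading terms in \<open>R z\<close> cancel, the components in \<open>R\<close>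
  differ by \<open>(l - k) * fst f * \<phi> s\<close> up to lower degree, and this has degree
  exactly \<open>t + s\<close>.\<close>

lemma conflicting_votes:
  assumes M: "submod M" "f \<in> M" "g \<in> M" and s: "s \<in> nongaps"
    and f: "votes_for s t k f" and g: "votes_for s t l g" and "k \<noteq> l"
  shows "\<exists>h\<in>M. isG s (t + s) h"
proof -
  obtain m where m: "below t (fst f - const m * fst g)"
    using cancel_leading f g by (metis votes_for_def)
  let ?h = "f - mod_smult (const m) g"
  let ?f = "snd f + const k * (fst f * \<phi> s)" and ?g = "snd g + const l * (fst g * \<phi> s)"
  have "below (t + s) ((fst f - const m * fst g) * \<phi> s)"
    using m has_deg_\<phi>[OF s] by (rule below_mult_right)
  then have "below (t + s) (?f - const m * ?g - const l * ((fst f - const m * fst g) * \<phi> s))"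
    using f g by (intro below_diff below_const_mult) (simp_all add: votes_for_def)
  moreover have "has_deg (t + s) (const (l - k) * (fst f * \<phi> s))"
    using f has_deg_\<phi>[OF s] \<open>k \<noteq> l\<close>
    by (intro has_deg_const_mult has_deg_mult) (auto simp: votes_for_def)
  ultimately have "has_deg (t + s) (const (l - k) * (fst f * \<phi> s) +
      (?f - const m * ?g - const l * ((fst f - const m * fst g) * \<phi> s)))"
    by (intro has_deg_add_below)
  also have "const (l - k) * (fst f * \<phi> s) +
      (?f - const m * ?g - const l * ((fst f - const m * fst g) * \<phi> s)) = snd ?h"
    by (simp add: const_diff algebra_simps)
  finally have "isG s (t + s) ?h"
    using m by (simp add: isG_def)
  then show ?thesis
    using M submod_diff submod_smult by blast
qed

text \<open>\<open>\<phi> s\<close> has the same weight \<open>s\<close> as \<open>z\<close>, and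
  ties go to \<open>R z\<close>; hence the substitution preserves leading monomials for
  \<open>>\<^sub>s\<close>, here on the side of \<open>R\<close>, where the bound on
  \<open>fst f\<close> is strict.\<close>

lemma isG_subst:
  assumes "s \<in> nongaps" "isG s t f"
  shows "isG s t (mod_subst f (const k * \<phi> s))"
proof -
  have "below t (fst f * \<phi> s)"
    using below_mult_right[OF _ has_deg_\<phi>[OF assms(1)], of "t - s" "fst f"] assms(2)
    by (simp add: isG_def)
  then have "below t (fst f * (const k * \<phi> s))"
    using below_const_mult[of t "fst f * \<phi> s" k] by (simp add: ac_simps)
  then show ?thesis
    using assms has_deg_add_below[of t "snd f" "fst f * (const k * \<phi> s)"]
    by (simp add: isG_def mod_subst_def add.commute)
qed

lemma isF_subst:
  assumes "s \<in> nongaps" "isF s t f"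
  shows "isF s t (mod_subst f (const k * \<phi> s))"
proof -
  have "below (t + s + 1) (fst f * \<phi> s)"
    using has_deg_mult[OF _ has_deg_\<phi>[OF assms(1)], of t "fst f"] assms(2)
    by (auto simp: isF_def intro: has_deg_imp_below)
  then have "below (t + s + 1) (fst f * (const k * \<phi> s))"
    using below_const_mult[of _ "fst f * \<phi> s" k] by (simp add: ac_simps)
  then show ?thesis
    using assms by (auto simp: isF_def mod_subst_def intro: below_add)
qed

lemma \<Sigma>_eq: "has_deg n f \<Longrightarrow> \<Sigma> f = \<phi> ` {t \<in> nongaps. t - n \<in> nongaps}"
  using has_deg_nongap[of n f] by (auto simp: \<Sigma>_def lm_eq monomials_eq_\<phi> divides_\<phi>)

end

section \<open>The outcome of a vote\<close>

context mk_code
begin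

lemma votes_for_w_of:
  assumes F: "isF s t F" and s: "s \<in> nongaps"
  shows "votes_for s t (w_of s F) F"
proof -
  let ?g = "fst F * \<phi> s" and ?n = "t + s"
  have g: "has_deg ?n ?g"
    using F has_deg_\<phi>[OF s] by (intro has_deg_mult) (auto simp: isF_def)
  then have n: "?n \<in> nongaps" by (rule has_deg_nongap)
  have "below (?n + 1) (snd F + const (w_of s F) * ?g)"
    using F g by (intro below_add below_const_mult) (auto simp: isF_def intro: has_deg_imp_below)
  moreover have "coef (snd F + const (w_of s F) * ?g) (\<phi> ?n) = 0"
    using coef_support(1)[OF g]
    by (simp only: coef_add coef_const_mult w_of_def lm_eq[OF g] lc_eq[OF g]) simp
  ultimately have "below ?n (snd F + const (w_of s F) * ?g)"
    using below_Suc_coef[OF _ n, of _ 0] by force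
  then show ?thesis
    using F by (simp add: votes_for_def isF_def)
qed

text \<open>The algorithm consults only basis elements, but because \<open>B\<close> is a Groebner
  basis, \<open>\<Delta>_set\<close> of the \<open>G\<close> components consists of all standard
  monomials of \<open>M\<close> in \<open>R\<close>. This links the count to
  \<open>stairG\<close>.\<close>

lemma votes_eq:
  assumes gb: "gb s M B" and M: "submod M" and s: "s \<in> nongaps"
  shows "votes s B k =
    card {T \<in> stairG s M. \<exists>F\<in>B. \<exists>t. isF s t F \<and> w_of s F = k \<and> T - (t + s) \<in> nongaps}"
proof -
  have B: "0 \<notin> B" "B \<subseteq> M"
    using gb by (auto simp: gb_def)
  note parts = G_part_eq[OF B(1)] F_part_eq[OF B(1)]
  have "\<Sigma> (fst F * \<phi> s) = \<phi> ` {T \<in> nongaps. T - (t + s) \<in> nongaps}" if "isF s t F" for F t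
    using that has_deg_\<phi>[OF s] by (intro \<Sigma>_eq has_deg_mult) (auto simp: isF_def)
  then have \<Sigma>: "(\<Union>F\<in>{F \<in> F_part s B. w_of s F = k}. \<Sigma> (fst F * \<phi> s)) =
      \<phi> ` {T \<in> nongaps. \<exists>F\<in>B. \<exists>t. isF s t F \<and> w_of s F = k \<and> T - (t + s) \<in> nongaps}"
    unfolding parts by fastforce
  have "(\<forall>g\<in>snd ` G_part s B. \<not> divides (lm g) (\<phi> T)) \<longleftrightarrow> T \<in> stairG s M"
    if T: "T \<in> nongaps" for T
  proof -
    have "divides (lm (snd G)) (\<phi> T) \<longleftrightarrow> T - t \<in> nongaps" if "isG s t G" for G t
      using that isG_nongap[OF that] T by (auto simp: isG_def lm_eq divides_\<phi>)
    then have "(\<exists>g\<in>snd ` G_part s B. divides (lm g) (\<phi> T)) \<longleftrightarrow>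
        (\<exists>G\<in>B. \<exists>t. isG s t G \<and> T - t \<in> nongaps)"
      unfolding parts by fastforce
    also have "\<dots> \<longleftrightarrow> (\<exists>f\<in>M. isG s T f)"
    proof
      assume "\<exists>G\<in>B. \<exists>t. isG s t G \<and> T - t \<in> nongaps"
      then obtain G t where G: "G \<in> B" "isG s t G" "T - t \<in> nongaps" by blast
      then have "isG s T (mod_smult (\<phi> (T - t)) G)"
        using isG_smult[OF has_deg_\<phi>[OF G(3)] G(2)] by simp
      then show "\<exists>f\<in>M. isG s T f"
        using G B M submod_smult by blast
    next
      assume "\<exists>f\<in>M. isG s T f"
      then show "\<exists>G\<in>B. \<exists>t. isG s t G \<and> T - t \<in> nongaps"
        using gb_G[OF gb] by metis
    qed
    finally show ?thesis
      using T by (auto simp: stairG_def)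
  qed
  then have \<Delta>: "\<Delta>_set (snd ` G_part s B) = \<phi> ` stairG s M"
    unfolding \<Delta>_set_def monomials_eq_\<phi> by (auto simp: stairG_def)
  have sub: "stairG s M \<subseteq> nongaps"
    by (auto simp: stairG_def)
  let ?A = "{T \<in> nongaps. \<exists>F\<in>B. \<exists>t. isF s t F \<and> w_of s F = k \<and> T - (t + s) \<in> nongaps}"
  have "\<phi> ` ?A \<inter> \<phi> ` stairG s M = \<phi> ` (?A \<inter> stairG s M)"
    using inj_on_image_Int[OF inj_on_\<phi>, of ?A "stairG s M"] sub by auto
  moreover have "inj_on \<phi> (?A \<inter> stairG s M)"
    by (rule inj_on_subset[OF inj_on_\<phi>]) (use sub in blast)
  moreover have "?A \<inter> stairG s M =
      {T \<in> stairG s M. \<exists>F\<in>B. \<exists>t. isF s t F \<and> w_of s F = k \<and> T - (t + s) \<in> nongaps}"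
    using sub by blast
  ultimately show ?thesis
    unfolding votes_def \<Sigma> \<Delta> by (simp add: card_image)
qed

lemma correct_value_wins:
  fixes e :: "'a ^ 'n"
  assumes s: "s \<in> nongaps" and \<nu>: "\<nu> s > 2 * int (wt e)"
    and \<mu>: "below s (\<mu> - const \<omega> * \<phi> s)"
    and M: "M = interp_module (ev \<mu> + e)" and gb: "gb s M B"
  shows "\<omega> \<in> candidates s B"
    and "k \<noteq> \<omega> \<Longrightarrow> votes s B k < votes s B \<omega>"
proof -
  let ?E = "{i. e $ i \<noteq> 0}"
  let ?DG = "stairG s M" and ?DF = "stairF s M" and ?DE = "footprint ?E" and ?DJ = "footprint UNIV"
  have s0: "s \<ge> 0" using s by (rule nongaps_nonneg)
  have sub: "submod M" unfolding M by (rule submod_interp_module)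
  note stairs = card_stairs[OF s0, of "ev \<mu> + e", folded M]
  note DE = card_footprint[of ?E, folded wt_def]
  note DJ = card_footprint[of UNIV]
  have BM: "B \<subseteq> M" "0 \<notin> B" using gb by (auto simp: gb_def)
  have loc: "\<exists>g\<in>M. votes_for s t \<omega> g \<and> isF s t g" if t: "t \<in> nongaps" "t \<notin> ?DE" for t
  proof -
    obtain f where f: "has_deg t f" "\<forall>i\<in>?E. pt_value f (P i) = 0"
      using t by (auto simp: footprint_def)
    let ?g = "(f, - (f * \<mu>))"
    have "pt_value f (P i) * e $ i = 0" for i
      using f by (cases "i \<in> ?E") auto
    then have "?g \<in> M"
      by (simp add: M interp_module_def algebra_simps)
    moreover have "votes_for s t \<omega> ?g"
    proof -
      have "below (t + s) (- (f * (\<mu> - const \<omega> * \<phi> s)))"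
        using f(1) \<mu> by (intro below_minus below_mult)
      then show ?thesis
        using f(1) by (simp add: votes_for_def algebra_simps)
    qed
    moreover have "isF s t ?g"
    proof -
      have "below (s + 1) ((\<mu> - const \<omega> * \<phi> s) + const \<omega> * \<phi> s)"
        using \<mu> has_deg_\<phi>[OF s]
        by (intro below_add below_const_mult) (auto intro: below_mono has_deg_imp_below)
      then have "below (t + (s + 1)) (f * \<mu>)"
        using f(1) by (intro below_mult) simp_all
      then show ?thesis
        using f(1) by (simp add: isF_def below_minus add.assoc)
    qed
    ultimately show ?thesis by blast
  qed
  have DF_sub: "?DF \<subseteq> ?DE"
    using loc by (fastforce simp: stairF_def)
  have DG_sub: "?DG \<subseteq> ?DJ"
  proof
    fix t assume t: "t \<in> ?DG"
    have "\<not> (has_deg t f \<and> (\<forall>i\<in>UNIV. pt_value f (P i) = 0))" for f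
    proof
      assume f: "has_deg t f \<and> (\<forall>i\<in>UNIV. pt_value f (P i) = 0)"
      then have "(0, f) \<in> M" "isG s t (0, f)"
        by (simp_all add: M interp_module_def isG_def)
      then show False using t by (auto simp: stairG_def)
    qed
    then show "t \<in> ?DJ"
      using t by (auto simp: footprint_def stairG_def)
  qed
  define V where "V k = {T \<in> ?DG. \<exists>F\<in>B. \<exists>t. isF s t F \<and> w_of s F = k \<and> T - (t + s) \<in> nongaps}" for k
  have votes: "votes s B k = card (V k)" for k
    unfolding V_def by (rule votes_eq[OF gb sub s])
  have V_vote: "\<exists>f\<in>M. votes_for s (T - s) k f \<and> isF s (T - s) f" if T: "T \<in> V k" for T k
  proof -
    obtain F t where F: "F \<in> B" "isF s t F" "w_of s F = k" "T - (t + s) \<in> nongaps"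
      using T by (auto simp: V_def)
    let ?f = "mod_smult (\<phi> (T - (t + s))) F"
    have "votes_for s (T - (t + s) + t) k ?f" "isF s (T - (t + s) + t) ?f"
      using votes_for_smult isF_smult votes_for_w_of[OF F(2) s] F has_deg_\<phi>[OF F(4)] by blast+
    moreover have "?f \<in> M" using F BM sub submod_smult by blast
    ultimately show ?thesis by (intro bexI[of _ ?f]) auto
  qed
  have agree: "k = l"
    if "T \<in> ?DG" "f \<in> M" "g \<in> M" "votes_for s (T - s) k f" "votes_for s (T - s) l g" for T k l f g
    using conflicting_votes[OF sub that(2,3) s that(4,5)] that(1) by (auto simp: stairG_def)
  have wrong: "int (card (V k)) \<le> int (wt e) - int (card ?DF)" if k: "k \<noteq> \<omega>" for k
  proof -
    \<comment> \<open>A voter at \<open>T\<close> leads with \<open>\<phi> (T - s)\<close> in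
      \<open>R z\<close>, so \<open>T - s\<close> is not in \<open>DF\<close>. Outside
      \<open>?DE\<close> a correct voter would exist in the same degree and conflict with
      it.\<close>
    have "(\<lambda>T. T - s) ` V k \<subseteq> ?DE - ?DF"
    proof safe
      fix T assume T: "T \<in> V k"
      obtain f where f: "f \<in> M" "votes_for s (T - s) k f" "isF s (T - s) f"
        using V_vote[OF T] by blast
      have TG: "T \<in> ?DG" using T by (simp add: V_def)
      show "T - s \<in> ?DE"
      proof (rule ccontr)
        assume "T - s \<notin> ?DE"
        then obtain g where "g \<in> M" "votes_for s (T - s) \<omega> g"
          using loc isF_nongap[OF f(3)] by blast
        then show False using agree[OF TG f(1) _ f(2)] k by blast
      qed
      assume "T - s \<in> ?DF"
      then show False using f by (auto simp: stairF_def)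
    qed
    then have "card (V k) \<le> card (?DE - ?DF)"
      using DE(1) by (intro card_inj_on_le[of "\<lambda>T. T - s"]) (auto simp: inj_on_def)
    also have "\<dots> = card ?DE - card ?DF"
      using DF_sub stairs(2) by (intro card_Diff_subset)
    finally show ?thesis
      using card_mono[OF DE(1) DF_sub] DE(2) by simp
  qed
  have right: "int (card (V \<omega>)) \<ge> \<nu> s - int (card ?DF) - int (wt e)"
  proof -
    let ?N = "{T \<in> ?DJ. T - s \<in> nongaps}" and ?X = "{T. T - s \<in> ?DE}"
    have X: "?X = (\<lambda>t. t + s) ` ?DE"
      by (auto simp: image_iff intro!: bexI[of _ "_ - s"])
    have Xc: "finite ?X" "card ?X = wt e"
      unfolding X using DE by (simp_all add: card_image)
    \<comment> \<open>At a position in \<open>DG\<close> with \<open>T - s\<close> outside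
      \<open>?DE\<close> some element of \<open>M\<close> votes correctly, though it need not come
      from \<open>B\<close>. A basis element dividing its leading monomial votes at the same
      position, and \<open>agree\<close> forces the same value.\<close>
    have "?N \<subseteq> V \<omega> \<union> (?DJ - ?DG) \<union> ?X"
    proof
      fix T assume T: "T \<in> ?N"
      show "T \<in> V \<omega> \<union> (?DJ - ?DG) \<union> ?X"
      proof (rule ccontr)
        assume neg: "\<not> ?thesis"
        then have TG: "T \<in> ?DG" and TE: "T - s \<notin> ?DE" and TV: "T \<notin> V \<omega>"
          using T by auto
        obtain g where g: "g \<in> M" "votes_for s (T - s) \<omega> g" "isF s (T - s) g"
          using loc TE T by blast
        obtain F t where F: "F \<in> B" "isF s t F" "T - s - t \<in> nongaps"
          using gb_F[OF gb g(1,3)] by metis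
        then have "T \<in> V (w_of s F)"
          using TG by (auto simp: V_def algebra_simps intro!: bexI[of _ F] exI[of _ t])
        then obtain f where "f \<in> M" "votes_for s (T - s) (w_of s F) f"
          using V_vote by blast
        then have "w_of s F = \<omega>"
          using agree[OF TG _ g(1) _ g(2)] by blast
        then show False using TV \<open>T \<in> V (w_of s F)\<close> by simp
      qed
    qed
    moreover have "finite (V \<omega>)"
      using stairs(1) by (simp add: V_def)
    ultimately have "card ?N \<le> card (V \<omega> \<union> (?DJ - ?DG) \<union> ?X)"
      using DJ(1) Xc by (intro card_mono) auto
    also have "\<dots> \<le> card (V \<omega>) + card (?DJ - ?DG) + card ?X"
      using card_Un_le[of "V \<omega> \<union> (?DJ - ?DG)" ?X] card_Un_le[of "V \<omega>" "?DJ - ?DG"] by linarith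
    \<comment> \<open>\<open>?DJ\<close> has as many elements as the two stairs together, and it
      contains \<open>?DG\<close>.\<close>
    also have "card (?DJ - ?DG) = card ?DF"
      using card_Diff_subset[OF stairs(1) DG_sub] stairs(3) DJ(2) by simp
    finally show ?thesis
      using \<nu>_le[OF s] Xc by simp
  qed
  have DFE: "card ?DF \<le> wt e"
    using card_mono[OF DE(1) DF_sub] DE(2) by simp
  \<comment> \<open>The algorithm maximises over values proposed by some basis element, so
    \<open>\<omega>\<close> must be shown to be among them; it has a positive number of votes
    because \<open>|DF| \<le> wt e\<close>.\<close>
  show "\<omega> \<in> candidates s B"
  proof -
    have "card (V \<omega>) > 0" using right \<nu> DFE by simp
    then have "V \<omega> \<noteq> {}" by auto
    then obtain F t where "F \<in> B" "isF s t F" "w_of s F = \<omega>" by (auto simp: V_def)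
    then show ?thesis
      unfolding candidates_def F_part_eq[OF BM(2)] by blast
  qed
  show "votes s B k < votes s B \<omega>" if "k \<noteq> \<omega>"
    using wrong[OF that] right \<nu> unfolding votes by simp
qed

text \<open>Substituting with \<open>- k\<close> is the inverse, so elements of the new module are
  pulled back to the old one; leading monomials are the same on both sides.\<close>

lemma subst_gb:
  assumes s: "s \<in> nongaps" and gb: "gb s (interp_module v) B"
  shows "gb s (interp_module (v - ev (const k * \<phi> s))) ((\<lambda>f. mod_subst f (const k * \<phi> s)) ` B)"
proof -
  let ?g = "const k * \<phi> s"
  have B: "finite B" "B \<subseteq> interp_module v" "0 \<notin> B"
    using gb by (auto simp: gb_def)
  have mem: "mod_subst f g \<in> interp_module (w - ev g)" if "f \<in> interp_module w" for f g w
    using that by (simp add: interp_module_def mod_subst_def algebra_simps)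
  have inv: "mod_subst (mod_subst f g) (- g) = f" for f g
    by (simp add: mod_subst_def)
  have unsubst: "mod_subst f (const (- k) * \<phi> s) \<in> interp_module v"
    if "f \<in> interp_module (v - ev ?g)" for f
  proof -
    have "ev (- ?g) = - ev ?g" by (simp add: vec_eq_iff)
    then show ?thesis
      using mem[OF that, of "- ?g"] by (simp add: const_minus)
  qed
  show ?thesis
  proof (rule gbI)
    show "0 \<notin> (\<lambda>f. mod_subst f ?g) ` B"
    proof
      assume "0 \<in> (\<lambda>f. mod_subst f ?g) ` B"
      then obtain f where "f \<in> B" "mod_subst f ?g = 0" by auto
      then have "f = 0" by (auto simp: mod_subst_def zero_prod_def prod_eq_iff)
      with \<open>f \<in> B\<close> B show False by simp
    qed
    fix f t assume f: "f \<in> interp_module (v - ev ?g)"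
    let ?f = "mod_subst f (const (- k) * \<phi> s)"
    show "\<exists>G\<in>(\<lambda>f. mod_subst f ?g) ` B. \<exists>q. isG s q G \<and> t - q \<in> nongaps" if "isG s t f"
    proof -
      obtain G q where "G \<in> B" "isG s q G" "t - q \<in> nongaps"
        using gb_G[OF gb unsubst[OF f] isG_subst[OF s \<open>isG s t f\<close>]] by metis
      then show ?thesis using isG_subst[OF s] by blast
    qed
    show "\<exists>F\<in>(\<lambda>f. mod_subst f ?g) ` B. \<exists>q. isF s q F \<and> t - q \<in> nongaps" if "isF s t f"
    proof -
      obtain F q where "F \<in> B" "isF s q F" "t - q \<in> nongaps"
        using gb_F[OF gb unsubst[OF f] isF_subst[OF s \<open>isF s t f\<close>]] by metis
      then show ?thesis using isF_subst[OF s] by blast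
    qed
  qed (use B mem in auto)
qed

end

section \<open>Correctness of the decoder\<close>

context mk_code
begin

text \<open>Multiplication by \<open>x\<close> raises the degree by \<open>a\<close>, so one element
  of least degree in each occupied residue class modulo \<open>a\<close> suffices.\<close>

lemma groebner_ideal_exists: "\<exists>E. groebner_ideal J E"
proof -
  let ?T = "{t. \<exists>f\<in>J. has_deg t f}"
  have J_mult: "r * f \<in> J" if "f \<in> J" for r f
    using that by (simp add: J_iff)
  have nonneg: "t \<ge> 0" if "t \<in> ?T" for t
    using that has_deg_nongap nongaps_nonneg by blast
  define least where "least r = (LEAST n. int n \<in> ?T \<and> n mod a = r)" for r
  have least: "int (least r) \<in> ?T \<and> least r mod a = r \<and> least r \<le> n"
    if "int n \<in> ?T" "n mod a = r" for n r
    unfolding least_def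
    using LeastI[of "\<lambda>n. int n \<in> ?T \<and> n mod a = r" n] Least_le[of "\<lambda>n. int n \<in> ?T \<and> n mod a = r" n] that
    by blast
  define g where "g r = (SOME f. f \<in> J \<and> has_deg (int (least r)) f)" for r
  have g: "g r \<in> J \<and> has_deg (int (least r)) (g r)" if "int (least r) \<in> ?T" for r
    unfolding g_def by (rule someI_ex) (use that in blast)
  let ?E = "g ` {r \<in> {..<a}. int (least r) \<in> ?T}"
  have "groebner_ideal J ?E"
    unfolding groebner_ideal_def
  proof (intro conjI ballI impI)
    show "?E \<subseteq> J - {0}"
      using g has_deg_nonzero by fastforce
    fix f assume f: "f \<in> J" "f \<noteq> 0"
    then have fT: "\<delta> f \<in> ?T" using has_degI by blast
    define n where "n = nat (\<delta> f)"
    have n: "int n = \<delta> f" using nonneg[OF fT] by (simp add: n_def)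
    let ?r = "n mod a"
    have l: "int (least ?r) \<in> ?T" "least ?r mod a = ?r" "least ?r \<le> n"
      using least[of n ?r] fT n by auto
    have "a dvd n - least ?r"
      using l(2,3) by (metis mod_eq_dvd_iff_nat)
    then obtain i where "n - least ?r = a * i" ..
    then have "\<delta> f - int (least ?r) = int a * int i + int b * 0"
      using l(3) n by (metis add.right_neutral mult_zero_right of_nat_diff of_nat_mult)
    then have "\<delta> f - int (least ?r) \<in> nongaps"
      using nongap_iff[of 0 "int i"] a_pos by simp
    moreover have "has_deg (int (least ?r)) (g ?r)" using g l(1) by blast
    ultimately have "divides (lm (g ?r)) (lm f)"
      using f has_deg_nongap[OF has_degI[OF f(2)]] has_deg_nongap
      by (simp add: lm_eq lm_eq[OF has_degI[OF f(2)]] divides_\<phi>)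
    then show "\<exists>g\<in>?E. divides (lm g) (lm f)"
      using l(1) a_pos by (intro bexI[of _ "g ?r"]) auto
  qed simp
  then show ?thesis by blast
qed

text \<open>If \<open>f\<close> leads in \<open>R\<close>, then \<open>snd f + fst f * h\<close>
  lies in \<open>J\<close> and has the degree of \<open>snd f\<close>, as \<open>h\<close> weighs at
  most as much as \<open>z\<close>. If \<open>f\<close> leads in \<open>R z\<close>, then
  \<open>z - h\<close> divides. The bound on \<open>h\<close> by \<open>N + 1\<close> also admits
  \<open>h = 0\<close> with \<open>N = - 1\<close>.\<close>

lemma initial_gb:
  assumes E: "groebner_ideal J E" and h: "below (N + 1) h"
  shows "gb N (interp_module (ev h)) ({(0, \<eta>) | \<eta>. \<eta> \<in> E} \<union> {(1, - h)})"
proof -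
  let ?B = "{(0 :: 'r, \<eta>) | \<eta>. \<eta> \<in> E} \<union> {(1, - h)}"
  show ?thesis
  proof (rule gbI)
    have E': "finite E" "E \<subseteq> J - {0}" "\<And>f. f \<in> J \<Longrightarrow> f \<noteq> 0 \<Longrightarrow> \<exists>g\<in>E. divides (lm g) (lm f)"
      using E by (auto simp: groebner_ideal_def)
    have im: "{(0 :: 'r, \<eta>) | \<eta>. \<eta> \<in> E} = Pair 0 ` E" by auto
    show "finite ?B"
      unfolding im using E'(1) by simp
    show "?B \<subseteq> interp_module (ev h)"
      using E'(2) by (auto simp: interp_module_def J_iff)
    show "0 \<notin> ?B"
      using E'(2) by (auto simp: zero_prod_def)
    fix f t assume f: "f \<in> interp_module (ev h)"
    show "\<exists>G\<in>?B. \<exists>q. isG N q G \<and> t - q \<in> nongaps" if t: "isG N t f"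
    proof -
      let ?g = "snd f + fst f * h"
      have "?g \<in> J"
        using f by (simp add: interp_module_def J_iff add.commute)
      moreover have "below t (fst f * h)"
      proof (cases "fst f = 0 \<or> h = 0")
        case False
        then show ?thesis
          using t h by (auto simp: isG_def below_def \<delta>_mult)
      qed auto
      then have deg: "has_deg t ?g"
        using t by (intro has_deg_add_below) (simp_all add: isG_def)
      ultimately obtain \<eta> where \<eta>: "\<eta> \<in> E" "divides (lm \<eta>) (lm ?g)"
        using E'(3) has_deg_nonzero by blast
      then have "\<eta> \<noteq> 0" using E'(2) by blast
      from has_degI[OF this] have d: "has_deg (\<delta> \<eta>) \<eta>" .
      have "t - \<delta> \<eta> \<in> nongaps"
        using \<eta>(2) has_deg_nongap[OF d] has_deg_nongap[OF deg]
        by (simp add: lm_eq[OF d] lm_eq[OF deg] divides_\<phi>)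
      moreover have "isG N (\<delta> \<eta>) (0, \<eta>)"
        using d by (simp add: isG_def)
      ultimately show ?thesis
        using \<eta>(1) by blast
    qed
    show "\<exists>F\<in>?B. \<exists>q. isF N q F \<and> t - q \<in> nongaps" if t: "isF N t f"
    proof -
      have "isF N 0 (1, - h)"
        using h has_deg_const[of 1] by (simp add: isF_def below_minus)
      moreover have "t - 0 \<in> nongaps"
        using isF_nongap[OF t] by simp
      ultimately show ?thesis by blast
    qed
  qed
qed

text \<open>The part of the message still unknown when iteration \<open>s\<close> begins. Keeping
  both bounds gives the whole message for \<open>s \<ge> u\<close> and zero for
  \<open>s = - 1\<close>.\<close>

definition msg :: "(int \<Rightarrow> 'a) \<Rightarrow> int \<Rightarrow> 'r" where
  "msg \<omega> s = (\<Sum>t\<in>{t \<in> nongaps. t \<le> int u \<and> t \<le> s}. const (\<omega> t) * \<phi> t)"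

lemma finite_msg: "finite {t \<in> nongaps. t \<le> int u \<and> t \<le> s}"
  by (rule finite_subset[OF _ nongaps_upto_u(1)]) auto

lemma below_msg: "below (s + 1) (msg \<omega> s)"
  unfolding msg_def
  by (intro below_sum below_const_mult) (auto intro: has_deg_imp_below[OF has_deg_\<phi>])

lemma msg_diff:
  "msg \<omega> s = msg \<omega> (s - 1) + (if s \<in> nongaps \<and> s \<le> int u then const (\<omega> s) * \<phi> s else 0)"
proof (cases "s \<in> nongaps \<and> s \<le> int u")
  case True
  then have "{t \<in> nongaps. t \<le> int u \<and> t \<le> s} = insert s {t \<in> nongaps. t \<le> int u \<and> t \<le> s - 1}"
    by auto
  then show ?thesis
    using True finite_msg[of "s - 1"] by (simp add: msg_def)
next
  case False
  then have "{t \<in> nongaps. t \<le> int u \<and> t \<le> s} = {t \<in> nongaps. t \<le> int u \<and> t \<le> s - 1}"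
    by (auto simp: order_le_less)
  then show ?thesis
    using False by (auto simp: msg_def)
qed

section \<open>The invariant of the main loop\<close>

context
  fixes \<omega> :: "int \<Rightarrow> 'a" and e :: "'a ^ 'n"
  assumes d_u: "d_u > 2 * int (wt e)"
begin

text \<open>Justifies the initial value zero at nongaps never visited. If \<open>m\<close> is the
  largest exception, \<open>h - msg \<omega> u\<close> has degree \<open>m\<close> and evaluates to
  \<open>e\<close>, so \<open>\<nu> m \<le> wt e\<close>.\<close>

lemma omega_zero_above:
  assumes h: "ev h = ev (msg \<omega> (int u)) + e" "below (N + 1) h"
    and t: "t \<in> nongaps" "t \<le> int u" "N < t"
  shows "\<omega> t = 0"
proof (rule ccontr)
  assume nz: "\<omega> t \<noteq> 0"
  let ?T = "{t \<in> nongaps. t \<le> int u \<and> N < t \<and> \<omega> t \<noteq> 0}"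
  have fin: "finite ?T"
    by (rule finite_subset[OF _ nongaps_upto_u(1)]) auto
  define m where "m = Max ?T"
  have m: "m \<in> ?T" "\<And>t. t \<in> ?T \<Longrightarrow> t \<le> m"
  proof -
    have "t \<in> ?T" using t nz by simp
    then show "m \<in> ?T"
      unfolding m_def using fin by (intro Max_in) blast+
    show "t \<le> m" if "t \<in> ?T" for t
      unfolding m_def using fin that by (rule Max_ge)
  qed
  \<comment> \<open>The index set as \<open>msg \<omega> (int u)\<close> unfolds to it, hence the
    repeated condition.\<close>
  let ?A = "{t \<in> nongaps. t \<le> int u \<and> t \<le> int u}"
  have "below m (const (\<omega> t) * \<phi> t)" if "t \<in> ?A - {m}" for t
  proof (cases "t < m")
    case True
    then show ?thesis
      using that by (intro below_const_mult has_deg_imp_below[OF has_deg_\<phi>]) auto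
  next
    case False
    then have "\<omega> t = 0" using m that by force
    then show ?thesis by simp
  qed
  then have "below m (\<Sum>t\<in>?A - {m}. const (\<omega> t) * \<phi> t)"
    by (rule below_sum)
  moreover have "has_deg m (const (\<omega> m) * \<phi> m)"
    using m(1) by (intro has_deg_const_mult has_deg_\<phi>) auto
  ultimately have "has_deg m (const (\<omega> m) * \<phi> m + (\<Sum>t\<in>?A - {m}. const (\<omega> t) * \<phi> t))"
    by (intro has_deg_add_below)
  then have "has_deg m (msg \<omega> (int u))"
    unfolding msg_def using m(1) finite_msg[of "int u"] by (subst sum.remove[of _ m]) auto
  moreover have "below m h"
    using h(2) m(1) by (auto intro: below_mono)
  ultimately have "has_deg m (h - msg \<omega> (int u))"
    by (rule has_deg_below_diff)
  moreover have "ev (h - msg \<omega> (int u)) = e"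
    using h(1) by (auto simp: vec_eq_iff algebra_simps)
  ultimately have "\<nu> m \<le> int (wt e)"
    using \<nu>_le_wt_ev by force
  then show False
    using d_u d_u_le[of m] m(1) by force
qed

text \<open>At \<open>s = - 1\<close> the second conjunct reaches every nongap up to
  \<open>u\<close>, nongaps being nonnegative; the final output is read off from it.\<close>

definition state_ok :: "int \<Rightarrow> ('r \<times> 'r) set \<Rightarrow> (int \<Rightarrow> 'a) \<Rightarrow> bool" where
  "state_ok s B w \<longleftrightarrow> gb s (interp_module (ev (msg \<omega> s) + e)) B \<and>
     (\<forall>t\<in>nongaps. t \<le> int u \<longrightarrow> s < t \<longrightarrow> w t = \<omega> t)"

lemma initial_state_ok:
  assumes E: "groebner_ideal J E" and h: "ev h = ev (msg \<omega> (int u)) + e"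
  shows "state_ok (if h = 0 then - 1 else \<delta> h) ({(0, \<eta>) | \<eta>. \<eta> \<in> E} \<union> {(1, - h)}) (\<lambda>_. 0)"
proof -
  let ?N = "if h = 0 then - 1 else \<delta> h"
  have hN: "below (?N + 1) h"
    by (simp add: below_def)
  note zero = omega_zero_above[OF h hN]
  \<comment> \<open>Starting at \<open>?N\<close> instead of \<open>u\<close> loses nothing, because
    the omitted coefficients vanish.\<close>
  have "msg \<omega> ?N = msg \<omega> (int u)"
    unfolding msg_def
  proof (intro sum.mono_neutral_left finite_msg ballI)
    fix t assume "t \<in> {t \<in> nongaps. t \<le> int u \<and> t \<le> int u} - {t \<in> nongaps. t \<le> int u \<and> t \<le> ?N}"
    then show "const (\<omega> t) * \<phi> t = 0"
      using zero[of t] by (cases "t \<le> ?N") auto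
  qed auto
  then show ?thesis
    using initial_gb[OF E hN] zero unfolding state_ok_def h by auto
qed

text \<open>The winner is strict, so the nondeterministic choice has a single outcome. The
  equivalence serves both existence of a step and preservation of the invariant.\<close>

lemma step_M1_correct:
  assumes ok: "state_ok s B w"
  shows "step_M1 s B w B' w' \<longleftrightarrow>
    (if s \<in> nongaps \<and> s \<le> int u
     then B' = (\<lambda>f. mod_subst f (const (\<omega> s) * \<phi> s)) ` B \<and> w' = w(s := \<omega> s)
     else B' = B \<and> w' = w)"
proof (cases "s \<in> nongaps \<and> s \<le> int u")
  case True
  have \<nu>: "\<nu> s > 2 * int (wt e)"
    using d_u d_u_le[of s] True by simp
  have "below s (msg \<omega> s - const (\<omega> s) * \<phi> s)"
    using below_msg[of "s - 1" \<omega>] msg_diff[of \<omega> s] True by simp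
  note wins = correct_value_wins[OF conjunct1[OF True] \<nu> this refl]
  have gb: "gb s (interp_module (ev (msg \<omega> s) + e)) B"
    using ok by (simp add: state_ok_def)
  have sel: "k \<in> candidates s B \<and> (\<forall>k'\<in>candidates s B. votes s B k' \<le> votes s B k) \<longleftrightarrow> k = \<omega> s" for k
    using wins[OF gb] by (metis leD less_imp_le order_refl)
  have "(\<exists>k\<in>candidates s B. (\<forall>k'\<in>candidates s B. votes s B k' \<le> votes s B k) \<and> Q k) \<longleftrightarrow> Q (\<omega> s)" for Q
    by (simp only: Bex_def sel simp_thms flip: conj_assoc)
  then show ?thesis
    using True unfolding step_M1_def by simp
qed (auto simp: step_M1_def)

lemma state_ok_M1:
  assumes ok: "state_ok s B w" and M1: "step_M1 s B w B' w'"
  shows "gb s (interp_module (ev (msg \<omega> (s - 1)) + e)) B'"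
    and "\<forall>t\<in>nongaps. t \<le> int u \<longrightarrow> s - 1 < t \<longrightarrow> w' t = \<omega> t"
proof -
  have gb: "gb s (interp_module (ev (msg \<omega> s) + e)) B"
    using ok by (simp add: state_ok_def)
  note M1' = M1[unfolded step_M1_correct[OF ok]]
  show "gb s (interp_module (ev (msg \<omega> (s - 1)) + e)) B'"
  proof (cases "s \<in> nongaps \<and> s \<le> int u")
    case True
    then have eq: "ev (msg \<omega> s) + e - ev (const (\<omega> s) * \<phi> s) = ev (msg \<omega> (s - 1)) + e"
      using msg_diff[of \<omega> s] by (simp add: vec_eq_iff)
    show ?thesis
      using subst_gb[OF conjunct1[OF True] gb, of "\<omega> s", unfolded eq] M1' True by simp
  next
    case False
    then have "msg \<omega> s = msg \<omega> (s - 1)" using msg_diff[of \<omega> s] by auto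
    then show ?thesis using M1' gb False by auto
  qed
  show "\<forall>t\<in>nongaps. t \<le> int u \<longrightarrow> s - 1 < t \<longrightarrow> w' t = \<omega> t"
  proof (intro ballI impI)
    fix t assume "t \<in> nongaps" "t \<le> int u" "s - 1 < t"
    then show "w' t = \<omega> t"
      using M1' ok by (cases "t = s") (auto simp: state_ok_def split: if_splits)
  qed
qed

lemma state_ok_main_step:
  assumes "state_ok s B w" "main_step s B w B' w'"
  shows "state_ok (s - 1) B' w'"
  using assms state_ok_M1 step_M2_gb[OF _ submod_interp_module]
  unfolding main_step_def state_ok_def by blast

lemma main_step_exists:
  assumes ok: "state_ok s B w"
  shows "\<exists>B' w'. main_step s B w B' w'"
proof -
  obtain Bt w' where M1: "step_M1 s B w Bt w'"
    unfolding step_M1_correct[OF ok] by (cases "s \<in> nongaps \<and> s \<le> int u") auto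
  then show ?thesis
    using step_M2_exists[OF state_ok_M1(1)[OF ok M1] submod_interp_module]
    unfolding main_step_def by blast
qed

lemma exec_state_ok:
  assumes "exec (ev (msg \<omega> (int u)) + e) s B w"
  shows "state_ok s B w"
  using assms
proof induction
  case (initialize E h)
  then show ?case by (intro initial_state_ok)
next
  case (main s B w B' w')
  then show ?case by (intro state_ok_main_step)
qed

lemma decoding_correct: "outputs (ev (msg \<omega> (int u)) + e) \<omega>"
  unfolding outputs_def
proof (intro conjI allI impI ballI)
  obtain E h where "groebner_ideal J E" "ev h = ev (msg \<omega> (int u)) + e"
    using groebner_ideal_exists ev_surj by blast
  then show "\<exists>s B w. exec (ev (msg \<omega> (int u)) + e) s B w"
    using exec.initialize by blast
  show "\<exists>B' w'. main_step s B w B' w'" if "exec (ev (msg \<omega> (int u)) + e) s B w \<and> 0 \<le> s" for s B w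
    using main_step_exists exec_state_ok that by blast
  show "w s = \<omega> s"
    if "exec (ev (msg \<omega> (int u)) + e) (- 1) B w" "s \<in> nongaps" "s \<le> int u" for B w s
    using exec_state_ok[OF that(1)] that(2,3) nongaps_nonneg[OF that(2)] by (auto simp: state_ok_def)
qed

end

end

theorem theorem4p4:
  fixes a b :: nat
    and c :: "nat \<Rightarrow> nat \<Rightarrow> 'a::field"
    and d :: 'a
    and cls :: "'a poly poly \<Rightarrow> 'r::comm_ring_1"
    and \<delta> :: "'r \<Rightarrow> int"
    and P :: "'n::finite \<Rightarrow> 'a \<times> 'a"
    and u :: nat
    and \<omega> :: "int \<Rightarrow> 'a"
    and \<mu> :: 'r
    and cw e v :: "'a ^ 'n"
  assumes code: "mk_code a b c d cls \<delta> P u"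
    and message: "\<mu> = (\<Sum>s\<in>{s \<in> mk_curve.nongaps \<delta>. s \<le> int u}.
                         mk_curve.const cls (\<omega> s) * mk_curve.\<phi> a cls \<delta> s)"
    and codeword: "cw = mk_code.ev cls P \<mu>" "cw \<in> mk_code.C_u cls \<delta> P u"
    and received: "v = cw + e"
  shows "(mk_code.d_u a cls \<delta> P u > 2 * int (wt e) \<longrightarrow> mk_code.outputs a cls \<delta> P u v \<omega>)
         \<and> mk_code.d_u a cls \<delta> P u \<ge> int CARD('n) - int u"
proof -
  interpret mk_code a b c d cls \<delta> P u by (rule code)
  have "v = ev (msg \<omega> (int u)) + e"
    using received codeword message by (simp add: msg_def)
  then show ?thesis
    using decoding_correct d_u_ge by blast
qed

end
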